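(* Let $G$ be a topological group and $(X,d)$ a compact metric $G$-space. The following properties are equivalent: (1) $X$ is RN. (2) $X$ is HAE. (3) Every (nonempty) closed $G$-subsystem $Y$ of $X$ has a point of equicontinuity. (4) $X$ is HNS. (5) $X$ is $d_G$-fragmented, where $d_G(x,x')=\sup_{g\in G}d(gx,gx')$. (6) $(X,d_G)$ is separable. (7) Every continuous function $F:X\to\mathbb{R}$ is s-Asplund.
   Context: A compact metric $G$-space is a compact metric space $(X,d)$ with a (jointly) continuous left action $G\times X\to X$ of the topological group $G$. A $G$-subsystem is a nonempty closed $G$-invariant subset with the restricted action. RN: a Banach space $V$ is Asplund if every separable Banach subspace of $V$ has separable dual. $\mathrm{Iso}(V)$ is the group of linear isometries of $V$ onto itself. $X$ is Radon-Nikodým (RN) if there exist an Asplund space $V$, a strongly continuous co-homomorphism $h:G\to \mathrm{Iso}(V)$ (i.e. $h(gg')=h(g')h(g)$, and $g\mapsto h(g)v$ is norm continuous for each $v\in V$), and a bounded topological embedding $\alpha:X\to(V^*,\text{weak}^* )$ with $\alpha(gx)=g\alpha(x)$, where $(g\varphi)(v)=\varphi(h(g)(v))$. A point $x_0$ of a system $Y$ is a point of equicontinuity if for every $\varepsilon>0$ there is a neighborhood $U$ of $x_0$ in $Y$ with $d(gx_0,gx)<\varepsilon$ for all $x\in U$, $g\in G$. $Y$ is almost equicontinuous (AE) if its points of equicontinuity are dense in $Y$. $X$ is hereditarily almost equicontinuous (HAE) if every closed $G$-subspace of $X$ is AE. $Y$ is not sensitive (NS) if for every $\varepsilon>0$ there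 is a nonempty open $O\subset Y$ whose $d_G$-diameter is less than $\varepsilon$. $X$ is hereditarily not sensitive (HNS) if every nonempty closed $G$-subspace of $X$ is NS. $X$ is $d_G$-fragmented if for every nonempty $A\subset X$ and $\varepsilon>0$ there is an open (in the topology of $d$) $O\subset X$ such that $O\cap A\ne\emptyset$ and $O\cap A$ has $d_G$-diameter less than $\varepsilon$. A continuous $F:X\to\mathbb R$ is s-Asplund if the pseudometric space $(X,\rho_{G,F})$ is separable, where $\rho_{G,F}(x,y)=\sup_{g\in G}|F(gx)-F(gy)|$. *)

theory Defs
  imports "HOL-Analysis.Analysis"
begin

subsection \<open>Real Banach spaces with an explicit carrier\<close>

text \<open>
  The Radon-Nikodym property quantifies existentially over Banach spaces, so these have to be
  objects rather than types of class \<open>banach\<close>.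
\<close>

record 'v vspace =
  vcarrier :: "'v set"
  vzero :: "'v"
  vadd :: "'v \<Rightarrow> 'v \<Rightarrow> 'v"
  vscale :: "real \<Rightarrow> 'v \<Rightarrow> 'v"
  vnorm :: "'v \<Rightarrow> real"

text \<open>Set to 0 off the carrier, since \<^locale>\<open>Metric_space\<close> asks for nonnegativity on the whole type.\<close>

definition vdist :: "'v vspace \<Rightarrow> 'v \<Rightarrow> 'v \<Rightarrow> real" where
  "vdist V x y =
    (if x \<in> vcarrier V \<and> y \<in> vcarrier V then vnorm V (vadd V x (vscale V (-1) y)) else 0)"

definition vtopology :: "'v vspace \<Rightarrow> 'v topology" where
  "vtopology V = Metric_space.mtopology (vcarrier V) (vdist V)"

locale normed_vspace =
  fixes V :: "'v vspace"
  assumes zero_closed: "vzero V \<in> vcarrier V"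
    and add_closed: "\<lbrakk>x \<in> vcarrier V; y \<in> vcarrier V\<rbrakk> \<Longrightarrow> vadd V x y \<in> vcarrier V"
    and scale_closed: "x \<in> vcarrier V \<Longrightarrow> vscale V a x \<in> vcarrier V"
    and add_assoc: "\<lbrakk>x \<in> vcarrier V; y \<in> vcarrier V; z \<in> vcarrier V\<rbrakk>
          \<Longrightarrow> vadd V (vadd V x y) z = vadd V x (vadd V y z)"
    and add_commute: "\<lbrakk>x \<in> vcarrier V; y \<in> vcarrier V\<rbrakk> \<Longrightarrow> vadd V x y = vadd V y x"
    and add_zero: "x \<in> vcarrier V \<Longrightarrow> vadd V (vzero V) x = x"
    and add_inverse: "x \<in> vcarrier V \<Longrightarrow> \<exists>y\<in>vcarrier V. vadd V x y = vzero V"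
    and scale_add_right: "\<lbrakk>x \<in> vcarrier V; y \<in> vcarrier V\<rbrakk>
          \<Longrightarrow> vscale V a (vadd V x y) = vadd V (vscale V a x) (vscale V a y)"
    and scale_add_left: "x \<in> vcarrier V
          \<Longrightarrow> vscale V (a + b) x = vadd V (vscale V a x) (vscale V b x)"
    and scale_scale: "x \<in> vcarrier V \<Longrightarrow> vscale V a (vscale V b x) = vscale V (a * b) x"
    and scale_one: "x \<in> vcarrier V \<Longrightarrow> vscale V 1 x = x"
    and norm_nonneg: "x \<in> vcarrier V \<Longrightarrow> 0 \<le> vnorm V x"
    and norm_eq_zero: "x \<in> vcarrier V \<Longrightarrow> vnorm V x = 0 \<longleftrightarrow> x = vzero V"
    and norm_scale: "x \<in> vcarrier V \<Longrightarrow> vnorm V (vscale V a x) = \<bar>a\<bar> * vnorm V x"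
    and norm_triangle: "\<lbrakk>x \<in> vcarrier V; y \<in> vcarrier V\<rbrakk>
          \<Longrightarrow> vnorm V (vadd V x y) \<le> vnorm V x + vnorm V y"

locale banach_vspace = normed_vspace +
  assumes complete: "Metric_space.mcomplete (vcarrier V) (vdist V)"

text \<open>
  Continuous linear functionals. They are extensional, so that equality of functions is equality
  of functionals, and so that the dual is a subset of the topological space carrying the
  product topology.
\<close>

definition dual :: "'v vspace \<Rightarrow> ('v \<Rightarrow> real) set" where
  "dual V = {f \<in> extensional (vcarrier V).
     (\<forall>x\<in>vcarrier V. \<forall>y\<in>vcarrier V. f (vadd V x y) = f x + f y) \<and>
     (\<forall>a. \<forall>x\<in>vcarrier V. f (vscale V a x) = a * f x) \<and>
     (\<exists>C. \<forall>x\<in>vcarrier V. \<bar>f x\<bar> \<le> C * vnorm V x)}"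

definition dual_norm :: "'v vspace \<Rightarrow> ('v \<Rightarrow> real) \<Rightarrow> real" where
  "dual_norm V f = (SUP x\<in>{x \<in> vcarrier V. vnorm V x \<le> 1}. \<bar>f x\<bar>)"

definition weak_star :: "'v vspace \<Rightarrow> ('v \<Rightarrow> real) topology" where
  "weak_star V = subtopology (product_topology (\<lambda>_. euclideanreal) (vcarrier V)) (dual V)"

text \<open>Separability of a set with respect to a pseudometric, hence not \<^const>\<open>separable_space\<close>
  of a \<^locale>\<open>Metric_space\<close>.\<close>

definition pm_separable :: "'a set \<Rightarrow> ('a \<Rightarrow> 'a \<Rightarrow> real) \<Rightarrow> bool" where
  "pm_separable S \<rho> \<longleftrightarrow>
     (\<exists>D. D \<subseteq> S \<and> countable D \<and> (\<forall>x\<in>S. \<forall>\<epsilon>>0. \<exists>y\<in>D. \<rho> x y < \<epsilon>))"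

definition Asplund :: "'v vspace \<Rightarrow> bool" where
  "Asplund V \<longleftrightarrow> banach_vspace V \<and>
     (\<forall>W. W \<subseteq> vcarrier V \<longrightarrow> banach_vspace (V\<lparr>vcarrier := W\<rparr>) \<longrightarrow> pm_separable W (vdist V) \<longrightarrow>
        pm_separable (dual (V\<lparr>vcarrier := W\<rparr>))
          (\<lambda>f f'. dual_norm (V\<lparr>vcarrier := W\<rparr>) (\<lambda>v. f v - f' v)))"

text \<open>Values outside the carrier are irrelevant.\<close>

definition Iso :: "'v vspace \<Rightarrow> ('v \<Rightarrow> 'v) set" where
  "Iso V = {T. bij_betw T (vcarrier V) (vcarrier V) \<and>
     (\<forall>x\<in>vcarrier V. \<forall>y\<in>vcarrier V. T (vadd V x y) = vadd V (T x) (T y)) \<and>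
     (\<forall>a. \<forall>x\<in>vcarrier V. T (vscale V a x) = vscale V a (T x)) \<and>
     (\<forall>x\<in>vcarrier V. vnorm V (T x) = vnorm V x)}"


subsection \<open>Metric \<open>G\<close>-spaces\<close>

text \<open>
  The library's topological groups are those of class \<^class>\<open>topological_group_add\<close>. Despite the
  additive notation they need be neither abelian nor Hausdorff: \<open>g + g'\<close> is the product of
  \<open>g\<close> and \<open>g'\<close> in this order and \<open>0\<close> is the neutral element.
\<close>

definition continuous_action ::
  "('g::topological_group_add \<Rightarrow> 'x::metric_space \<Rightarrow> 'x) \<Rightarrow> bool" where
  "continuous_action act \<longleftrightarrow>
     (\<forall>x. act 0 x = x) \<and>
     (\<forall>g g' x. act (g + g') x = act g (act g' x)) \<and>
     continuous_on UNIV (\<lambda>(g, x). act g x)"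

definition closed_invariant :: "('g \<Rightarrow> 'x::metric_space \<Rightarrow> 'x) \<Rightarrow> 'x set \<Rightarrow> bool" where
  "closed_invariant act Y \<longleftrightarrow> closed Y \<and> (\<forall>g. act g ` Y \<subseteq> Y)"

definition subsystem :: "('g \<Rightarrow> 'x::metric_space \<Rightarrow> 'x) \<Rightarrow> 'x set \<Rightarrow> bool" where
  "subsystem act Y \<longleftrightarrow> Y \<noteq> {} \<and> closed_invariant act Y"

definition dG :: "('g \<Rightarrow> 'x::metric_space \<Rightarrow> 'x) \<Rightarrow> 'x \<Rightarrow> 'x \<Rightarrow> real" where
  "dG act x y = (SUP g. dist (act g x) (act g y))"

definition rhoG :: "('g \<Rightarrow> 'x \<Rightarrow> 'x) \<Rightarrow> ('x \<Rightarrow> real) \<Rightarrow> 'x \<Rightarrow> 'x \<Rightarrow> real" where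
  "rhoG act F x y = (SUP g. \<bar>F (act g x) - F (act g y)\<bar>)"

definition pm_diameter :: "('a \<Rightarrow> 'a \<Rightarrow> real) \<Rightarrow> 'a set \<Rightarrow> real" where
  "pm_diameter \<rho> A = (if A = {} then 0 else SUP (x, y)\<in>A \<times> A. \<rho> x y)"

text \<open>
  The type argument is the type in which the carrier of the Asplund space lives.
  The co-homomorphism \<open>h\<close> is contravariant: \<open>h (g + g')\<close> is \<open>h g'\<close> after \<open>h g\<close>.
\<close>

definition RN ::
  "'v itself \<Rightarrow> ('g::topological_group_add \<Rightarrow> 'x::metric_space \<Rightarrow> 'x) \<Rightarrow> bool" where
  "RN (ty :: 'v itself) act \<longleftrightarrow>
     (\<exists>(V :: 'v vspace) (h :: 'g \<Rightarrow> 'v \<Rightarrow> 'v) (\<alpha> :: 'x \<Rightarrow> 'v \<Rightarrow> real).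
        Asplund V \<and>
        (\<forall>g. h g \<in> Iso V) \<and>
        (\<forall>g g'. \<forall>v\<in>vcarrier V. h (g + g') v = h g' (h g v)) \<and>
        (\<forall>v\<in>vcarrier V. continuous_map euclidean (vtopology V) (\<lambda>g. h g v)) \<and>
        embedding_map euclidean (weak_star V) \<alpha> \<and>
        (\<exists>C. \<forall>x. dual_norm V (\<alpha> x) \<le> C) \<and>
        (\<forall>g x. \<forall>v\<in>vcarrier V. \<alpha> (act g x) v = \<alpha> x (h g v)))"

definition equicontinuity_point ::
  "('g \<Rightarrow> 'x::metric_space \<Rightarrow> 'x) \<Rightarrow> 'x set \<Rightarrow> 'x \<Rightarrow> bool" where
  "equicontinuity_point act Y x0 \<longleftrightarrow> x0 \<in> Y \<and>
     (\<forall>\<epsilon>>0. \<exists>U. openin (top_of_set Y) U \<and> x0 \<in> U \<and>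
        (\<forall>x\<in>U. \<forall>g. dist (act g x0) (act g x) < \<epsilon>))"

definition almost_equicontinuous :: "('g \<Rightarrow> 'x::metric_space \<Rightarrow> 'x) \<Rightarrow> 'x set \<Rightarrow> bool" where
  "almost_equicontinuous act Y \<longleftrightarrow> Y \<subseteq> closure {x. equicontinuity_point act Y x}"

definition HAE :: "('g \<Rightarrow> 'x::metric_space \<Rightarrow> 'x) \<Rightarrow> bool" where
  "HAE act \<longleftrightarrow> (\<forall>Y. closed_invariant act Y \<longrightarrow> almost_equicontinuous act Y)"

definition NS :: "('g \<Rightarrow> 'x::metric_space \<Rightarrow> 'x) \<Rightarrow> 'x set \<Rightarrow> bool" where
  "NS act Y \<longleftrightarrow>
     (\<forall>\<epsilon>>0. \<exists>U. openin (top_of_set Y) U \<and> U \<noteq> {} \<and> pm_diameter (dG act) U < \<epsilon>)"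

definition HNS :: "('g \<Rightarrow> 'x::metric_space \<Rightarrow> 'x) \<Rightarrow> bool" where
  "HNS act \<longleftrightarrow> (\<forall>Y. subsystem act Y \<longrightarrow> NS act Y)"

definition dG_fragmented :: "('g \<Rightarrow> 'x::metric_space \<Rightarrow> 'x) \<Rightarrow> bool" where
  "dG_fragmented act \<longleftrightarrow>
     (\<forall>A. \<forall>\<epsilon>>0. A \<noteq> {} \<longrightarrow>
        (\<exists>U. open U \<and> U \<inter> A \<noteq> {} \<and> pm_diameter (dG act) (U \<inter> A) < \<epsilon>))"

definition s_Asplund :: "('g \<Rightarrow> 'x::metric_space \<Rightarrow> 'x) \<Rightarrow> ('x \<Rightarrow> real) \<Rightarrow> bool" where
  "s_Asplund act F \<longleftrightarrow> pm_separable UNIV (rhoG act F)"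

text \<open>
  On the use of \<^const>\<open>RN\<close>: quantification over all Banach spaces is not available inside a formula.
  A theorem about \<open>RN TYPE('v + real)\<close> with \<open>'v\<close> an arbitrary type imposes no restriction on the
  Asplund space: every Banach space, of any cardinality, is isomorphic to one whose carrier lies
  in \<open>Inl ` UNIV\<close> for a suitable \<open>'v\<close>. The summand \<open>real\<close> keeps small types \<open>'v\<close> from excluding
  spaces: it makes room for at least all separable Banach spaces.
\<close>

end

theory Submission imports Defs
begin

text \<open>
  All seven properties are compared with separability of \<open>(X, d\<^sub>G)\<close>, in the form: for every
  \<open>\<epsilon> > 0\<close>, \<open>X\<close> is a countable union of sets of \<open>d\<^sub>G\<close>-diameter less than \<open>\<epsilon>\<close>.

  Inside topological dynamics two principles are used. If \<open>X\<close> is HNS, take the largest open set that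
  has a countable cover by \<open>d\<^sub>G\<close>-small sets; it exists by the Lindeloef property and is invariant, and
  non-sensitivity of its complement would enlarge it, so it is all of \<open>X\<close>
  (\<open>HNS_imp_dG_separable\<close>). Conversely the balls of \<open>d\<^sub>G\<close> are closed in \<open>X\<close>, so Baire's theorem turns
  a countable cover of a closed set by small balls into a relatively open small set
  (\<open>dG_separable_imp_fragmented\<close>). Baire's theorem also produces a dense set of equicontinuity points
  from non-sensitivity of all subsystems (\<open>HNS_imp_HAE\<close>). The functions \<open>dist p\<close>, with \<open>p\<close> in a finite
  net, recover \<open>d\<^sub>G\<close> from the pseudometrics of continuous functions
  (\<open>s_Asplund_imp_dG_separable\<close>).

  Let \<open>X\<close> be represented on an Asplund space \<open>V\<close>. Up to a prescribed error \<open>d\<^sub>G\<close> is controlled by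
  finitely many vectors \<open>v\<close> and countably many group elements \<open>g\<close>. The vectors \<open>h g v\<close> span a separable
  subspace \<open>W\<close>, and separability of its dual yields the required countable covers
  (\<open>RN_imp_dG_separable\<close>).

  For the converse an Asplund space has to be built from separability of \<open>d\<^sub>G\<close>. Let \<open>V\<close> be the space
  of all \<open>f \<in> C(X)\<close> with \<open>\<bar>f x - f y\<bar> = o(sqrt (d\<^sub>G x y))\<close>, normed by the supremum and the Hoelder
  constant. As \<open>d\<^sub>G\<close> is invariant, \<open>G\<close> acts on \<open>V\<close> by isometries, and evaluation embeds \<open>X\<close> into the
  dual. That every subspace \<open>W\<close> of \<open>V\<close> has separable dual is shown in three steps.
  \<^item> The \<open>o\<close>-condition makes \<open>V\<close> similar to a \<open>c\<^sub>0\<close>-sum: by a gliding hump a functional \<open>f\<close> on \<open>W\<close>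
    satisfies \<open>\<bar>f u\<bar> \<le> C * sup \<bar>u\<bar> + \<delta> * \<parallel>u\<parallel>\<close>, with \<open>\<delta>\<close> as small as desired
    (\<open>hoelder_functional_bound\<close>).
  \<^item> By the Hahn-Banach theorem \<open>f\<close> is then \<open>\<delta>\<close>-close to a bounded functional on \<open>C(X)\<close>
    (\<open>approximation_by_norm_bounded_functional\<close>).
  \<^item> A bounded functional on \<open>C(X)\<close> is a measure. As \<open>X\<close> is a countable union of \<open>d\<^sub>G\<close>-small closed
    sets and the unit ball of \<open>V\<close> is uniformly equicontinuous for \<open>d\<^sub>G\<close>, the functional is uniformly
    close on this ball to a finite combination of point evaluations, which may be taken with
    rational coefficients and points in a countable set (\<open>bounded_functional.discretise\<close>). The measure
    itself is never constructed: the proof uses only the superadditivity of its total variation.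
\<close>

section \<open>Countable covers\<close>

text \<open>
An open set \<open>U\<close> is the union of the compact sets of points whose distance from the complement of
\<open>U\<close> is at least \<open>1 / n\<close>. This reduces the claim to finite subcovers.
\<close>

lemma compact_UNIV_Lindelof:
  assumes "compact (UNIV :: 'a::metric_space set)"
    and op: "\<And>S. S \<in> \<F> \<Longrightarrow> open (S :: 'a set)"
  obtains \<F>' where "\<F>' \<subseteq> \<F>" "countable \<F>'" "\<Union>\<F>' = \<Union>\<F>"
proof -
  define U where "U = \<Union>\<F>"
  define C where "C n = - (\<Union>y\<in>-U. ball y (1 / real (Suc n)))" for n
  have "open U" using op by (auto simp: U_def)
  have "\<exists>\<D>\<subseteq>\<F>. finite \<D> \<and> C n \<subseteq> \<Union>\<D>" for n
  proof -
    have "compact (C n)"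
      using assms(1) closed_Int_compact[of "C n" UNIV] by (auto simp: C_def closed_Compl)
    moreover have "C n \<subseteq> \<Union>\<F>"
    proof
      fix x assume "x \<in> C n"
      hence "x \<notin> ball x (1 / real (Suc n)) \<or> x \<in> U" unfolding C_def by blast
      thus "x \<in> \<Union>\<F>" by (simp add: U_def)
    qed
    ultimately obtain \<D> where "\<D> \<subseteq> \<F>" "finite \<D>" "C n \<subseteq> \<Union>\<D>"
      using op by (meson compactE)
    thus ?thesis by blast
  qed
  then obtain D where D: "\<And>n. D n \<subseteq> \<F>" "\<And>n. finite (D n)" "\<And>n. C n \<subseteq> \<Union>(D n)"
    by metis
  show thesis
  proof
    show "(\<Union>n. D n) \<subseteq> \<F>" using D by auto
    show "countable (\<Union>n. D n)" by (simp add: D(2) countable_finite)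
    show "\<Union>(\<Union>n. D n) = \<Union>\<F>"
    proof
      show "\<Union>\<F> \<subseteq> \<Union>(\<Union>n. D n)"
      proof
        fix x assume "x \<in> \<Union>\<F>"
        then obtain e where e: "e > 0" "ball x e \<subseteq> U"
          using \<open>open U\<close> by (auto simp: U_def elim: openE)
        then obtain n where n: "1 / real (Suc n) < e"
          using nat_approx_posE by blast
        have "x \<in> C n"
        proof (rule ccontr)
          assume "x \<notin> C n"
          then obtain y where y: "y \<notin> U" "dist y x < 1 / real (Suc n)"
            by (auto simp: C_def)
          hence "y \<in> ball x e" using n by (auto simp: dist_commute)
          with e y show False by auto
        qed
        thus "x \<in> \<Union>(\<Union>n. D n)" using D(3)[of n] by blast
      qed
    qed (use D(1) in blast)
  qed
qed

text \<open>
Covers by small sets are easier to restrict, intersect and pull back than dense sequences, which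
need not stay inside the set under consideration.
\<close>

lemma pm_separable_iff_countable_covers:
  assumes refl: "\<And>x. x \<in> S \<Longrightarrow> \<rho> x x = 0"
    and sym: "\<And>x y. x \<in> S \<Longrightarrow> y \<in> S \<Longrightarrow> \<rho> x y = \<rho> y x"
    and tri: "\<And>x y z. x \<in> S \<Longrightarrow> y \<in> S \<Longrightarrow> z \<in> S \<Longrightarrow> \<rho> x z \<le> \<rho> x y + \<rho> y z"
  shows "pm_separable S \<rho> \<longleftrightarrow>
    (\<forall>\<epsilon>>0. \<exists>\<C>. countable \<C> \<and> S \<subseteq> \<Union>\<C> \<and> (\<forall>C\<in>\<C>. \<forall>x\<in>C\<inter>S. \<forall>y\<in>C\<inter>S. \<rho> x y < \<epsilon>))"
    (is "_ \<longleftrightarrow> ?R")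
proof
  assume "pm_separable S \<rho>"
  then obtain D where D: "D \<subseteq> S" "countable D" "\<forall>x\<in>S. \<forall>\<epsilon>>0. \<exists>y\<in>D. \<rho> x y < \<epsilon>"
    by (auto simp: pm_separable_def)
  show ?R
  proof (intro allI impI)
    fix \<epsilon> :: real assume "\<epsilon> > 0"
    let ?\<C> = "(\<lambda>y. {x \<in> S. \<rho> x y < \<epsilon> / 2}) ` D"
    have "\<rho> x x' < \<epsilon>" if "y \<in> D" "x \<in> S" "x' \<in> S" "\<rho> x y < \<epsilon> / 2" "\<rho> x' y < \<epsilon> / 2" for x x' y
      using that tri[of x y x'] sym[of x' y] D(1) by auto
    moreover have "S \<subseteq> \<Union>?\<C>" using D(3)[rule_format, of _ "\<epsilon> / 2"] \<open>\<epsilon> > 0\<close> by force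
    ultimately show "\<exists>\<C>. countable \<C> \<and> S \<subseteq> \<Union>\<C> \<and> (\<forall>C\<in>\<C>. \<forall>x\<in>C\<inter>S. \<forall>y\<in>C\<inter>S. \<rho> x y < \<epsilon>)"
      using D(2) by (intro exI[of _ ?\<C>]) auto
  qed
next
  assume R: ?R
  have "\<exists>\<C>. countable \<C> \<and> S \<subseteq> \<Union>\<C> \<and>
      (\<forall>C\<in>\<C>. \<forall>x\<in>C\<inter>S. \<forall>y\<in>C\<inter>S. \<rho> x y < 1 / real (Suc n))" for n
    using R by simp
  then obtain \<C> where \<C>: "\<And>n. countable (\<C> n)" "\<And>n. S \<subseteq> \<Union>(\<C> n)"
    "\<And>n C x y. C \<in> \<C> n \<Longrightarrow> x \<in> C \<inter> S \<Longrightarrow> y \<in> C \<inter> S \<Longrightarrow> \<rho> x y < 1 / real (Suc n)"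
    by metis
  define D where "D = (\<Union>n. (\<lambda>C. SOME x. x \<in> C \<inter> S) ` {C \<in> \<C> n. C \<inter> S \<noteq> {}})"
  have pick: "(SOME x. x \<in> C \<inter> S) \<in> C \<inter> S" if "C \<inter> S \<noteq> {}" for C
    using that by (meson all_not_in_conv someI_ex)
  show "pm_separable S \<rho>"
    unfolding pm_separable_def
  proof (intro exI[of _ D] conjI ballI allI impI)
    show "D \<subseteq> S" using pick by (auto simp: D_def)
    show "countable D" using \<C>(1) by (auto simp: D_def)
    fix x and \<epsilon> :: real assume x: "x \<in> S" and "\<epsilon> > 0"
    then obtain n where n: "1 / real (Suc n) < \<epsilon>" using nat_approx_posE by blast
    obtain C where C: "C \<in> \<C> n" "x \<in> C" using \<C>(2)[of n] x by auto
    with x have "C \<inter> S \<noteq> {}" by auto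
    hence "(SOME x. x \<in> C \<inter> S) \<in> D" using C by (auto simp: D_def)
    moreover have "\<rho> x (SOME x. x \<in> C \<inter> S) < 1 / real (Suc n)"
      by (rule \<C>(3)[OF C(1)]) (use pick[OF \<open>C \<inter> S \<noteq> {}\<close>] C x in auto)
    ultimately show "\<exists>y\<in>D. \<rho> x y < \<epsilon>" using n by (meson order.strict_trans)
  qed
qed

lemma finite_common_refinement:
  fixes R :: "'p \<Rightarrow> 'a \<Rightarrow> 'a \<Rightarrow> bool"
  assumes "finite P"
    and "\<And>p. p \<in> P \<Longrightarrow> \<exists>\<C>. countable \<C> \<and> \<Union>\<C> = UNIV \<and> (\<forall>C\<in>\<C>. \<forall>x\<in>C. \<forall>y\<in>C. R p x y)"
  shows "\<exists>\<C>. countable \<C> \<and> \<Union>\<C> = UNIV \<and> (\<forall>C\<in>\<C>. \<forall>x\<in>C. \<forall>y\<in>C. \<forall>p\<in>P. R p x y)"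
  using assms
proof (induction P rule: finite_induct)
  case empty
  show ?case by (rule exI[of _ "{UNIV}"]) auto
next
  case (insert p P)
  then obtain \<C> where \<C>: "countable \<C>" "\<Union>\<C> = UNIV" "\<forall>C\<in>\<C>. \<forall>x\<in>C. \<forall>y\<in>C. \<forall>p\<in>P. R p x y"
    by auto
  obtain \<D> where \<D>: "countable \<D>" "\<Union>\<D> = UNIV" "\<forall>C\<in>\<D>. \<forall>x\<in>C. \<forall>y\<in>C. R p x y"
    using insert.prems[of p] by auto
  have "\<Union>((\<lambda>(C, D). C \<inter> D) ` (\<C> \<times> \<D>)) = UNIV"
  proof (intro set_eqI iffI UNIV_I)
    fix x :: 'a
    have "x \<in> \<Union>\<C>" "x \<in> \<Union>\<D>" by (simp_all add: \<C>(2) \<D>(2))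
    thus "x \<in> \<Union>((\<lambda>(C, D). C \<inter> D) ` (\<C> \<times> \<D>))" by force
  qed
  thus ?case using \<C> \<D> by (intro exI[of _ "(\<lambda>(C, D). C \<inter> D) ` (\<C> \<times> \<D>)"]) auto
qed

section \<open>The metric \<open>d\<^sub>G\<close>\<close>

locale compact_system =
  fixes act :: "'g::topological_group_add \<Rightarrow> 'x::metric_space \<Rightarrow> 'x"
  assumes compact_UNIV: "compact (UNIV :: 'x set)"
    and continuous_action: "continuous_action act"
begin

lemma act_zero [simp]: "act 0 x = x"
  and act_add: "act (g + g') x = act g (act g' x)"
  and continuous_act: "continuous_on UNIV (\<lambda>(g, x). act g x)"
  using continuous_action by (auto simp: continuous_action_def)

lemma act_minus [simp]: "act (- g) (act g x) = x" "act g (act (- g) x) = x"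
  by (simp_all flip: act_add)

lemma continuous_on_act: "continuous_on S (act g)"
proof -
  have "continuous_on UNIV (\<lambda>x. case (g, x) of (g, x) \<Rightarrow> act g x)"
    by (rule continuous_on_compose2[OF continuous_act]) (auto intro!: continuous_intros)
  thus ?thesis using continuous_on_subset by fastforce
qed

lemma bdd_dist_act: "bdd_above (range (\<lambda>g. dist (act g x) (act g y)))"
proof -
  have "bounded (UNIV :: 'x set)" using compact_UNIV compact_imp_bounded by blast
  thus ?thesis
    by (intro bdd_aboveI2[of _ _ "diameter (UNIV :: 'x set)"] diameter_bounded_bound[OF \<open>bounded UNIV\<close>]) auto
qed

lemma dist_act_le_dG: "dist (act g x) (act g y) \<le> dG act x y"
  unfolding dG_def by (rule cSUP_upper[OF _ bdd_dist_act]) simp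

lemma dist_le_dG: "dist x y \<le> dG act x y"
  using dist_act_le_dG[of 0] by simp

lemma dG_least: "(\<And>g. dist (act g x) (act g y) \<le> r) \<Longrightarrow> dG act x y \<le> r"
  unfolding dG_def by (rule cSUP_least) auto

lemma dG_nonneg [simp]: "0 \<le> dG act x y"
  using dist_le_dG[of x y] zero_le_dist[of x y] by linarith

lemma dG_self [simp]: "dG act x x = 0"
  by (rule antisym) (auto intro: dG_least)

lemma dG_sym: "dG act x y = dG act y x"
  by (simp add: dG_def dist_commute)

lemma dG_triangle: "dG act x z \<le> dG act x y + dG act y z"
  by (rule dG_least) (meson add_mono dist_act_le_dG dist_triangle order_trans)

lemma dG_act [simp]: "dG act (act g x) (act g y) = dG act x y"
proof (rule antisym)
  have "dist (act h (act g x)) (act h (act g y)) \<le> dG act x y" for h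
    using dist_act_le_dG[of "h + g" x y] by (simp only: act_add)
  thus "dG act (act g x) (act g y) \<le> dG act x y" by (rule dG_least)
  have "dist (act h x) (act h y) \<le> dG act (act g x) (act g y)" for h
    using dist_act_le_dG[of "h + - g" "act g x" "act g y"] by (simp only: act_add act_minus)
  thus "dG act x y \<le> dG act (act g x) (act g y)" by (rule dG_least)
qed

lemma dG_le_diameter: "dG act x y \<le> diameter (UNIV :: 'x set)"
  using compact_UNIV compact_imp_bounded diameter_bounded_bound by (intro dG_least) blast

text \<open>As a supremum of continuous functions, \<open>d\<^sub>G\<close> is lower semicontinuous.\<close>

lemma closed_dG_cball: "closed {x. dG act x y \<le> r}"
proof -
  have "{x. dG act x y \<le> r} = (\<Inter>g. {x. dist (act g x) (act g y) \<le> r})"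
    by (auto intro: dG_least order_trans[OF dist_act_le_dG])
  also have "closed \<dots>"
    by (intro closed_INT ballI closed_Collect_le continuous_intros continuous_on_act)
  finally show ?thesis .
qed

lemma pm_diameter_dG_le:
  assumes "\<And>x y. x \<in> A \<Longrightarrow> y \<in> A \<Longrightarrow> dG act x y \<le> r" "0 \<le> r"
  shows "pm_diameter (dG act) A \<le> r"
  using assms by (auto simp: pm_diameter_def intro!: cSUP_least)

lemma dG_le_pm_diameter:
  assumes "x \<in> A" "y \<in> A"
  shows "dG act x y \<le> pm_diameter (dG act) A"
proof -
  have "bdd_above ((\<lambda>(x, y). dG act x y) ` (A \<times> A))"
    using dG_le_diameter by (auto intro!: bdd_aboveI)
  from cSUP_upper[OF _ this, of "(x, y)"] show ?thesis
    using assms by (auto simp: pm_diameter_def)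
qed

lemma dG_separable_iff:
  "pm_separable UNIV (dG act) \<longleftrightarrow>
    (\<forall>\<epsilon>>0. \<exists>\<C>. countable \<C> \<and> \<Union>\<C> = UNIV \<and> (\<forall>C\<in>\<C>. \<forall>x\<in>C. \<forall>y\<in>C. dG act x y < \<epsilon>))"
  using pm_separable_iff_countable_covers[of UNIV "dG act", OF dG_self dG_sym dG_triangle]
  by (simp add: top.extremum_unique)

section \<open>Sensitivity, equicontinuity and fragmentability\<close>

lemma HAE_imp_equicontinuity_point:
  assumes "HAE act" "subsystem act Y"
  shows "\<exists>x. equicontinuity_point act Y x"
proof -
  have "Y \<subseteq> closure {x. equicontinuity_point act Y x}" "Y \<noteq> {}"
    using assms by (auto simp: HAE_def subsystem_def almost_equicontinuous_def)
  thus ?thesis by (metis (no_types, lifting) closure_empty empty_Collect_eq subset_empty)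
qed

lemma equicontinuity_point_imp_NS:
  assumes "equicontinuity_point act Y x"
  shows "NS act Y"
  unfolding NS_def
proof (intro allI impI)
  fix \<epsilon> :: real assume "\<epsilon> > 0"
  hence "\<epsilon> / 3 > 0" by simp
  then obtain U where U: "openin (top_of_set Y) U" "x \<in> U"
    "\<And>y g. y \<in> U \<Longrightarrow> dist (act g x) (act g y) < \<epsilon> / 3"
    using assms unfolding equicontinuity_point_def by meson
  have *: "dG act x y \<le> \<epsilon> / 3" if "y \<in> U" for y
    using U(3)[OF that] by (intro dG_least) (auto intro: less_imp_le)
  have "dG act y z \<le> 2 * \<epsilon> / 3" if "y \<in> U" "z \<in> U" for y z
    using *[OF that(1)] *[OF that(2)] dG_triangle[of y z x] dG_sym[of y x] by auto
  hence "pm_diameter (dG act) U \<le> 2 * \<epsilon> / 3"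
    using \<open>\<epsilon> > 0\<close> by (intro pm_diameter_dG_le) auto
  thus "\<exists>U. openin (top_of_set Y) U \<and> U \<noteq> {} \<and> pm_diameter (dG act) U < \<epsilon>"
    using U \<open>\<epsilon> > 0\<close> by (intro exI[of _ U]) auto
qed

lemma act_image_eq_vimage: "act g ` A = act (- g) -` A"
proof (intro set_eqI iffI)
  fix y assume "y \<in> act g ` A"
  then obtain x where "x \<in> A" "y = act g x" by (elim imageE)
  thus "y \<in> act (- g) -` A" by simp
next
  fix y assume "y \<in> act (- g) -` A"
  thus "y \<in> act g ` A" by (intro image_eqI[of _ _ "act (- g) y"]) simp_all
qed

lemma open_act_image:
  assumes "open A"
  shows "open (act g ` A)"
proof -
  have "open (act (- g) -` A)" using assms by (rule open_vimage[OF _ continuous_on_act])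
  thus ?thesis by (simp only: act_image_eq_vimage)
qed

text \<open>
The open sets with a countable cover by small sets form an invariant family that is closed under
arbitrary unions, by the Lindeloef property. A transfinite derivation process, removing small open
pieces again and again, is thereby replaced by passing to the union \<open>W\<close> of this family.
\<close>

lemma HNS_imp_dG_separable:
  assumes "HNS act"
  shows "pm_separable UNIV (dG act)"
  unfolding dG_separable_iff
proof (intro allI impI)
  fix \<epsilon> :: real assume "\<epsilon> > 0"
  define small where "small C \<longleftrightarrow> (\<forall>x\<in>C. \<forall>y\<in>C. dG act x y < \<epsilon>)" for C
  define good where "good A \<longleftrightarrow> (\<exists>\<C>. countable \<C> \<and> A \<subseteq> \<Union>\<C> \<and> (\<forall>C\<in>\<C>. small C))" for A
  define W where "W = \<Union>{A. open A \<and> good A}"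
  have small_act: "small (act g ` C)" if "small C" for g C
    using that by (simp add: small_def)
  have good_act: "good (act g ` A)" if good_A: "good A" for A g
  proof -
    obtain \<C> where \<C>: "countable \<C>" "A \<subseteq> \<Union>\<C>" "\<forall>C\<in>\<C>. small C"
      using good_A unfolding good_def by blast
    have "act g ` A \<subseteq> \<Union> ((`) (act g) ` \<C>)" using \<C>(2) by blast
    thus ?thesis
      unfolding good_def using \<C> small_act by (intro exI[of _ "(`) (act g) ` \<C>"]) simp
  qed
  have "good W"
  proof -
    obtain \<F> where \<F>: "\<F> \<subseteq> {A. open A \<and> good A}" "countable \<F>" "\<Union>\<F> = W"
      unfolding W_def by (rule compact_UNIV_Lindelof[OF compact_UNIV, of "{A. open A \<and> good A}"]) simp_all
    have "\<forall>A\<in>\<F>. \<exists>\<C>. countable \<C> \<and> A \<subseteq> \<Union>\<C> \<and> (\<forall>C\<in>\<C>. small C)"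
      using \<F>(1) unfolding good_def by blast
    from bchoice[OF this] obtain \<C> where
      \<C>: "\<forall>A\<in>\<F>. countable (\<C> A) \<and> A \<subseteq> \<Union>(\<C> A) \<and> (\<forall>C\<in>\<C> A. small C)"
      by blast
    have "A \<subseteq> \<Union>(\<Union>A\<in>\<F>. \<C> A)" if "A \<in> \<F>" for A
    proof -
      have "A \<subseteq> \<Union>(\<C> A)" using \<C> that by simp
      also have "\<C> A \<subseteq> (\<Union>A\<in>\<F>. \<C> A)" using that by (rule UN_upper)
      hence "\<Union>(\<C> A) \<subseteq> \<Union>(\<Union>A\<in>\<F>. \<C> A)" by (rule Union_mono)
      finally show ?thesis .
    qed
    hence "W \<subseteq> \<Union>(\<Union>A\<in>\<F>. \<C> A)"
      unfolding \<F>(3)[symmetric] by (rule Union_least)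
    moreover have "countable (\<Union>A\<in>\<F>. \<C> A)" using \<F>(2) \<C> by simp
    moreover have "\<forall>C\<in>(\<Union>A\<in>\<F>. \<C> A). small C" using \<C> by simp
    ultimately show ?thesis
      unfolding good_def by (intro exI[of _ "\<Union>A\<in>\<F>. \<C> A"] conjI)
  qed
  then obtain \<C> where \<C>: "countable \<C>" "W \<subseteq> \<Union>\<C>" "\<forall>C\<in>\<C>. small C"
    unfolding good_def by blast
  have "W = UNIV"
  proof (rule ccontr)
    assume "W \<noteq> UNIV"
    \<comment> \<open>The complement of \<open>W\<close> would be a subsystem, and a small relatively open piece
        of it could be added to \<open>W\<close>.\<close>
    have "act g x \<in> - W" if "x \<in> - W" for g x
    proof
      assume "act g x \<in> W"
      then obtain A where A: "open A" "good A" "act g x \<in> A" unfolding W_def by blast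
      hence "act (- g) ` A \<subseteq> W"
        unfolding W_def by (intro Union_upper CollectI conjI open_act_image good_act)
      hence "act (- g) (act g x) \<in> W" using A(3) by blast
      thus False using that by simp
    qed
    moreover have "open W" unfolding W_def by blast
    ultimately have "subsystem act (- W)"
      using \<open>W \<noteq> UNIV\<close> unfolding subsystem_def closed_invariant_def by blast
    then obtain U where U: "openin (top_of_set (- W)) U" "U \<noteq> {}" "pm_diameter (dG act) U < \<epsilon>"
      using assms \<open>\<epsilon> > 0\<close> unfolding HNS_def NS_def by meson
    then obtain T where T: "open T" "U = - W \<inter> T" unfolding openin_open by blast
    have "small U"
      using le_less_trans[OF dG_le_pm_diameter U(3)] by (simp add: small_def)
    hence "\<forall>C\<in>insert U \<C>. small C" using \<C>(3) by simp
    moreover have "T \<subseteq> \<Union>(insert U \<C>)" using \<C>(2) T(2) by blast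
    ultimately have "good T"
      unfolding good_def using \<C>(1) by blast
    hence "T \<subseteq> W" using T(1) unfolding W_def by blast
    thus False using T U by blast
  qed
  with \<C> have "countable \<C> \<and> \<Union>\<C> = UNIV \<and> (\<forall>C\<in>\<C>. \<forall>x\<in>C. \<forall>y\<in>C. dG act x y < \<epsilon>)"
    by (simp add: small_def top.extremum_unique)
  thus "\<exists>\<C>. countable \<C> \<and> \<Union>\<C> = UNIV \<and> (\<forall>C\<in>\<C>. \<forall>x\<in>C. \<forall>y\<in>C. dG act x y < \<epsilon>)" ..
qed

lemma compact_Hausdorff_top_of_closed:
  assumes "closed (Y :: 'x set)"
  shows "locally_compact_space (top_of_set Y) \<and> regular_space (top_of_set Y)"
proof -
  have "compact_space (top_of_set Y)"
    using assms compact_UNIV closed_Int_compact[of Y UNIV] by (auto simp: compact_space_subtopology)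
  moreover have "Hausdorff_space (top_of_set Y)"
    by (simp add: Hausdorff_space_subtopology)
  ultimately show ?thesis
    by (simp add: compact_Hausdorff_imp_regular_space compact_imp_locally_compact_space)
qed

text \<open>
Baire's theorem is applied to the closure of \<open>A\<close>; an open set that meets the closure meets \<open>A\<close>.
\<close>

lemma dG_separable_imp_fragmented:
  assumes "pm_separable UNIV (dG act)"
  shows "dG_fragmented act"
  unfolding dG_fragmented_def
proof (intro allI impI)
  fix A :: "'x set" and \<epsilon> :: real assume "\<epsilon> > 0" "A \<noteq> {}"
  define Y where "Y = closure A"
  obtain D where D: "countable D" "\<And>x. \<exists>y\<in>D. dG act x y < \<epsilon> / 3"
    using assms \<open>\<epsilon> > 0\<close> unfolding pm_separable_def by (metis UNIV_I divide_pos_pos zero_less_numeral)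
  define \<G> where "\<G> = (\<lambda>y. Y \<inter> {x. dG act x y \<le> \<epsilon> / 3}) ` D"
  have "\<Union>\<G> = Y" using D(2) by (fastforce simp: \<G>_def intro: less_imp_le)
  have "\<exists>T\<in>\<G>. top_of_set Y interior_of T \<noteq> {}"
  proof (rule ccontr)
    assume "\<not> ?thesis"
    hence "top_of_set Y interior_of \<Union>\<G> = {}"
      using compact_Hausdorff_top_of_closed[of Y] D(1)
      by (intro Baire_category_alt)
        (auto simp: \<G>_def Y_def simp del: divide_const_simps intro!: closedin_closed_Int closed_dG_cball)
    moreover have "top_of_set Y interior_of \<Union>\<G> = Y"
      using \<open>\<Union>\<G> = Y\<close> interior_of_topspace[of "top_of_set Y"] by simp
    ultimately show False using \<open>A \<noteq> {}\<close> closure_subset[of A] by (auto simp: Y_def)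
  qed
  then obtain y U where U: "openin (top_of_set Y) U" "U \<noteq> {}" "U \<subseteq> {x. dG act x y \<le> \<epsilon> / 3}"
    unfolding \<G>_def by (auto simp: interior_of_def)
  then obtain T where T: "open T" "U = Y \<inter> T" by (auto simp: openin_open)
  have "T \<inter> A \<noteq> {}" using T U(2) open_Int_closure_eq_empty[of T A] by (auto simp: Y_def)
  moreover have "pm_diameter (dG act) (T \<inter> A) \<le> 2 * \<epsilon> / 3"
  proof (rule pm_diameter_dG_le)
    fix x z assume "x \<in> T \<inter> A" "z \<in> T \<inter> A"
    hence "x \<in> U" "z \<in> U" using T closure_subset[of A] by (auto simp: Y_def)
    hence "dG act x y \<le> \<epsilon> / 3" "dG act z y \<le> \<epsilon> / 3" using U by auto
    thus "dG act x z \<le> 2 * \<epsilon> / 3" using dG_triangle[of x z y] dG_sym[of z y] by auto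
  qed (use \<open>\<epsilon> > 0\<close> in auto)
  ultimately show "\<exists>U. open U \<and> U \<inter> A \<noteq> {} \<and> pm_diameter (dG act) (U \<inter> A) < \<epsilon>"
    using T \<open>\<epsilon> > 0\<close> by (intro exI[of _ T]) auto
qed

lemma fragmented_imp_HNS:
  assumes "dG_fragmented act"
  shows "HNS act"
  unfolding HNS_def NS_def
proof (intro allI impI)
  fix Y and \<epsilon> :: real assume "subsystem act Y" "\<epsilon> > 0"
  then obtain T where T: "open T" "T \<inter> Y \<noteq> {}" "pm_diameter (dG act) (T \<inter> Y) < \<epsilon>"
    using assms unfolding dG_fragmented_def subsystem_def by meson
  thus "\<exists>U. openin (top_of_set Y) U \<and> U \<noteq> {} \<and> pm_diameter (dG act) U < \<epsilon>"
    using openin_open_Int[OF T(1), of Y] by (intro exI[of _ "Y \<inter> T"]) (simp add: Int_commute)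
qed

text \<open>
The points of equicontinuity of \<open>Y\<close> are the intersection of the sets \<open>Y \<inter> E n\<close> of points that have a
neighbourhood in \<open>Y\<close> of \<open>d\<^sub>G\<close>-diameter below \<open>1 / (n + 1)\<close>. Each of them is relatively open and invariant. Were
one not dense in \<open>Y\<close>, then non-sensitivity of the closure \<open>Z\<close> of the part of \<open>Y\<close> that it misses
would give a small open subset of \<open>Z\<close> and hence a further point of \<open>E n\<close>.
\<close>

lemma HNS_imp_HAE:
  assumes "HNS act"
  shows "HAE act"
  unfolding HAE_def
proof (intro allI impI)
  fix Y assume Y: "closed_invariant act Y"
  hence "closed Y" by (simp add: closed_invariant_def)
  define E where "E n = \<Union>{T. open T \<and> pm_diameter (dG act) (Y \<inter> T) < 1 / real (Suc n)}" for n
  have "open (E n)" for n by (auto simp: E_def)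
  have dense: "Y \<subseteq> closure (Y \<inter> E n)" for n
  proof (rule ccontr)
    assume *: "\<not> Y \<subseteq> closure (Y \<inter> E n)"
    define Z where "Z = closure (Y - closure (Y \<inter> E n))"
    have act_E: "act g ` (Y \<inter> E n) \<subseteq> Y \<inter> E n" for g
    proof
      fix z assume "z \<in> act g ` (Y \<inter> E n)"
      then obtain x T where x: "z = act g x" "x \<in> Y" "x \<in> T" "open T"
        "pm_diameter (dG act) (Y \<inter> T) < 1 / real (Suc n)"
        by (auto simp: E_def)
      have "pm_diameter (dG act) (Y \<inter> act g ` T) \<le> pm_diameter (dG act) (Y \<inter> T)"
      proof (rule pm_diameter_dG_le)
        fix a b assume ab: "a \<in> Y \<inter> act g ` T" "b \<in> Y \<inter> act g ` T"
        hence "act (- g) a \<in> Y \<inter> T" "act (- g) b \<in> Y \<inter> T"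
          using Y by (auto simp: closed_invariant_def)
        from dG_le_pm_diameter[OF this] show "dG act a b \<le> pm_diameter (dG act) (Y \<inter> T)" by simp
      next
        show "0 \<le> pm_diameter (dG act) (Y \<inter> T)"
          using dG_le_pm_diameter[of x "Y \<inter> T" x] x by simp
      qed
      hence "act g ` T \<subseteq> E n" using x open_act_image[of T g] unfolding E_def
        by (intro Union_upper) auto
      thus "z \<in> Y \<inter> E n" using x Y by (auto simp: closed_invariant_def)
    qed
    have inv_closure: "act g ` closure B \<subseteq> closure B" if "\<And>g. act g ` B \<subseteq> B" for g B
      by (intro image_closure_subset[OF continuous_on_act] closed_closure
          order_trans[OF that closure_subset])
    have "act g x \<in> Y - closure (Y \<inter> E n)" if "x \<in> Y - closure (Y \<inter> E n)" for g x
    proof -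
      have "act (- g) ` closure (Y \<inter> E n) \<subseteq> closure (Y \<inter> E n)" using inv_closure[OF act_E] .
      hence "act g x \<in> closure (Y \<inter> E n) \<Longrightarrow> act (- g) (act g x) \<in> closure (Y \<inter> E n)" by blast
      hence "act g x \<notin> closure (Y \<inter> E n)" using that by auto
      thus ?thesis using that Y unfolding closed_invariant_def by blast
    qed
    hence "act g ` Z \<subseteq> Z" for g unfolding Z_def by (intro inv_closure) blast
    moreover have "Z \<noteq> {}" using * by (auto simp: Z_def)
    ultimately have "subsystem act Z"
      by (auto simp: subsystem_def closed_invariant_def Z_def)
    then obtain U where U: "openin (top_of_set Z) U" "U \<noteq> {}"
      "pm_diameter (dG act) U < 1 / real (Suc n)"
      using assms unfolding HNS_def NS_def
      by (meson of_nat_0_less_iff zero_less_Suc zero_less_divide_1_iff)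
    then obtain T where T: "open T" "U = Z \<inter> T" by (auto simp: openin_open)
    let ?T = "T \<inter> - closure (Y \<inter> E n)"
    have "T \<inter> (Y - closure (Y \<inter> E n)) \<noteq> {}"
      using open_Int_closure_eq_empty[OF T(1), of "Y - closure (Y \<inter> E n)"] U(2) T(2)
      unfolding Z_def by (simp add: Int_commute)
    then obtain x where x: "x \<in> Y" "x \<in> ?T" by auto
    have "pm_diameter (dG act) (Y \<inter> ?T) \<le> pm_diameter (dG act) U"
    proof (rule pm_diameter_dG_le)
      show "dG act a b \<le> pm_diameter (dG act) U" if "a \<in> Y \<inter> ?T" "b \<in> Y \<inter> ?T" for a b
        using that T closure_subset[of "Y - closure (Y \<inter> E n)"]
        by (intro dG_le_pm_diameter) (auto simp: Z_def)
      show "0 \<le> pm_diameter (dG act) U"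
        using U(2) dG_le_pm_diameter[of _ U] order_trans[OF dG_nonneg] by blast
    qed
    hence "pm_diameter (dG act) (Y \<inter> ?T) < 1 / real (Suc n)" using U(3) by (rule le_less_trans)
    moreover have "open ?T" using T(1) by (simp add: open_Int open_Compl)
    ultimately have "x \<in> E n" using x(2) unfolding E_def by blast
    hence "x \<in> closure (Y \<inter> E n)" using x(1) closure_subset[of "Y \<inter> E n"] by blast
    thus False using x(2) by blast
  qed
  have "top_of_set Y closure_of (\<Inter>n. Y \<inter> E n) = topspace (top_of_set Y)"
  proof (rule Baire_category)
    fix T assume "T \<in> range (\<lambda>n. Y \<inter> E n)"
    then obtain n where "T = Y \<inter> E n" by auto
    thus "openin (top_of_set Y) T \<and> top_of_set Y closure_of T = topspace (top_of_set Y)"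
      using \<open>open (E n)\<close> dense[of n] by (simp add: closure_of_subtopology openin_open_Int Int_absorb2)
  qed (use compact_Hausdorff_top_of_closed[OF \<open>closed Y\<close>] in simp_all)
  hence "Y \<subseteq> closure (\<Inter>n. Y \<inter> E n)"
    by (auto simp: closure_of_subtopology)
  also have "\<dots> \<subseteq> closure {x. equicontinuity_point act Y x}"
  proof (intro closure_mono subsetI)
    fix x assume x: "x \<in> (\<Inter>n. Y \<inter> E n)"
    have "\<exists>U. openin (top_of_set Y) U \<and> x \<in> U \<and> (\<forall>y\<in>U. \<forall>g. dist (act g x) (act g y) < \<epsilon>)"
      if eps: "\<epsilon> > 0" for \<epsilon>
    proof -
      obtain n where n: "1 / real (Suc n) < \<epsilon>" by (rule nat_approx_posE[OF eps])
      have "x \<in> E n" using x by auto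
      then obtain T where T: "open T" "x \<in> T" "pm_diameter (dG act) (Y \<inter> T) < 1 / real (Suc n)"
        unfolding E_def by blast
      have "dist (act g x) (act g y) < \<epsilon>" if "y \<in> Y \<inter> T" for g y
      proof -
        have "x \<in> Y \<inter> T" using T x by auto
        from dG_le_pm_diameter[OF this that] show ?thesis
          using dist_act_le_dG[of g x y] T(3) n by linarith
      qed
      moreover have "openin (top_of_set Y) (Y \<inter> T)" "x \<in> Y \<inter> T" using T x by auto
      ultimately show ?thesis by blast
    qed
    moreover have "x \<in> Y" using x by blast
    ultimately show "x \<in> {x. equicontinuity_point act Y x}"
      unfolding equicontinuity_point_def by blast
  qed
  finally show "almost_equicontinuous act Y" by (simp add: almost_equicontinuous_def)
qed

section \<open>Continuous functions with separable orbit pseudometrics\<close>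

lemma bdd_rhoG:
  assumes "continuous_on UNIV (F :: 'x \<Rightarrow> real)"
  shows "bdd_above (range (\<lambda>g. \<bar>F (act g x) - F (act g y)\<bar>))"
proof -
  have "bounded (range F)"
    using compact_continuous_image[OF assms compact_UNIV] compact_imp_bounded by blast
  then obtain B where "\<And>x. \<bar>F x\<bar> \<le> B" by (auto simp: bounded_iff)
  hence "\<bar>F (act g x) - F (act g y)\<bar> \<le> B + B" for g
    using abs_triangle_ineq4 add_mono order_trans by meson
  thus ?thesis by (meson bdd_aboveI2)
qed

lemma rhoG_upper:
  assumes "continuous_on UNIV (F :: 'x \<Rightarrow> real)"
  shows "\<bar>F (act g x) - F (act g y)\<bar> \<le> rhoG act F x y"
  unfolding rhoG_def by (rule cSUP_upper[OF _ bdd_rhoG[OF assms]]) simp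

lemma rhoG_least: "(\<And>g. \<bar>F (act g x) - F (act g y)\<bar> \<le> r) \<Longrightarrow> rhoG act F x y \<le> r"
  unfolding rhoG_def by (rule cSUP_least) auto

lemma rhoG_separable_iff:
  assumes F: "continuous_on UNIV (F :: 'x \<Rightarrow> real)"
  shows "pm_separable UNIV (rhoG act F) \<longleftrightarrow>
    (\<forall>\<epsilon>>0. \<exists>\<C>. countable \<C> \<and> \<Union>\<C> = UNIV \<and> (\<forall>C\<in>\<C>. \<forall>x\<in>C. \<forall>y\<in>C. rhoG act F x y < \<epsilon>))"
proof -
  have "rhoG act F x z \<le> rhoG act F x y + rhoG act F y z" for x y z
  proof (rule rhoG_least)
    fix g
    show "\<bar>F (act g x) - F (act g z)\<bar> \<le> rhoG act F x y + rhoG act F y z"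
      using rhoG_upper[OF F, of g x y] rhoG_upper[OF F, of g y z] by linarith
  qed
  moreover have "rhoG act F x x = 0" "rhoG act F x y = rhoG act F y x" for x y
    by (simp_all add: rhoG_def abs_minus_commute)
  ultimately have "pm_separable UNIV (rhoG act F) \<longleftrightarrow> (\<forall>\<epsilon>>0. \<exists>\<C>. countable \<C> \<and>
      UNIV \<subseteq> \<Union>\<C> \<and> (\<forall>C\<in>\<C>. \<forall>x\<in>C\<inter>UNIV. \<forall>y\<in>C\<inter>UNIV. rhoG act F x y < \<epsilon>))"
    by (intro pm_separable_iff_countable_covers)
  thus ?thesis by (simp add: top.extremum_unique)
qed

lemma dG_separable_imp_s_Asplund:
  assumes "pm_separable UNIV (dG act)" and F: "continuous_on UNIV (F :: 'x \<Rightarrow> real)"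
  shows "s_Asplund act F"
  unfolding s_Asplund_def rhoG_separable_iff[OF F]
proof (intro allI impI)
  fix \<epsilon> :: real assume "\<epsilon> > 0"
  have "uniformly_continuous_on UNIV F"
    by (rule compact_uniformly_continuous[OF F compact_UNIV])
  then obtain \<delta> where \<delta>: "\<delta> > 0" "\<And>x y. dist x y < \<delta> \<Longrightarrow> \<bar>F x - F y\<bar> < \<epsilon> / 2"
    using \<open>\<epsilon> > 0\<close> unfolding uniformly_continuous_on_def dist_real_def by (metis UNIV_I half_gt_zero)
  obtain \<C> where \<C>: "countable \<C>" "\<Union>\<C> = UNIV" "\<And>C x y. C\<in>\<C> \<Longrightarrow> x\<in>C \<Longrightarrow> y\<in>C \<Longrightarrow> dG act x y < \<delta>"
    using assms(1) \<delta>(1) unfolding dG_separable_iff by metis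
  have "rhoG act F x y < \<epsilon>" if "C\<in>\<C>" "x\<in>C" "y\<in>C" for C x y
  proof -
    have "rhoG act F x y \<le> \<epsilon> / 2"
      by (intro rhoG_least less_imp_le \<delta>(2) le_less_trans[OF dist_act_le_dG] \<C>(3)[OF that])
    thus ?thesis using \<open>\<epsilon> > 0\<close> by linarith
  qed
  thus "\<exists>\<C>. countable \<C> \<and> \<Union>\<C> = UNIV \<and> (\<forall>C\<in>\<C>. \<forall>x\<in>C. \<forall>y\<in>C. rhoG act F x y < \<epsilon>)"
    using \<C> by blast
qed

text \<open>
If \<open>P\<close> is an \<open>\<epsilon> / 4\<close>-net, then \<open>d\<^sub>G\<close> exceeds the maximum of the pseudometrics of the functions
\<open>dist p\<close>, \<open>p \<in> P\<close>, by at most \<open>\<epsilon> / 2\<close>. Finitely many countable covers have a countable common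
refinement, so each error \<open>\<epsilon>\<close> can be treated with its own finite set of functions.
\<close>

lemma s_Asplund_imp_dG_separable:
  assumes "\<And>F :: 'x \<Rightarrow> real. continuous_on UNIV F \<Longrightarrow> s_Asplund act F"
  shows "pm_separable UNIV (dG act)"
  unfolding dG_separable_iff
proof (intro allI impI)
  fix \<epsilon> :: real assume "\<epsilon> > 0"
  have "\<forall>e>0. \<exists>k. finite k \<and> k \<subseteq> UNIV \<and> (UNIV :: 'x set) \<subseteq> (\<Union>x\<in>k. ball x e)"
    by (rule seq_compact_imp_totally_bounded[OF compact_imp_seq_compact[OF compact_UNIV]])
  moreover have eps4: "\<epsilon> / 4 > 0" using \<open>\<epsilon> > 0\<close> by simp
  ultimately obtain P where P: "finite P" "(UNIV :: 'x set) \<subseteq> (\<Union>p\<in>P. ball p (\<epsilon> / 4))"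
    by blast
  have cont: "continuous_on UNIV (dist p)" for p :: 'x by (intro continuous_intros)
  have "\<exists>\<C>. countable \<C> \<and> \<Union>\<C> = UNIV \<and> (\<forall>C\<in>\<C>. \<forall>x\<in>C. \<forall>y\<in>C. rhoG act (dist p) x y < \<epsilon> / 4)" for p
    using assms[OF cont] eps4 unfolding s_Asplund_def rhoG_separable_iff[OF cont] by blast
  hence "\<exists>\<C>. countable \<C> \<and> \<Union>\<C> = UNIV \<and>
      (\<forall>C\<in>\<C>. \<forall>x\<in>C. \<forall>y\<in>C. \<forall>p\<in>P. rhoG act (dist p) x y < \<epsilon> / 4)"
    by (rule finite_common_refinement[OF P(1), where R = "\<lambda>p x y. rhoG act (dist p) x y < \<epsilon> / 4"])
  then obtain \<C> where \<C>: "countable \<C>" "\<Union>\<C> = UNIV"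
    "\<forall>C\<in>\<C>. \<forall>x\<in>C. \<forall>y\<in>C. \<forall>p\<in>P. rhoG act (dist p) x y < \<epsilon> / 4"
    by (elim exE conjE) (rule that)
  have "dG act x y < \<epsilon>" if "C\<in>\<C>" "x\<in>C" "y\<in>C" for C x y
  proof -
    have "dist (act g x) (act g y) \<le> 3 * \<epsilon> / 4" for g
    proof -
      obtain p where p: "p \<in> P" "dist p (act g x) < \<epsilon> / 4" using P(2) by (auto simp: subset_iff)
      have "\<bar>dist p (act g x) - dist p (act g y)\<bar> < \<epsilon> / 4"
        using rhoG_upper[OF cont] \<C>(3)[rule_format, OF that p(1)] by (rule le_less_trans)
      moreover have "dist (act g x) (act g y) \<le> dist p (act g x) + dist p (act g y)"
        by (metis dist_commute dist_triangle)
      ultimately show ?thesis using p by linarith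
    qed
    hence "dG act x y \<le> 3 * \<epsilon> / 4" by (rule dG_least)
    thus ?thesis using \<open>\<epsilon> > 0\<close> by linarith
  qed
  thus "\<exists>\<C>. countable \<C> \<and> \<Union>\<C> = UNIV \<and> (\<forall>C\<in>\<C>. \<forall>x\<in>C. \<forall>y\<in>C. dG act x y < \<epsilon>)"
    using \<C> by blast
qed

end

section \<open>Normed spaces with an explicit carrier\<close>

context normed_vspace
begin

lemma scale_0: "x \<in> vcarrier V \<Longrightarrow> vscale V 0 x = vzero V"
  using norm_eq_zero[OF scale_closed, of x 0] norm_scale[of x 0] by simp

lemma norm_zero: "vnorm V (vzero V) = 0"
  using norm_eq_zero[OF zero_closed] by simp

lemma scale_zero: "vscale V a (vzero V) = vzero V"
  using norm_eq_zero[OF scale_closed[OF zero_closed], of a] norm_scale[OF zero_closed, of a]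
  by (simp add: norm_zero)

lemma add_zero_right: "x \<in> vcarrier V \<Longrightarrow> vadd V x (vzero V) = x"
  using add_zero add_commute[OF zero_closed] by simp

lemma add_neg: "x \<in> vcarrier V \<Longrightarrow> vadd V x (vscale V (-1) x) = vzero V"
  using scale_add_left[of x 1 "-1"] scale_one[of x] scale_0[of x] by simp

lemma add_neg_left: "x \<in> vcarrier V \<Longrightarrow> vadd V (vscale V (-1) x) x = vzero V"
  using add_neg add_commute[of x "vscale V (-1) x"] scale_closed by simp

lemma add_swap:
  assumes "a \<in> vcarrier V" "b \<in> vcarrier V" "c \<in> vcarrier V" "d \<in> vcarrier V"
  shows "vadd V (vadd V a b) (vadd V c d) = vadd V (vadd V a c) (vadd V b d)"
proof -
  have "vadd V (vadd V a b) (vadd V c d) = vadd V a (vadd V (vadd V b c) d)"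
    using assms by (simp add: add_assoc add_closed)
  also have "vadd V b c = vadd V c b" using assms by (simp add: add_commute)
  also have "vadd V a (vadd V (vadd V c b) d) = vadd V (vadd V a c) (vadd V b d)"
    using assms by (simp add: add_assoc add_closed)
  finally show ?thesis .
qed

lemma vdist_eq:
  "x \<in> vcarrier V \<Longrightarrow> y \<in> vcarrier V \<Longrightarrow> vdist V x y = vnorm V (vadd V x (vscale V (-1) y))"
  by (simp add: vdist_def)

lemma vdist_nonneg: "0 \<le> vdist V x y"
  by (simp add: vdist_def norm_nonneg add_closed scale_closed)

lemma vdist_self: "vdist V x x = 0"
  by (simp add: vdist_def add_neg norm_zero)

lemma vdist_sym: "vdist V x y = vdist V y x"
proof (cases "x \<in> vcarrier V \<and> y \<in> vcarrier V")
  case True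
  hence "vscale V (-1) (vadd V x (vscale V (-1) y)) = vadd V y (vscale V (-1) x)"
    by (simp add: scale_add_right scale_closed scale_scale scale_one add_commute)
  thus ?thesis
    using True norm_scale[of "vadd V x (vscale V (-1) y)" "-1"]
    by (simp add: vdist_def add_closed scale_closed)
qed (auto simp: vdist_def)

lemma vdist_add:
  assumes "a \<in> vcarrier V" "b \<in> vcarrier V" "c \<in> vcarrier V" "d \<in> vcarrier V"
  shows "vdist V (vadd V a b) (vadd V c d) \<le> vdist V a c + vdist V b d"
proof -
  have "vadd V (vadd V a b) (vscale V (-1) (vadd V c d)) =
      vadd V (vadd V a (vscale V (-1) c)) (vadd V b (vscale V (-1) d))"
    using assms by (simp add: scale_add_right add_swap scale_closed)
  thus ?thesis
    using assms by (simp add: vdist_eq norm_triangle add_closed scale_closed)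
qed

lemma vdist_triangle:
  assumes "x \<in> vcarrier V" "y \<in> vcarrier V" "z \<in> vcarrier V"
  shows "vdist V x z \<le> vdist V x y + vdist V y z"
proof -
  have "vadd V (vadd V x (vscale V (-1) y)) (vadd V y (vscale V (-1) z)) =
      vadd V x (vadd V (vadd V (vscale V (-1) y) y) (vscale V (-1) z))"
    using assms by (simp add: add_assoc add_closed scale_closed)
  also have "\<dots> = vadd V x (vscale V (-1) z)"
    using assms by (simp add: add_neg_left add_zero scale_closed)
  finally have eq: "vadd V x (vscale V (-1) z) =
      vadd V (vadd V x (vscale V (-1) y)) (vadd V y (vscale V (-1) z))" by simp
  show ?thesis
    using assms unfolding vdist_eq[OF assms(1,3)] eq
    by (simp add: vdist_eq norm_triangle add_closed scale_closed)
qed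

lemma vdist_scale:
  assumes "x \<in> vcarrier V" "y \<in> vcarrier V"
  shows "vdist V (vscale V a x) (vscale V a y) = \<bar>a\<bar> * vdist V x y"
proof -
  have "vadd V (vscale V a x) (vscale V (-1) (vscale V a y)) =
      vscale V a (vadd V x (vscale V (-1) y))"
    using assms by (simp add: scale_add_right scale_scale scale_closed)
  thus ?thesis using assms by (simp add: vdist_eq scale_closed norm_scale add_closed)
qed

lemma vdist_scale_left:
  assumes "x \<in> vcarrier V"
  shows "vdist V (vscale V a x) (vscale V b x) = \<bar>a - b\<bar> * vnorm V x"
proof -
  have "vadd V (vscale V a x) (vscale V (-1) (vscale V b x)) = vscale V (a - b) x"
    using assms scale_add_left[of x a "-b"] by (simp add: scale_scale scale_closed)
  thus ?thesis using assms by (simp add: vdist_eq scale_closed norm_scale)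
qed

lemma vdist_eq_0_iff:
  assumes "x \<in> vcarrier V" "y \<in> vcarrier V"
  shows "vdist V x y = 0 \<longleftrightarrow> x = y"
proof
  assume "vdist V x y = 0"
  hence "vadd V x (vscale V (-1) y) = vzero V"
    using assms by (simp add: vdist_eq norm_eq_zero add_closed scale_closed)
  hence "vadd V (vadd V x (vscale V (-1) y)) y = y" using assms by (simp add: add_zero)
  thus "x = y" using assms by (simp add: add_assoc scale_closed add_neg_left add_zero_right)
qed (simp add: vdist_self)

sublocale met: Metric_space "vcarrier V" "vdist V"
  by unfold_locales
    (simp_all add: vdist_nonneg vdist_sym vdist_eq_0_iff vdist_triangle)

lemma mcomplete_iff:
  "met.mcomplete \<longleftrightarrow> (\<forall>s :: nat \<Rightarrow> 'v. range s \<subseteq> vcarrier V \<longrightarrow>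
     (\<forall>\<epsilon>>0. \<exists>N. \<forall>m\<ge>N. \<forall>n\<ge>N. vdist V (s m) (s n) < \<epsilon>) \<longrightarrow>
     (\<exists>x\<in>vcarrier V. \<forall>\<epsilon>>0. \<exists>N. \<forall>n\<ge>N. vdist V (s n) x < \<epsilon>))"
proof -
  have lim: "limitin met.mtopology s x sequentially \<longleftrightarrow>
      x \<in> vcarrier V \<and> (\<forall>\<epsilon>>0. \<exists>N. \<forall>n\<ge>N. vdist V (s n) x < \<epsilon>)" if "range s \<subseteq> vcarrier V" for s x
    using that by (auto simp: met.limit_metric_sequentially subset_iff)
  have cauchy: "met.MCauchy s \<longleftrightarrow> range s \<subseteq> vcarrier V \<and>
      (\<forall>\<epsilon>>0. \<exists>N. \<forall>m\<ge>N. \<forall>n\<ge>N. vdist V (s m) (s n) < \<epsilon>)" for s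
    unfolding met.MCauchy_def by meson
  have key: "((range s \<subseteq> vcarrier V \<and> (\<forall>\<epsilon>>0. \<exists>N. \<forall>m\<ge>N. \<forall>n\<ge>N. vdist V (s m) (s n) < \<epsilon>)) \<longrightarrow>
        (\<exists>x. limitin met.mtopology s x sequentially)) \<longleftrightarrow>
      (range s \<subseteq> vcarrier V \<longrightarrow> (\<forall>\<epsilon>>0. \<exists>N. \<forall>m\<ge>N. \<forall>n\<ge>N. vdist V (s m) (s n) < \<epsilon>) \<longrightarrow>
        (\<exists>x\<in>vcarrier V. \<forall>\<epsilon>>0. \<exists>N. \<forall>n\<ge>N. vdist V (s n) x < \<epsilon>))" for s :: "nat \<Rightarrow> 'v"
  proof (cases "range s \<subseteq> vcarrier V")
    case True
    thus ?thesis unfolding lim[OF True] by blast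
  qed blast
  show ?thesis
    unfolding met.mcomplete_def cauchy by (rule arg_cong[where f = All], rule ext, rule key)
qed

definition subspace_carrier :: "'v set \<Rightarrow> bool" where
  "subspace_carrier W \<longleftrightarrow> W \<subseteq> vcarrier V \<and> vzero V \<in> W \<and>
     (\<forall>x\<in>W. \<forall>y\<in>W. vadd V x y \<in> W) \<and> (\<forall>a. \<forall>x\<in>W. vscale V a x \<in> W)"

lemma normed_vspace_subspace:
  assumes "subspace_carrier W"
  shows "normed_vspace (V\<lparr>vcarrier := W\<rparr>)"
proof -
  have [simp, intro]: "x \<in> vcarrier V" if "x \<in> W" for x
    using assms that unfolding subspace_carrier_def by blast
  show ?thesis
  proof
    fix x assume "x \<in> vcarrier (V\<lparr>vcarrier := W\<rparr>)"
    hence "x \<in> W" by simp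
    thus "\<exists>y\<in>vcarrier (V\<lparr>vcarrier := W\<rparr>). vadd (V\<lparr>vcarrier := W\<rparr>) x y = vzero (V\<lparr>vcarrier := W\<rparr>)"
      using assms by (intro bexI[of _ "vscale V (-1) x"]) (simp_all add: add_neg subspace_carrier_def)
  next
    fix x y assume "x \<in> vcarrier (V\<lparr>vcarrier := W\<rparr>)" "y \<in> vcarrier (V\<lparr>vcarrier := W\<rparr>)"
    thus "vadd (V\<lparr>vcarrier := W\<rparr>) x y = vadd (V\<lparr>vcarrier := W\<rparr>) y x"
      using add_commute[of x y] by simp
  qed (use assms in \<open>simp_all add: subspace_carrier_def add_assoc add_zero
      scale_add_right scale_add_left scale_scale scale_one norm_nonneg norm_eq_zero norm_scale
      norm_triangle\<close>)
qed

text \<open>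
Finite combinations are coded by lists since the lists over a countable set are countable.
\<close>

fun combination :: "(real \<times> 'v) list \<Rightarrow> 'v" where
  "combination [] = vzero V"
| "combination ((q, v) # l) = vadd V (vscale V q v) (combination l)"

lemma combination_closed:
  "set l \<subseteq> UNIV \<times> vcarrier V \<Longrightarrow> combination l \<in> vcarrier V"
  by (induction l rule: combination.induct) (auto simp: zero_closed add_closed scale_closed)

lemma combination_append:
  "set l \<subseteq> UNIV \<times> vcarrier V \<Longrightarrow> set l' \<subseteq> UNIV \<times> vcarrier V \<Longrightarrow>
    combination (l @ l') = vadd V (combination l) (combination l')"
  by (induction l rule: combination.induct)
    (auto simp: add_zero combination_closed add_assoc scale_closed)

lemma combination_scale:
  "set l \<subseteq> UNIV \<times> vcarrier V \<Longrightarrow>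
    combination (map (\<lambda>(q, v). (r * q, v)) l) = vscale V r (combination l)"
  by (induction l rule: combination.induct)
    (auto simp: scale_zero scale_add_right scale_scale scale_closed combination_closed)

end

text \<open>
\<open>W\<close> is the closure of the set \<open>Q\<close> of rational combinations. It is closed under all real scalars because
a real multiple of an element of \<open>Q\<close> is a limit of rational ones.
\<close>

lemma (in banach_vspace) separable_closed_span:
  assumes A: "A \<subseteq> vcarrier V" "countable A"
  obtains W where "A \<subseteq> W" "W \<subseteq> vcarrier V" "banach_vspace (V\<lparr>vcarrier := W\<rparr>)"
    "pm_separable W (vdist V)"
proof
  define Q where "Q = combination ` lists (\<rat> \<times> A)"
  define W where "W = {x \<in> vcarrier V. \<forall>\<epsilon>>0. \<exists>y\<in>Q. vdist V x y < \<epsilon>}"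
  have list_carrier: "set l \<subseteq> UNIV \<times> vcarrier V" if "l \<in> lists (\<rat> \<times> A)" for l
    using that A(1) by auto
  have Q_carrier: "x \<in> vcarrier V" if "x \<in> Q" for x
    using that combination_closed[OF list_carrier] by (auto simp: Q_def)
  have W_carrier: "x \<in> vcarrier V" if "x \<in> W" for x
    using that by (simp add: W_def)
  have near: "\<exists>y\<in>Q. vdist V x y < \<epsilon>" if "x \<in> W" "\<epsilon> > 0" for x \<epsilon>
    using that by (simp add: W_def)
  have Q_add: "vadd V x y \<in> Q" if xy: "x \<in> Q" "y \<in> Q" for x y
  proof -
    obtain k l where "k \<in> lists (\<rat> \<times> A)" "x = combination k" "l \<in> lists (\<rat> \<times> A)" "y = combination l"
      using xy unfolding Q_def by blast
    thus ?thesis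
      unfolding Q_def by (intro image_eqI[of _ _ "k @ l"])
        (simp_all add: combination_append list_carrier del: in_lists_conv_set)
  qed
  have Q_scale: "vscale V r x \<in> Q" if rx: "r \<in> \<rat>" "x \<in> Q" for r x
  proof -
    obtain l where l: "l \<in> lists (\<rat> \<times> A)" "x = combination l" using rx(2) unfolding Q_def by blast
    have "map (\<lambda>(q, v). (r * q, v)) l \<in> lists (\<rat> \<times> A)" using l(1) rx(1) by (fastforce intro: Rats_mult)
    thus ?thesis
      unfolding Q_def l(2) by (intro image_eqI) (simp_all add: combination_scale list_carrier l(1))
  qed
  have Q_W: "Q \<subseteq> W"
    using Q_carrier vdist_self by (auto simp: W_def intro!: bexI)
  have W_add: "vadd V x y \<in> W" if xy: "x \<in> W" "y \<in> W" for x y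
  proof -
    have "\<exists>z\<in>Q. vdist V (vadd V x y) z < \<epsilon>" if "\<epsilon> > 0" for \<epsilon>
    proof -
      obtain a b where ab: "a \<in> Q" "b \<in> Q" "vdist V x a < \<epsilon> / 2" "vdist V y b < \<epsilon> / 2"
        using near[OF xy(1), of "\<epsilon> / 2"] near[OF xy(2), of "\<epsilon> / 2"] \<open>\<epsilon> > 0\<close> by auto
      have "vdist V (vadd V x y) (vadd V a b) \<le> vdist V x a + vdist V y b"
        using xy ab by (intro vdist_add W_carrier Q_carrier)
      thus ?thesis using ab by (intro bexI[OF _ Q_add[OF ab(1,2)]]) simp
    qed
    thus ?thesis using xy by (simp add: W_def add_closed)
  qed
  have W_scale: "vscale V r x \<in> W" if x: "x \<in> W" for r x
  proof -
    have "\<exists>z\<in>Q. vdist V (vscale V r x) z < \<epsilon>" if "\<epsilon> > 0" for \<epsilon>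
    proof -
      have pos: "\<epsilon> / 2 / (\<bar>r\<bar> + 1) > 0" using \<open>\<epsilon> > 0\<close> by simp
      obtain a where a: "a \<in> Q" "vdist V x a < \<epsilon> / 2 / (\<bar>r\<bar> + 1)" using near[OF x pos] by blast
      have "vdist V (vscale V r x) (vscale V r a) = \<bar>r\<bar> * vdist V x a"
        using x a by (intro vdist_scale W_carrier Q_carrier)
      also have "\<dots> \<le> (\<bar>r\<bar> + 1) * vdist V x a"
        using vdist_nonneg[of x a] by (intro mult_right_mono) auto
      also have "\<dots> < \<epsilon> / 2" using a(2) by (simp add: field_simps add_pos_nonneg)
      finally have 1: "vdist V (vscale V r x) (vscale V r a) < \<epsilon> / 2" .
      have n: "0 \<le> vnorm V a" using Q_carrier[OF a(1)] by (rule norm_nonneg)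
      hence "r < r + \<epsilon> / 2 / (vnorm V a + 1)" using \<open>\<epsilon> > 0\<close> by simp
      then obtain q where q: "q \<in> \<rat>" "r < q" "q < r + \<epsilon> / 2 / (vnorm V a + 1)"
        using Rats_dense_in_real by blast
      have "vdist V (vscale V r a) (vscale V q a) = \<bar>r - q\<bar> * vnorm V a"
        using Q_carrier[OF a(1)] by (rule vdist_scale_left)
      also have "\<dots> \<le> (q - r) * (vnorm V a + 1)"
        using q n by (intro mult_mono) auto
      also have "\<dots> < \<epsilon> / 2" using q(3) n by (simp add: field_simps)
      finally have 2: "vdist V (vscale V r a) (vscale V q a) < \<epsilon> / 2" .
      have "vdist V (vscale V r x) (vscale V q a)
          \<le> vdist V (vscale V r x) (vscale V r a) + vdist V (vscale V r a) (vscale V q a)"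
        using W_carrier[OF x] Q_carrier[OF a(1)] by (intro vdist_triangle scale_closed)
      thus ?thesis using 1 2 by (intro bexI[OF _ Q_scale[OF q(1) a(1)]]) simp
    qed
    thus ?thesis using x by (simp add: W_def scale_closed)
  qed
  have "combination [] \<in> Q" unfolding Q_def by (intro imageI) simp
  hence "vzero V \<in> W" using Q_W by auto
  hence sub: "subspace_carrier W"
    using W_add W_scale W_carrier by (auto simp: subspace_carrier_def)
  interpret W: normed_vspace "V\<lparr>vcarrier := W\<rparr>"
    using sub by (rule normed_vspace_subspace)
  have dist_W: "vdist (V\<lparr>vcarrier := W\<rparr>) x y = vdist V x y" if "x \<in> W" "y \<in> W" for x y
    using that W_carrier by (simp add: vdist_def)
  have "W.met.mcomplete"
  proof (rule W.mcomplete_iff[THEN iffD2], intro allI impI)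
    fix s :: "nat \<Rightarrow> 'a" assume "range s \<subseteq> vcarrier (V\<lparr>vcarrier := W\<rparr>)"
      and cauchy: "\<forall>\<epsilon>>0. \<exists>N. \<forall>m\<ge>N. \<forall>n\<ge>N. vdist (V\<lparr>vcarrier := W\<rparr>) (s m) (s n) < \<epsilon>"
    hence s: "s n \<in> W" for n by auto
    hence "\<forall>\<epsilon>>0. \<exists>N. \<forall>m\<ge>N. \<forall>n\<ge>N. vdist V (s m) (s n) < \<epsilon>" using cauchy by (simp add: dist_W)
    then obtain x where x: "x \<in> vcarrier V" "\<forall>\<epsilon>>0. \<exists>N. \<forall>n\<ge>N. vdist V (s n) x < \<epsilon>"
      using complete[unfolded mcomplete_iff, rule_format, of s] s W_carrier by blast
    have "\<exists>y\<in>Q. vdist V x y < \<epsilon>" if "\<epsilon> > 0" for \<epsilon>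
    proof -
      obtain N where "\<forall>n\<ge>N. vdist V (s n) x < \<epsilon> / 2" using x(2) \<open>\<epsilon> > 0\<close> half_gt_zero by blast
      hence 1: "vdist V x (s N) < \<epsilon> / 2" by (simp add: vdist_sym[of x])
      obtain y where y: "y \<in> Q" "vdist V (s N) y < \<epsilon> / 2"
        using near[OF s, of "\<epsilon> / 2"] \<open>\<epsilon> > 0\<close> by auto
      have "vdist V x y \<le> vdist V x (s N) + vdist V (s N) y"
        by (intro vdist_triangle x(1) W_carrier[OF s] Q_carrier[OF y(1)])
      thus ?thesis using 1 y by (intro bexI[OF _ y(1)]) simp
    qed
    hence "x \<in> W" using x(1) by (simp add: W_def)
    thus "\<exists>x\<in>vcarrier (V\<lparr>vcarrier := W\<rparr>). \<forall>\<epsilon>>0. \<exists>N. \<forall>n\<ge>N. vdist (V\<lparr>vcarrier := W\<rparr>) (s n) x < \<epsilon>"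
      using x(2) s by (intro bexI[of _ x]) (simp_all add: dist_W)
  qed
  thus "banach_vspace (V\<lparr>vcarrier := W\<rparr>)" by unfold_locales
  show "W \<subseteq> vcarrier V" using W_carrier by blast
  show "A \<subseteq> W"
  proof
    fix a assume a: "a \<in> A"
    hence "a = combination [(1, a)]" using A(1) by (auto simp: scale_one add_zero_right)
    moreover have "[(1, a)] \<in> lists (\<rat> \<times> A)" using a by simp
    ultimately have "a \<in> Q" unfolding Q_def by (rule image_eqI)
    thus "a \<in> W" using Q_W by blast
  qed
  have "countable Q" unfolding Q_def using A(2) by (intro countable_image countable_lists) (simp add: countable_rat)
  thus "pm_separable W (vdist V)"
    unfolding pm_separable_def using Q_W near by blast
qed

lemma (in normed_vspace) dual_norm_bound:
  assumes f: "f \<in> dual V" and f': "f' \<in> dual V" and w: "w \<in> vcarrier V"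
  shows "\<bar>f w - f' w\<bar> \<le> dual_norm V (\<lambda>v. f v - f' v) * vnorm V w"
proof -
  obtain C C' where C: "\<And>x. x \<in> vcarrier V \<Longrightarrow> \<bar>f x\<bar> \<le> C * vnorm V x"
    "\<And>x. x \<in> vcarrier V \<Longrightarrow> \<bar>f' x\<bar> \<le> C' * vnorm V x"
    using f f' unfolding dual_def by blast
  have scale: "f (vscale V a w) = a * f w" "f' (vscale V a w) = a * f' w" for a
    using f f' w unfolding dual_def by blast+
  have upper: "\<bar>f u - f' u\<bar> \<le> dual_norm V (\<lambda>v. f v - f' v)" if u: "u \<in> vcarrier V" "vnorm V u \<le> 1" for u
    unfolding dual_norm_def
  proof (rule cSUP_upper)
    have "\<bar>f x - f' x\<bar> \<le> \<bar>C\<bar> + \<bar>C'\<bar>" if x: "x \<in> vcarrier V" "vnorm V x \<le> 1" for x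
    proof -
      have "C * vnorm V x \<le> \<bar>C\<bar> * 1" "C' * vnorm V x \<le> \<bar>C'\<bar> * 1"
        using x norm_nonneg[OF x(1)] by (intro mult_mono; simp)+
      thus ?thesis using C[OF x(1)] by linarith
    qed
    thus "bdd_above ((\<lambda>x. \<bar>f x - f' x\<bar>) ` {x \<in> vcarrier V. vnorm V x \<le> 1})"
      by (intro bdd_aboveI2[of _ _ "\<bar>C\<bar> + \<bar>C'\<bar>"]) simp
  qed (use u in simp)
  show ?thesis
  proof (cases "vnorm V w = 0")
    case True
    thus ?thesis using C[OF w] by simp
  next
    case False
    hence pos: "vnorm V w > 0" using norm_nonneg[OF w] by simp
    have "\<bar>f (vscale V (1 / vnorm V w) w) - f' (vscale V (1 / vnorm V w) w)\<bar>
        \<le> dual_norm V (\<lambda>v. f v - f' v)"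
      using pos w by (intro upper) (simp_all add: scale_closed norm_scale)
    also have "f (vscale V (1 / vnorm V w) w) - f' (vscale V (1 / vnorm V w) w) = (f w - f' w) / vnorm V w"
      by (simp add: scale diff_divide_distrib)
    finally show ?thesis using pos by (simp add: field_simps)
  qed
qed

section \<open>Representable systems have separable \<open>d\<^sub>G\<close>\<close>

lemma topspace_weak_star: "topspace (weak_star V) = dual V"
proof -
  have "dual V \<subseteq> extensional (vcarrier V)" by (auto simp: dual_def)
  thus ?thesis by (auto simp: weak_star_def PiE_UNIV_domain extensional_def PiE_def)
qed

context compact_system
begin

text \<open>
For every rational \<open>q\<close> the open sets \<open>{(x, y). q < dist (act g x) (act g y)}\<close> have the same union over
all \<open>g\<close> as over countably many \<open>g\<close>. Thus \<open>d\<^sub>G\<close> is already the supremum over a countable set, although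
\<open>G\<close> itself need not be separable.
\<close>

lemma countable_dG:
  obtains H where "countable H"
    "\<forall>x y r. (\<forall>g\<in>H. dist (act g x) (act g y) \<le> r) \<longrightarrow> dG act x y \<le> r"
proof -
  define S where "S q g = {(x, y). q < dist (act g x) (act g y)}" for q g
  have compact2: "compact (UNIV :: ('x \<times> 'x) set)"
    using compact_Times[OF compact_UNIV compact_UNIV] by simp
  have "continuous_on UNIV (\<lambda>z. dist (act g (fst z)) (act g (snd z)))" for g
    by (intro continuous_intros continuous_on_compose2[OF continuous_on_act[of UNIV]]) auto
  hence open_S: "open (S q g)" for q g
    unfolding S_def case_prod_beta by (rule open_Collect_less[OF continuous_on_const])
  have "\<exists>K. countable K \<and> (\<Union>g\<in>K. S q g) = (\<Union>g. S q g)" for q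
  proof -
    obtain \<F> where \<F>: "\<F> \<subseteq> range (S q)" "countable \<F>" "\<Union>\<F> = \<Union>(range (S q))"
      by (rule compact_UNIV_Lindelof[OF compact2, of "range (S q)"]) (use open_S in blast)+
    then obtain K where "countable K" "\<F> = S q ` K"
      by (metis countable_subset_image subset_UNIV)
    thus ?thesis using \<F>(3) by auto
  qed
  then obtain K where K: "\<And>q. countable (K q)" "\<And>q. (\<Union>g\<in>K q. S q g) = (\<Union>g. S q g)"
    by metis
  show thesis
  proof
    show "countable (\<Union>q\<in>\<rat>. K q)" by (intro countable_UN countable_rat K(1))
    show "\<forall>x y r. (\<forall>g\<in>(\<Union>q\<in>\<rat>. K q). dist (act g x) (act g y) \<le> r) \<longrightarrow> dG act x y \<le> r"
    proof (intro allI impI dG_least, rule ccontr)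
      fix x y r assume *: "\<forall>g\<in>(\<Union>q\<in>\<rat>. K q). dist (act g x) (act g y) \<le> r"
      fix g assume "\<not> dist (act g x) (act g y) \<le> r"
      then obtain q where q: "q \<in> \<rat>" "r < q" "q < dist (act g x) (act g y)"
        using Rats_dense_in_real by (meson not_le)
      hence "(x, y) \<in> (\<Union>g. S q g)" by (auto simp: S_def)
      hence "(x, y) \<in> (\<Union>g\<in>K q. S q g)" using K(2) by simp
      then obtain k where "k \<in> K q" "q < dist (act k x) (act k y)" by (auto simp: S_def)
      moreover from this have "dist (act k x) (act k y) \<le> r" using q(1) * by blast
      ultimately show False using q(2) by linarith
    qed
  qed
qed

text \<open>
A quantitative form of the fact that a compact space carries the topology induced by any separating
family of continuous functions: the compact set of pairs at distance at least \<open>\<epsilon>\<close> is covered by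
finitely many of the open sets on which some \<open>\<alpha> x v\<close> and \<open>\<alpha> y v\<close> are visibly different.
\<close>

lemma finite_separating_family:
  fixes \<alpha> :: "'x \<Rightarrow> 'v \<Rightarrow> real"
  assumes cont: "\<And>v. v \<in> S \<Longrightarrow> continuous_on UNIV (\<lambda>x. \<alpha> x v)"
    and sep: "\<And>x y. x \<noteq> y \<Longrightarrow> \<exists>v\<in>S. \<alpha> x v \<noteq> \<alpha> y v"
    and "\<epsilon> > 0"
  obtains B :: "('v \<times> nat) set" where "finite B" "fst ` B \<subseteq> S"
    "\<And>x y. (\<And>v n. (v, n) \<in> B \<Longrightarrow> \<bar>\<alpha> x v - \<alpha> y v\<bar> \<le> 1 / real (Suc n)) \<Longrightarrow> dist x y < \<epsilon>"
proof -
  define K :: "('x \<times> 'x) set" where "K = {z. \<epsilon> \<le> dist (fst z) (snd z)}"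
  define O' where "O' = (\<lambda>(v, n). {z. 1 / real (Suc n) < \<bar>\<alpha> (fst z) v - \<alpha> (snd z) v\<bar>})"
  have "compact (UNIV :: ('x \<times> 'x) set)"
    using compact_Times[OF compact_UNIV compact_UNIV] by simp
  moreover have "closed K" unfolding K_def by (intro closed_Collect_le continuous_intros)
  ultimately have "compact K" using closed_Int_compact[of K UNIV] by simp
  moreover have "open (O' p)" if p: "p \<in> S \<times> UNIV" for p
  proof -
    obtain v n where vn: "p = (v, n)" "v \<in> S" using p by (cases p) auto
    have "continuous_on UNIV (\<lambda>z::'x\<times>'x. \<alpha> (fst z) v)" "continuous_on UNIV (\<lambda>z::'x\<times>'x. \<alpha> (snd z) v)"
      by (rule continuous_on_compose2[OF cont[OF vn(2)]]; auto intro!: continuous_intros)+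
    thus ?thesis unfolding O'_def vn(1) prod.case
      by (intro open_Collect_less continuous_intros)
  qed
  moreover have "K \<subseteq> (\<Union>p\<in>S \<times> UNIV. O' p)"
  proof
    fix z assume "z \<in> K"
    hence "fst z \<noteq> snd z" using \<open>\<epsilon> > 0\<close> by (auto simp: K_def)
    then obtain v where v: "v \<in> S" "\<alpha> (fst z) v \<noteq> \<alpha> (snd z) v" using sep by blast
    hence "\<bar>\<alpha> (fst z) v - \<alpha> (snd z) v\<bar> > 0" by simp
    then obtain n where "1 / real (Suc n) < \<bar>\<alpha> (fst z) v - \<alpha> (snd z) v\<bar>" by (rule nat_approx_posE)
    hence "z \<in> O' (v, n)" by (simp add: O'_def)
    thus "z \<in> (\<Union>p\<in>S \<times> UNIV. O' p)" using v(1) by blast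
  qed
  ultimately obtain B where B: "B \<subseteq> S \<times> UNIV" "finite B" "K \<subseteq> (\<Union>p\<in>B. O' p)"
    by (rule compactE_image)
  show thesis
  proof
    show "finite B" by fact
    show "fst ` B \<subseteq> S" using B(1) by auto
    fix x y assume *: "\<And>v n. (v, n) \<in> B \<Longrightarrow> \<bar>\<alpha> x v - \<alpha> y v\<bar> \<le> 1 / real (Suc n)"
    show "dist x y < \<epsilon>"
    proof (rule ccontr)
      assume "\<not> dist x y < \<epsilon>"
      hence "(x, y) \<in> K" by (simp add: K_def)
      then obtain p where p: "p \<in> B" "(x, y) \<in> O' p" using B(3) by blast
      obtain v n where "p = (v, n)" by (cases p)
      with p *[of v n] show False by (simp add: O'_def)
    qed
  qed
qed

text \<open>
Equivariance gives \<open>\<alpha> (act g x) v - \<alpha> (act g y) v = (\<alpha> x - \<alpha> y) (h g v)\<close>, and \<open>h g\<close> is an isometry. So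
two points whose functionals are close in norm on a subspace \<open>W\<close> containing all \<open>h g v\<close> have orbits that
stay close. The group may be nonseparable, hence \<open>g\<close> is restricted to a countable set that
determines \<open>d\<^sub>G\<close>; only then is \<open>W\<close> separable.
\<close>

lemma RN_imp_dG_separable:
  assumes "RN TYPE('v) act"
  shows "pm_separable UNIV (dG act)"
proof -
  obtain V :: "'v vspace" and h :: "'g \<Rightarrow> 'v \<Rightarrow> 'v" and \<alpha> :: "'x \<Rightarrow> 'v \<Rightarrow> real"
    where V: "Asplund V" and h: "\<forall>g. h g \<in> Iso V"
      and emb: "embedding_map euclidean (weak_star V) \<alpha>"
      and equiv: "\<forall>g x. \<forall>v\<in>vcarrier V. \<alpha> (act g x) v = \<alpha> x (h g v)"
    using assms unfolding RN_def by blast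
  interpret V: banach_vspace V using V by (simp add: Asplund_def)
  have homeo: "homeomorphic_map euclidean (subtopology (weak_star V) (range \<alpha>)) \<alpha>"
    using emb by (simp add: embedding_map_def)
  have cont: "continuous_map euclidean (weak_star V) \<alpha>"
    using homeomorphic_imp_continuous_map[OF homeo] by (rule continuous_map_into_fulltopology)
  have \<alpha>_dual: "\<alpha> x \<in> dual V" for x
    using continuous_map_image_subset_topspace[OF cont] by (auto simp: topspace_weak_star)
  have cont_v: "continuous_on UNIV (\<lambda>x. \<alpha> x v)" if v: "v \<in> vcarrier V" for v
  proof -
    have "continuous_map euclidean (product_topology (\<lambda>_. euclideanreal) (vcarrier V)) \<alpha>"
      using cont by (simp add: weak_star_def continuous_map_in_subtopology)
    thus ?thesis using v by (simp add: continuous_map_componentwise)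
  qed
  have inj: "inj \<alpha>"
    using homeomorphic_imp_injective_map[OF homeo] by simp
  have sep: "\<exists>v\<in>vcarrier V. \<alpha> x v \<noteq> \<alpha> y v" if "x \<noteq> y" for x y
  proof (rule ccontr)
    assume "\<not> ?thesis"
    hence "\<alpha> x = \<alpha> y" using \<alpha>_dual[of x] \<alpha>_dual[of y]
      by (intro extensionalityI[of _ "vcarrier V"]) (auto simp: dual_def)
    thus False using inj \<open>x \<noteq> y\<close> by (simp add: inj_eq)
  qed
  obtain H where H: "countable H"
    "\<forall>x y r. (\<forall>g\<in>H. dist (act g x) (act g y) \<le> r) \<longrightarrow> dG act x y \<le> r"
    by (rule countable_dG)
  have h_carrier: "h g v \<in> vcarrier V" and h_norm: "vnorm V (h g v) = vnorm V v"
    if "v \<in> vcarrier V" for g v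
    using h that imageI[of v "vcarrier V" "h g"] by (simp_all add: Iso_def bij_betw_def)
  show ?thesis
    unfolding dG_separable_iff
  proof (intro allI impI)
    fix \<epsilon> :: real assume "\<epsilon> > 0"
    obtain B :: "('v \<times> nat) set" where B: "finite B" "fst ` B \<subseteq> vcarrier V"
      "\<And>x y. (\<And>v n. (v, n) \<in> B \<Longrightarrow> \<bar>\<alpha> x v - \<alpha> y v\<bar> \<le> 1 / real (Suc n)) \<Longrightarrow> dist x y < \<epsilon> / 2"
      by (rule finite_separating_family[of "vcarrier V" \<alpha> "\<epsilon> / 2", OF cont_v sep])
        (use \<open>\<epsilon> > 0\<close> in auto)
    define A where "A = (\<lambda>(g, v). h g v) ` (H \<times> fst ` B)"
    have "A \<subseteq> vcarrier V" using B(2) h_carrier by (auto simp: A_def)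
    moreover have "countable A" unfolding A_def using H(1) B(1) by (simp add: countable_finite)
    ultimately obtain W where W: "A \<subseteq> W" "W \<subseteq> vcarrier V" "banach_vspace (V\<lparr>vcarrier := W\<rparr>)"
      "pm_separable W (vdist V)"
      by (rule V.separable_closed_span)
    let ?W = "V\<lparr>vcarrier := W\<rparr>"
    interpret W: banach_vspace ?W by fact
    have "pm_separable (dual ?W) (\<lambda>f f'. dual_norm ?W (\<lambda>v. f v - f' v))"
      using V W(2-4) unfolding Asplund_def by blast
    then obtain D where D: "D \<subseteq> dual ?W" "countable D"
      "\<forall>f\<in>dual ?W. \<forall>\<delta>>0. \<exists>d\<in>D. dual_norm ?W (\<lambda>v. f v - d v) < \<delta>"
      unfolding pm_separable_def by (elim exE conjE) (rule that)
    \<comment> \<open>Small enough for all finitely many \<open>(v, n) \<in> B\<close> at once; the inserted \<open>1\<close> covers the case of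
        an empty \<open>B\<close>.\<close>
    define \<delta> where "\<delta> = Min (insert 1 ((\<lambda>(v, n). 1 / real (Suc n) / (vnorm V v + 1)) ` B))"
    have "0 < 1 / real (Suc n) / (vnorm V v + 1)" if vn: "(v, n) \<in> B" for v n
    proof -
      have "v \<in> vcarrier V" using vn B(2) by force
      thus ?thesis using V.norm_nonneg[of v] by (intro divide_pos_pos) simp_all
    qed
    hence "0 < \<delta>"
      unfolding \<delta>_def using B(1) by (subst Min_gr_iff) auto
    have \<delta>: "\<delta> * vnorm V v \<le> 1 / real (Suc n)" if vn: "(v, n) \<in> B" for v n
    proof -
      have v: "0 \<le> vnorm V v" using vn B(2) V.norm_nonneg by force
      have "\<delta> \<le> 1 / real (Suc n) / (vnorm V v + 1)"
        unfolding \<delta>_def using B(1) vn by (intro Min_le) force+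
      hence "\<delta> * (vnorm V v + 1) \<le> 1 / real (Suc n) / (vnorm V v + 1) * (vnorm V v + 1)"
        using v by (intro mult_right_mono) simp_all
      also have "\<dots> = 1 / real (Suc n)" using v by simp
      finally have "\<delta> * (vnorm V v + 1) \<le> 1 / real (Suc n)" .
      thus ?thesis using \<open>0 < \<delta>\<close> by (simp add: distrib_left)
    qed
    define \<rho> where "\<rho> x = restrict (\<alpha> x) W" for x
    have \<rho>_dual: "\<rho> x \<in> dual ?W" for x
    proof -
      have lin: "\<forall>v\<in>vcarrier V. \<forall>w\<in>vcarrier V. \<alpha> x (vadd V v w) = \<alpha> x v + \<alpha> x w"
        "\<forall>a. \<forall>v\<in>vcarrier V. \<alpha> x (vscale V a v) = a * \<alpha> x v"
        using \<alpha>_dual[of x] by (simp_all add: dual_def)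
      obtain C where "\<forall>v\<in>vcarrier V. \<bar>\<alpha> x v\<bar> \<le> C * vnorm V v"
        using \<alpha>_dual[of x] unfolding dual_def by blast
      hence C: "\<forall>v\<in>W. \<bar>\<alpha> x v\<bar> \<le> C * vnorm V v" using W(2) by blast
      show ?thesis
        unfolding dual_def \<rho>_def mem_Collect_eq
      proof (intro conjI)
        show "\<exists>C. \<forall>v\<in>vcarrier ?W. \<bar>restrict (\<alpha> x) W v\<bar> \<le> C * vnorm ?W v"
          using C by (intro exI[of _ C]) simp
      qed (use lin W(2) W.add_closed W.scale_closed in \<open>auto simp: subset_iff\<close>)
    qed
    define \<C> where "\<C> = (\<lambda>d. {x. dual_norm ?W (\<lambda>v. \<rho> x v - d v) < \<delta> / 2}) ` D"
    have "\<Union>\<C> = UNIV"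
      using D(3)[rule_format, OF \<rho>_dual, of "\<delta> / 2"] \<open>0 < \<delta>\<close> by (auto simp: \<C>_def)
    moreover have "dG act x y < \<epsilon>" if C: "C \<in> \<C>" "x \<in> C" "y \<in> C" for C x y
    proof -
      obtain d where d: "d \<in> D" "dual_norm ?W (\<lambda>v. \<rho> x v - d v) < \<delta> / 2"
        "dual_norm ?W (\<lambda>v. \<rho> y v - d v) < \<delta> / 2" using C by (auto simp: \<C>_def)
      have *: "dist (act g x) (act g y) \<le> \<epsilon> / 2" if g: "g \<in> H" for g
      proof (rule less_imp_le, rule B(3))
        fix v n assume vn: "(v, n) \<in> B"
        hence v: "v \<in> vcarrier V" using B(2) by force
        have "h g v \<in> A" using vn g by (force simp: A_def)
        hence hv: "h g v \<in> W" using W(1) by blast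
        have bound: "\<bar>\<alpha> z (h g v) - d (h g v)\<bar> \<le> \<delta> / 2 * vnorm V v"
          if z: "dual_norm ?W (\<lambda>v. \<rho> z v - d v) < \<delta> / 2" for z
        proof -
          have "\<bar>\<rho> z (h g v) - d (h g v)\<bar> \<le> dual_norm ?W (\<lambda>v. \<rho> z v - d v) * vnorm ?W (h g v)"
            using D(1) d(1) hv \<rho>_dual by (intro W.dual_norm_bound) auto
          also have "\<dots> \<le> \<delta> / 2 * vnorm ?W (h g v)"
            using z W.norm_nonneg[of "h g v"] hv by (intro mult_right_mono) auto
          finally show ?thesis using hv v by (simp add: \<rho>_def h_norm)
        qed
        have "\<bar>\<alpha> (act g x) v - \<alpha> (act g y) v\<bar> = \<bar>\<alpha> x (h g v) - \<alpha> y (h g v)\<bar>"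
          using equiv v by simp
        also have "\<dots> \<le> \<delta> * vnorm V v" using bound[OF d(2)] bound[OF d(3)] by argo
        also have "\<dots> \<le> 1 / real (Suc n)" using vn by (rule \<delta>)
        finally show "\<bar>\<alpha> (act g x) v - \<alpha> (act g y) v\<bar> \<le> 1 / real (Suc n)" .
      qed
      have "dG act x y \<le> \<epsilon> / 2" using H(2) * by blast
      thus ?thesis using \<open>\<epsilon> > 0\<close> by linarith
    qed
    moreover have "countable \<C>" using D(2) by (simp add: \<C>_def)
    ultimately show "\<exists>\<C>. countable \<C> \<and> \<Union>\<C> = UNIV \<and> (\<forall>C\<in>\<C>. \<forall>x\<in>C. \<forall>y\<in>C. dG act x y < \<epsilon>)"
      by (intro exI[of _ \<C>]) simp
  qed
qed

end

section \<open>Linear functionals below sublinear ones\<close>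

text \<open>
The Hahn-Banach theorem is needed in the form that every sublinear functional dominates a linear
one. In this form the extension from a subspace is hidden in the choice of the sublinear
functional, and Zorn's lemma applies to total functions: a minimal sublinear functional is linear.
\<close>

definition sublinear :: "('a::real_vector \<Rightarrow> real) \<Rightarrow> bool" where
  "sublinear p \<longleftrightarrow> (\<forall>u v. p (u + v) \<le> p u + p v) \<and> (\<forall>c\<ge>0. \<forall>u. p (c *\<^sub>R u) = c * p u)"

lemma sublinear_add: "sublinear p \<Longrightarrow> p (u + v) \<le> p u + p v"
  and sublinear_scale: "sublinear p \<Longrightarrow> c \<ge> 0 \<Longrightarrow> p (c *\<^sub>R u) = c * p u"
  by (auto simp: sublinear_def)

lemma sublinear_0: "sublinear p \<Longrightarrow> p 0 = 0"
  using sublinear_scale[of p 0 0] by simp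

lemma sublinear_lower: "sublinear p \<Longrightarrow> - p (- u) \<le> p u"
  using sublinear_add[of p u "- u"] sublinear_0[of p] by simp

lemma sublinearI:
  assumes add: "\<And>u v. p (u + v) \<le> p u + p v"
    and scale: "\<And>c u. c > 0 \<Longrightarrow> p (c *\<^sub>R u) \<le> c * p u" and zero: "p 0 = 0"
  shows "sublinear p"
  unfolding sublinear_def
proof (intro conjI allI impI add)
  fix c :: real and u assume "c \<ge> 0"
  show "p (c *\<^sub>R u) = c * p u"
  proof (cases "c = 0")
    case False
    hence c: "c > 0" using \<open>c \<ge> 0\<close> by simp
    have "p ((1 / c) *\<^sub>R (c *\<^sub>R u)) \<le> (1 / c) * p (c *\<^sub>R u)" using c by (intro scale) simp
    hence "c * p u \<le> p (c *\<^sub>R u)" using c by (simp add: field_simps)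
    with scale[OF c] show ?thesis by (intro antisym)
  qed (simp add: zero)
qed

text \<open>
The bound \<open>- p (- u)\<close> keeps the infimum finite, and comparability of any two members of the chain
makes it subadditive.
\<close>

lemma sublinear_INF_chain:
  assumes sub: "\<And>q. q \<in> C \<Longrightarrow> sublinear q" and low: "\<And>q. q \<in> C \<Longrightarrow> q \<le> p" and ne: "C \<noteq> {}"
    and chain: "\<And>q r. q \<in> C \<Longrightarrow> r \<in> C \<Longrightarrow> q \<le> r \<or> r \<le> q"
  shows "sublinear (\<lambda>u. INF q\<in>C. q u)" "\<And>q u. q \<in> C \<Longrightarrow> (INF q\<in>C. q u) \<le> q u"
proof -
  have bdd: "bdd_below ((\<lambda>q. q u) ` C)" for u
  proof (rule bdd_belowI2)
    fix q assume q: "q \<in> C"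
    have "q (- u) \<le> p (- u)" using low[OF q] by (rule le_funD)
    thus "- p (- u) \<le> q u" using sublinear_lower[OF sub[OF q], of u] by linarith
  qed
  show lower: "(INF q\<in>C. q u) \<le> q u" if "q \<in> C" for q u
    using bdd that by (rule cINF_lower)
  show "sublinear (\<lambda>u. INF q\<in>C. q u)"
  proof (rule sublinearI)
    fix u v
    have *: "(INF q\<in>C. q (u + v)) \<le> q u + r v" if qr: "q \<in> C" "r \<in> C" for q r
    proof -
      have "\<exists>s\<in>C. s \<le> q \<and> s \<le> r"
        using chain[OF qr]
      proof
        assume "q \<le> r"
        with qr show ?thesis by (intro bexI[of _ q] conjI order_refl)
      next
        assume "r \<le> q"
        with qr show ?thesis by (intro bexI[of _ r] conjI order_refl)
      qed
      then obtain s where s: "s \<in> C" "s \<le> q" "s \<le> r" by (elim bexE conjE)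
      have "(INF q\<in>C. q (u + v)) \<le> s (u + v)" using s(1) by (rule lower)
      also have "\<dots> \<le> s u + s v" using sub[OF s(1)] by (rule sublinear_add)
      also have "\<dots> \<le> q u + r v" using le_funD[OF s(2), of u] le_funD[OF s(3), of v] by (rule add_mono)
      finally show ?thesis .
    qed
    have "(INF q\<in>C. q (u + v)) - (INF q\<in>C. q u) \<le> r v" if r: "r \<in> C" for r
    proof -
      have "(INF q\<in>C. q (u + v)) - r v \<le> (INF q\<in>C. q u)"
        using ne *[OF _ r] by (intro cINF_greatest) (simp_all add: diff_le_eq)
      thus ?thesis by linarith
    qed
    hence "(INF q\<in>C. q (u + v)) - (INF q\<in>C. q u) \<le> (INF r\<in>C. r v)"
      using ne by (intro cINF_greatest)
    thus "(INF q\<in>C. q (u + v)) \<le> (INF q\<in>C. q u) + (INF q\<in>C. q v)" by linarith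
  next
    fix c :: real and u assume c: "c > 0"
    have "(INF q\<in>C. q (c *\<^sub>R u)) / c \<le> q u" if q: "q \<in> C" for q
      using lower[OF q, of "c *\<^sub>R u"] sublinear_scale[OF sub[OF q], of c u] c by (simp add: field_simps)
    hence "(INF q\<in>C. q (c *\<^sub>R u)) / c \<le> (INF q\<in>C. q u)" using ne by (intro cINF_greatest)
    thus "(INF q\<in>C. q (c *\<^sub>R u)) \<le> c * (INF q\<in>C. q u)" using c by (simp add: field_simps)
  next
    have "(INF q\<in>C. q 0) = (INF q\<in>C. 0 :: real)"
      by (rule INF_cong) (simp_all add: sublinear_0[OF sub])
    thus "(INF q\<in>C. q 0) = 0" using ne by simp
  qed
qed

text \<open>
For fixed \<open>v\<close> the functional \<open>r w = inf {q (w + t v) - t q v | t \<ge> 0}\<close> is sublinear and below \<open>q\<close>, so it equals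
\<open>q\<close>. The term with \<open>t = 1\<close> then gives \<open>q u \<le> q (u + v) - q v\<close>, the inequality missing for additivity.
\<close>

lemma minimal_sublinear_imp_linear:
  assumes q: "sublinear q" and min: "\<And>r. sublinear r \<Longrightarrow> r \<le> q \<Longrightarrow> r = q"
  shows "linear q"
proof -
  have ge: "q u + q v \<le> q (u + v)" for u v
  proof -
    define r where "r w = (INF t\<in>{0..}. q (w + t *\<^sub>R v) - t * q v)" for w
    have scale_v: "q (t *\<^sub>R v) = t * q v" if "t \<ge> 0" for t using q that by (rule sublinear_scale)
    have below: "- q (- w) \<le> q (w + t *\<^sub>R v) - t * q v" if "t \<ge> 0" for w t
      using sublinear_add[OF q, of "w + t *\<^sub>R v" "- w"] scale_v[OF that] by simp
    hence bdd: "bdd_below ((\<lambda>t. q (w + t *\<^sub>R v) - t * q v) ` {0..})" for w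
      by (intro bdd_belowI2[of _ "- q (- w)"]) simp
    have lower: "r w \<le> q (w + t *\<^sub>R v) - t * q v" if "t \<ge> 0" for w t
      unfolding r_def using bdd that by (intro cINF_lower) simp_all
    have greatest: "a \<le> r w" if "\<And>t. t \<ge> 0 \<Longrightarrow> a \<le> q (w + t *\<^sub>R v) - t * q v" for a w
      unfolding r_def using that by (intro cINF_greatest) auto
    have "sublinear r"
    proof (rule sublinearI)
      fix w w'
      have *: "r (w + w') \<le> (q (w + s *\<^sub>R v) - s * q v) + (q (w' + t *\<^sub>R v) - t * q v)"
        if "s \<ge> 0" "t \<ge> 0" for s t
      proof -
        have "r (w + w') \<le> q (w + w' + (s + t) *\<^sub>R v) - (s + t) * q v"
          using that by (intro lower) simp
        also have "w + w' + (s + t) *\<^sub>R v = (w + s *\<^sub>R v) + (w' + t *\<^sub>R v)"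
          by (simp add: scaleR_add_left)
        also have "q \<dots> \<le> q (w + s *\<^sub>R v) + q (w' + t *\<^sub>R v)" using q by (rule sublinear_add)
        finally show ?thesis by (simp add: distrib_right)
      qed
      have "r (w + w') - r w \<le> q (w' + t *\<^sub>R v) - t * q v" if t: "t \<ge> 0" for t
      proof -
        have "r (w + w') - (q (w' + t *\<^sub>R v) - t * q v) \<le> r w"
          using *[OF _ t] by (intro greatest) (simp add: diff_le_eq)
        thus ?thesis by linarith
      qed
      hence "r (w + w') - r w \<le> r w'" by (rule greatest)
      thus "r (w + w') \<le> r w + r w'" by linarith
    next
      fix c :: real and w assume c: "c > 0"
      have "r (c *\<^sub>R w) / c \<le> q (w + t *\<^sub>R v) - t * q v" if t: "t \<ge> 0" for t
      proof -
        have "r (c *\<^sub>R w) \<le> q (c *\<^sub>R w + (c * t) *\<^sub>R v) - (c * t) * q v"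
          using c t by (intro lower) simp
        also have "c *\<^sub>R w + (c * t) *\<^sub>R v = c *\<^sub>R (w + t *\<^sub>R v)" by (simp add: scaleR_add_right)
        also have "q \<dots> = c * q (w + t *\<^sub>R v)" using q c by (intro sublinear_scale) simp_all
        finally show ?thesis using c by (simp add: field_simps)
      qed
      hence "r (c *\<^sub>R w) / c \<le> r w" by (rule greatest)
      thus "r (c *\<^sub>R w) \<le> c * r w" using c by (simp add: field_simps)
    next
      show "r 0 = 0"
      proof (rule antisym)
        show "r 0 \<le> 0" using lower[of 0 0] sublinear_0[OF q] by simp
        show "0 \<le> r 0" using below[of _ 0] sublinear_0[OF q] by (intro greatest) simp
      qed
    qed
    moreover have "r \<le> q" using lower[of 0] by (intro le_funI) simp
    ultimately have "r = q" by (rule min)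
    thus ?thesis using lower[of 1 u] by simp
  qed
  have add: "q (u + v) = q u + q v" for u v
    using ge[of u v] sublinear_add[OF q, of u v] by (rule antisym[rotated])
  show ?thesis
  proof (rule linearI)
    fix c :: real and u
    show "q (c *\<^sub>R u) = c *\<^sub>R q u"
    proof (cases "c \<ge> 0")
      case False
      have "q (c *\<^sub>R u) + q ((- c) *\<^sub>R u) = 0"
        using add[of "c *\<^sub>R u" "(- c) *\<^sub>R u"] sublinear_0[OF q] by simp
      moreover have "q ((- c) *\<^sub>R u) = (- c) * q u" using False by (intro sublinear_scale[OF q]) simp
      ultimately show ?thesis by simp
    qed (simp add: sublinear_scale[OF q])
  qed (rule add)
qed

lemma sublinear_dominates_linear:
  assumes p: "sublinear p"
  obtains f where "linear f" "\<And>u. f u \<le> p u"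
proof -
  define S where "S = {q. sublinear q \<and> q \<le> p}"
  have "partial_order_on S (relation_of (\<lambda>q r. r \<le> q) S)"
    by (rule partial_order_on_relation_ofI) auto
  moreover have "\<exists>u\<in>S. \<forall>a\<in>C. u \<le> a" if C: "C \<in> Chains (relation_of (\<lambda>q r. r \<le> q) S)" for C
  proof (cases "C = {}")
    case True
    thus ?thesis using p by (auto simp: S_def)
  next
    case False
    have CS: "q \<in> S" if "q \<in> C" for q using C that by (auto simp: Chains_def relation_of_def)
    have chain: "q \<le> r \<or> r \<le> q" if "q \<in> C" "r \<in> C" for q r
      using C that by (auto simp: Chains_def relation_of_def)
    have sub: "sublinear q" and low: "q \<le> p" if "q \<in> C" for q using CS[OF that] by (simp_all add: S_def)
    note inf = sublinear_INF_chain[OF sub low False chain]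
    obtain q where "q \<in> C" using False by blast
    hence "(\<lambda>u. INF q\<in>C. q u) \<le> p"
      using inf(2) low by (intro le_funI) (meson le_funD order_trans)
    hence "(\<lambda>u. INF q\<in>C. q u) \<in> S" using inf(1) by (simp add: S_def)
    moreover have "\<forall>a\<in>C. (\<lambda>u. INF q\<in>C. q u) \<le> a"
      using inf(2) by (intro ballI le_funI)
    ultimately show ?thesis by blast
  qed
  ultimately obtain q where q: "q \<in> S" "\<forall>a\<in>S. a \<le> q \<longrightarrow> a = q"
    using predicate_Zorn[of S "\<lambda>q r. r \<le> q"] by blast
  have "linear q"
  proof (rule minimal_sublinear_imp_linear)
    show "sublinear q" using q(1) by (simp add: S_def)
    show "r = q" if "sublinear r" "r \<le> q" for r
      using that q order_trans[of r q p] by (simp add: S_def)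
  qed
  moreover have "q u \<le> p u" for u using q(1) by (simp add: S_def le_funD)
  ultimately show thesis by (rule that)
qed

section \<open>Discretisation of bounded functionals on continuous functions\<close>

definition evaluation :: "(real \<times> 'x) list \<Rightarrow> ('x \<Rightarrow> real) \<Rightarrow> real" where
  "evaluation l f = (\<Sum>(q, d)\<leftarrow>l. q * f d)"

lemma evaluation_add: "evaluation l (\<lambda>x. f x + g x) = evaluation l f + evaluation l g"
  by (induction l) (auto simp: evaluation_def distrib_left)

lemma evaluation_scale: "evaluation l (\<lambda>x. c * f x) = c * evaluation l f"
  by (induction l) (auto simp: evaluation_def distrib_left)

lemma evaluation_bound:
  assumes "\<And>x. \<bar>f x\<bar> \<le> M"
  shows "\<bar>evaluation l f\<bar> \<le> (\<Sum>(q, d)\<leftarrow>l. \<bar>q\<bar>) * M"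
proof (induction l)
  case (Cons p l)
  obtain q d where p: "p = (q, d)" by (cases p)
  have "\<bar>q * f d\<bar> \<le> \<bar>q\<bar> * M" using assms by (simp add: abs_mult mult_left_mono)
  with Cons show ?case by (simp add: evaluation_def p distrib_right)
qed (simp add: evaluation_def)

text \<open>
A functional on \<open>C(X)\<close> is represented by a function on all real functions, of which only the values at
continuous functions matter. This allows multiplication by continuous functions without passing
through a type of continuous functions.
\<close>

locale bounded_functional =
  fixes L :: "('x::metric_space \<Rightarrow> real) \<Rightarrow> real" and C :: real
  assumes compact_space: "compact (UNIV :: 'x set)"
    and L_add: "continuous_on UNIV f \<Longrightarrow> continuous_on UNIV g \<Longrightarrow> L (\<lambda>x. f x + g x) = L f + L g"
    and L_scale: "continuous_on UNIV f \<Longrightarrow> L (\<lambda>x. c * f x) = c * L f"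
    and L_bound: "continuous_on UNIV f \<Longrightarrow> (\<And>x. \<bar>f x\<bar> \<le> M) \<Longrightarrow> \<bar>L f\<bar> \<le> C * M"
begin

text \<open>
The integral of \<open>\<phi> \<ge> 0\<close> with respect to the total variation of the measure that represents \<open>L\<close>.
Superadditivity in \<open>\<phi>\<close> is immediate from the definition as a supremum.
\<close>

definition variation :: "('x \<Rightarrow> real) \<Rightarrow> real" where
  "variation \<phi> = (SUP h\<in>{h. continuous_on UNIV h \<and> (\<forall>x. \<bar>h x\<bar> \<le> \<phi> x)}. L h)"

lemma L_zero: "L (\<lambda>x. 0) = 0"
  using L_scale[of "\<lambda>x. 0" 0] by simp

lemma L_diff: "continuous_on UNIV f \<Longrightarrow> continuous_on UNIV g \<Longrightarrow> L (\<lambda>x. f x - g x) = L f - L g"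
  using L_add[of f "\<lambda>x. (-1) * g x"] L_scale[of g "-1"] by (simp add: continuous_on_minus)

lemma bounded_above: "continuous_on UNIV (\<phi> :: 'x \<Rightarrow> real) \<Longrightarrow> \<exists>M. \<forall>x. \<phi> x \<le> M"
  using compact_continuous_image[OF _ compact_space, of \<phi>] compact_imp_bounded[of "range \<phi>"]
  by (auto simp: bounded_iff intro: order_trans[OF abs_ge_self])

lemma bdd_variation:
  assumes "continuous_on UNIV \<phi>"
  shows "bdd_above (L ` {h. continuous_on UNIV h \<and> (\<forall>x. \<bar>h x\<bar> \<le> \<phi> x)})"
proof -
  obtain M where M: "\<And>x. \<phi> x \<le> M" using bounded_above[OF assms] by blast
  have "L h \<le> C * M" if "continuous_on UNIV h" "\<forall>x. \<bar>h x\<bar> \<le> \<phi> x" for h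
    using L_bound[of h M] that order_trans[OF _ M] by (meson abs_ge_self order_trans)
  thus ?thesis by (intro bdd_aboveI2) auto
qed

lemma L_le_variation:
  assumes "continuous_on UNIV \<phi>" "continuous_on UNIV h" "\<And>x. \<bar>h x\<bar> \<le> \<phi> x"
  shows "L h \<le> variation \<phi>"
  unfolding variation_def using bdd_variation[OF assms(1)] assms by (intro cSUP_upper) auto

lemma abs_L_le_variation:
  assumes \<phi>: "continuous_on UNIV \<phi>" and h: "continuous_on UNIV h" "\<And>x. \<bar>h x\<bar> \<le> c * \<phi> x" and "c > 0"
  shows "\<bar>L h\<bar> \<le> c * variation \<phi>"
proof -
  have bound: "\<bar>(s / c) * h x\<bar> \<le> \<phi> x" if "\<bar>s\<bar> = 1" for s x
    using h(2)[of x] \<open>c > 0\<close> that by (simp add: abs_mult field_simps)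
  have "L (\<lambda>x. (s / c) * h x) \<le> variation \<phi>" if "\<bar>s\<bar> = 1" for s
    using \<phi> h(1) bound[OF that] by (intro L_le_variation continuous_intros)
  hence "(s / c) * L h \<le> variation \<phi>" if "\<bar>s\<bar> = 1" for s
    using that by (simp only: L_scale[OF h(1)])
  from this[of 1] this[of "-1"] show ?thesis using \<open>c > 0\<close> by (auto simp: field_simps abs_le_iff)
qed

lemma variation_nonneg:
  assumes "continuous_on UNIV \<phi>" "\<And>x. 0 \<le> \<phi> x"
  shows "0 \<le> variation \<phi>"
  using L_le_variation[of \<phi> "\<lambda>x. 0"] assms L_zero by simp

lemma variation_le:
  assumes "\<And>x. 0 \<le> \<phi> x" "\<And>x. \<phi> x \<le> M"
  shows "variation \<phi> \<le> C * M"
  unfolding variation_def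
proof (rule cSUP_least)
  show "{h. continuous_on UNIV h \<and> (\<forall>x. \<bar>h x\<bar> \<le> \<phi> x)} \<noteq> {}"
    using assms(1) by (auto intro!: exI[of _ "\<lambda>x. 0"])
  fix h assume "h \<in> {h. continuous_on UNIV h \<and> (\<forall>x. \<bar>h x\<bar> \<le> \<phi> x)}"
  hence h: "continuous_on UNIV h" "\<bar>h x\<bar> \<le> \<phi> x" for x by simp_all
  have "\<bar>L h\<bar> \<le> C * M" using h(1) order_trans[OF h(2) assms(2)] by (rule L_bound)
  thus "L h \<le> C * M" by simp
qed

lemma variation_superadditive:
  assumes cont: "continuous_on UNIV \<phi>" "continuous_on UNIV \<psi>" and nonneg: "\<And>x. 0 \<le> \<phi> x" "\<And>x. 0 \<le> \<psi> x"
  shows "variation \<phi> + variation \<psi> \<le> variation (\<lambda>x. \<phi> x + \<psi> x)"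
proof -
  have ne: "{h. continuous_on UNIV h \<and> (\<forall>x. \<bar>h x\<bar> \<le> \<theta> x)} \<noteq> {}" if "\<And>x. 0 \<le> \<theta> x" for \<theta> :: "'x \<Rightarrow> real"
    using that by (auto intro!: exI[of _ "\<lambda>x. 0"])
  have sum: "L h + L k \<le> variation (\<lambda>x. \<phi> x + \<psi> x)"
    if "continuous_on UNIV h" "\<forall>x. \<bar>h x\<bar> \<le> \<phi> x" "continuous_on UNIV k" "\<forall>x. \<bar>k x\<bar> \<le> \<psi> x" for h k
  proof -
    have "\<bar>h x + k x\<bar> \<le> \<phi> x + \<psi> x" for x
      using that(2,4) by (meson abs_triangle_ineq add_mono order_trans)
    hence "L (\<lambda>x. h x + k x) \<le> variation (\<lambda>x. \<phi> x + \<psi> x)"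
      using cont that by (intro L_le_variation continuous_intros)
    thus ?thesis using that by (simp add: L_add)
  qed
  have "variation \<phi> \<le> variation (\<lambda>x. \<phi> x + \<psi> x) - L k"
    if k: "continuous_on UNIV k" "\<forall>x. \<bar>k x\<bar> \<le> \<psi> x" for k
    unfolding variation_def[of \<phi>]
  proof (rule cSUP_least[OF ne[OF nonneg(1)]])
    fix h assume "h \<in> {h. continuous_on UNIV h \<and> (\<forall>x. \<bar>h x\<bar> \<le> \<phi> x)}"
    thus "L h \<le> variation (\<lambda>x. \<phi> x + \<psi> x) - L k" using sum[OF _ _ k, of h] by simp
  qed
  hence "variation \<psi> \<le> variation (\<lambda>x. \<phi> x + \<psi> x) - variation \<phi>"
    unfolding variation_def[of \<psi>] by (intro cSUP_least[OF ne[OF nonneg(2)]]) force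
  thus ?thesis by simp
qed

lemma variation_split:
  assumes cont: "continuous_on UNIV \<phi>" "continuous_on UNIV \<psi>"
    and le: "\<And>x. 0 \<le> \<psi> x" "\<And>x. \<psi> x \<le> \<phi> x"
  shows "variation \<psi> + variation (\<lambda>x. \<phi> x - \<psi> x) \<le> variation \<phi>"
  using variation_superadditive[of \<psi> "\<lambda>x. \<phi> x - \<psi> x"] assms by (simp add: continuous_on_diff)

text \<open>
Let \<open>\<psi> n\<close> decrease to the indicator of \<open>K\<close>. The variations of \<open>\<phi> * \<psi> n\<close> decrease, so from some \<open>n\<close> on they
lose at most \<open>\<delta>\<close> in total. For this one \<open>n\<close> and every test function \<open>f\<close>, the cutoff \<open>\<psi> n\<close> may be replaced by
\<open>\<psi> m\<close> with \<open>m\<close> so large, depending on \<open>f\<close>, that \<open>f\<close> is almost constant on the support of \<open>\<psi> m\<close>. The choice of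
\<open>\<psi>\<close> is thus independent of \<open>f\<close>, and this is what countable additivity of the measure amounts to here.
\<close>

lemma localise_at_closed_set:
  assumes K: "closed K" and \<phi>: "continuous_on UNIV \<phi>" "\<And>x. 0 \<le> \<phi> x" and "\<delta> > 0"
  obtains \<psi> U where "continuous_on UNIV \<psi>" "\<And>x. 0 \<le> \<psi> x" "\<And>x. \<psi> x \<le> 1"
    "open U" "K \<subseteq> U" "\<And>x. x \<in> U \<Longrightarrow> \<psi> x = 1"
    "\<And>f y \<epsilon>. continuous_on UNIV f \<Longrightarrow> (\<And>x. \<bar>f x\<bar> \<le> 1) \<Longrightarrow> \<epsilon> > 0 \<Longrightarrow>
      (\<And>x. x \<in> K \<Longrightarrow> \<bar>f x - f y\<bar> \<le> \<epsilon>) \<Longrightarrow>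
      \<bar>L (\<lambda>x. \<phi> x * \<psi> x * f x) - L (\<lambda>x. \<phi> x * \<psi> x) * f y\<bar>
        \<le> 2 * \<epsilon> * variation (\<lambda>x. \<phi> x * \<psi> x) + 2 * \<delta>"
proof (cases "K = {}")
  case True
  show thesis
  proof (rule that[of "\<lambda>x. 0" "{}"])
    fix f :: "'x \<Rightarrow> real" and y \<epsilon> assume "(\<epsilon>::real) > 0"
    show "\<bar>L (\<lambda>x. \<phi> x * 0 * f x) - L (\<lambda>x. \<phi> x * 0) * f y\<bar>
        \<le> 2 * \<epsilon> * variation (\<lambda>x. \<phi> x * 0) + 2 * \<delta>"
      using \<open>\<epsilon> > 0\<close> \<open>\<delta> > 0\<close> variation_nonneg[of "\<lambda>x. 0"] by (simp add: L_zero)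
  qed (use True in auto)
next
  case False
  define \<psi> where "\<psi> n x = max 0 (min 1 (2 - real (Suc n) * infdist x K))" for n x
  have \<psi>_cont: "continuous_on UNIV (\<psi> n)" for n
    unfolding \<psi>_def by (intro continuous_intros)
  have \<psi>_ge: "0 \<le> \<psi> n x" and \<psi>_le: "\<psi> n x \<le> 1" for n x by (simp_all add: \<psi>_def)
  have \<psi>_mono: "\<psi> m x \<le> \<psi> n x" if "n \<le> m" for n m x
  proof -
    have "real (Suc n) * infdist x K \<le> real (Suc m) * infdist x K"
      using that by (intro mult_right_mono) (simp_all add: infdist_nonneg)
    thus ?thesis unfolding \<psi>_def by linarith
  qed
  define \<theta> where "\<theta> n x = \<phi> x * \<psi> n x" for n x
  have \<theta>_eq: "\<theta> n = (\<lambda>x. \<phi> x * \<psi> n x)" for n by (simp add: \<theta>_def fun_eq_iff)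
  have \<theta>_cont: "continuous_on UNIV (\<theta> n)" for n
    unfolding \<theta>_def by (intro continuous_intros \<phi>(1) \<psi>_cont)
  have \<theta>_ge: "0 \<le> \<theta> n x" for n x by (simp add: \<theta>_def \<phi>(2) \<psi>_ge)
  have \<theta>_mono: "\<theta> m x \<le> \<theta> n x" if "n \<le> m" for n m x
    unfolding \<theta>_def using \<psi>_mono[OF that] \<phi>(2) by (rule mult_left_mono)
  define a where "a n = variation (\<theta> n)" for n
  have a_ge: "0 \<le> a n" for n unfolding a_def using \<theta>_cont \<theta>_ge by (rule variation_nonneg)
  have a_bdd: "bdd_below (range a)" using a_ge by (rule bdd_belowI2)
  \<comment> \<open>Beyond this index the variation that is still to be lost is at most \<open>\<delta>\<close>.\<close>
  obtain n where n: "a n < Inf (range a) + \<delta>"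
    using cInf_lessD[of "range a" "Inf (range a) + \<delta>"] \<open>\<delta> > 0\<close> by auto
  have tail: "variation (\<lambda>x. \<theta> n x - \<theta> m x) \<le> \<delta>" and a_mono: "a m \<le> a n" if nm: "n \<le> m" for m
  proof -
    have "a m + variation (\<lambda>x. \<theta> n x - \<theta> m x) \<le> a n"
      unfolding a_def using \<theta>_cont \<theta>_cont \<theta>_ge \<theta>_mono[OF nm] by (rule variation_split)
    moreover have "Inf (range a) \<le> a m" using a_bdd by (intro cInf_lower) simp_all
    moreover have "0 \<le> variation (\<lambda>x. \<theta> n x - \<theta> m x)"
      using \<theta>_mono[OF nm] by (intro variation_nonneg continuous_intros \<theta>_cont) simp
    ultimately show "variation (\<lambda>x. \<theta> n x - \<theta> m x) \<le> \<delta>" "a m \<le> a n" using n by linarith+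
  qed
  show thesis
  proof (rule that[of "\<psi> n" "{x. infdist x K < 1 / real (Suc n)}"])
    show "open {x. infdist x K < 1 / real (Suc n)}"
      by (intro open_Collect_less continuous_intros)
    show "K \<subseteq> {x. infdist x K < 1 / real (Suc n)}" by auto
    show "\<psi> n x = 1" if "x \<in> {x. infdist x K < 1 / real (Suc n)}" for x
    proof -
      have "real (Suc n) * infdist x K < 1" using that by (simp add: field_simps)
      thus ?thesis by (simp add: \<psi>_def)
    qed
  next
    fix f :: "'x \<Rightarrow> real" and y \<epsilon>
    assume f: "continuous_on UNIV f" "\<And>x. \<bar>f x\<bar> \<le> 1" and \<epsilon>: "\<epsilon> > 0" and fK: "\<And>x. x \<in> K \<Longrightarrow> \<bar>f x - f y\<bar> \<le> \<epsilon>"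
    have "uniformly_continuous_on UNIV f" using f(1) compact_space by (rule compact_uniformly_continuous)
    hence "\<exists>t>0. \<forall>z\<in>UNIV. \<forall>x\<in>UNIV. dist x z < t \<longrightarrow> dist (f x) (f z) < \<epsilon>"
      using \<epsilon> by (simp add: uniformly_continuous_on_def)
    then obtain t where t: "t > 0" "\<forall>z\<in>UNIV. \<forall>x\<in>UNIV. dist x z < t \<longrightarrow> dist (f x) (f z) < \<epsilon>"
      by blast
    have "t / 2 > 0" using t(1) by simp
    then obtain m0 where m0: "1 / real (Suc m0) < t / 2" by (rule nat_approx_posE)
    define m where "m = max n m0"
    have m: "n \<le> m" "2 / real (Suc m) < t"
    proof -
      have "1 / real (Suc m) \<le> 1 / real (Suc m0)" by (intro divide_left_mono) (simp_all add: m_def)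
      thus "2 / real (Suc m) < t" using m0 by simp
    qed (simp add: m_def)
    have near: "\<bar>f x - f y\<bar> \<le> 2 * \<epsilon>" if x: "\<theta> m x \<noteq> 0" for x
    proof -
      have "\<psi> m x \<noteq> 0" using x by (auto simp: \<theta>_def)
      hence "real (Suc m) * infdist x K < 2" unfolding \<psi>_def by linarith
      hence "infdist x K < 2 / real (Suc m)" by (simp add: field_simps)
      hence "(INF k\<in>K. dist x k) < t" using m(2) False by (simp add: infdist_notempty)
      then obtain k where k: "k \<in> K" "dist x k < t"
        using False by (subst (asm) cINF_less_iff) (auto intro!: bdd_belowI2[of _ 0])
      show ?thesis using t(2)[rule_format, OF UNIV_I UNIV_I k(2)] fK[OF k(1)] unfolding dist_real_def by linarith
    qed
    define u where "u x = f x - f y" for x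
    have u_cont: "continuous_on UNIV u" unfolding u_def by (intro continuous_intros f(1))
    have "\<bar>\<theta> m x * u x\<bar> \<le> (2 * \<epsilon>) * \<theta> m x" for x
    proof (cases "\<theta> m x = 0")
      case False
      hence "\<theta> m x * \<bar>u x\<bar> \<le> \<theta> m x * (2 * \<epsilon>)" using near \<theta>_ge unfolding u_def by (intro mult_left_mono)
      thus ?thesis by (simp add: abs_mult \<theta>_ge mult.commute)
    qed simp
    hence "\<bar>L (\<lambda>x. \<theta> m x * u x)\<bar> \<le> (2 * \<epsilon>) * variation (\<theta> m)"
      using \<epsilon> \<theta>_cont u_cont by (intro abs_L_le_variation continuous_intros) simp_all
    also have "\<dots> \<le> (2 * \<epsilon>) * variation (\<theta> n)"
      using \<epsilon> a_mono[OF m(1)] by (simp add: a_def)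
    finally have 1: "\<bar>L (\<lambda>x. \<theta> m x * u x)\<bar> \<le> 2 * \<epsilon> * variation (\<theta> n)" .
    \<comment> \<open>The difference of the cutoffs has variation at most \<open>\<delta>\<close>, so a crude bound for \<open>u\<close> suffices.\<close>
    have "\<bar>u x\<bar> \<le> 2" for x using f(2)[of x] f(2)[of y] unfolding u_def by linarith
    hence "\<bar>(\<theta> n x - \<theta> m x) * u x\<bar> \<le> 2 * (\<theta> n x - \<theta> m x)" for x
      using \<theta>_mono[OF m(1), of x] mult_left_mono[of "\<bar>u x\<bar>" 2 "\<theta> n x - \<theta> m x"] by (simp add: abs_mult)
    hence "\<bar>L (\<lambda>x. (\<theta> n x - \<theta> m x) * u x)\<bar> \<le> 2 * variation (\<lambda>x. \<theta> n x - \<theta> m x)"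
      using \<theta>_cont u_cont by (intro abs_L_le_variation continuous_intros) simp_all
    also have "\<dots> \<le> 2 * \<delta>" using tail[OF m(1)] by simp
    finally have 2: "\<bar>L (\<lambda>x. (\<theta> n x - \<theta> m x) * u x)\<bar> \<le> 2 * \<delta>" .
    have "L (\<lambda>x. \<theta> n x * u x) = L (\<lambda>x. \<theta> m x * u x + (\<theta> n x - \<theta> m x) * u x)"
      by (simp add: algebra_simps)
    also have "\<dots> = L (\<lambda>x. \<theta> m x * u x) + L (\<lambda>x. (\<theta> n x - \<theta> m x) * u x)"
      by (intro L_add continuous_intros \<theta>_cont u_cont)
    finally have 3: "\<bar>L (\<lambda>x. \<theta> n x * u x)\<bar> \<le> 2 * \<epsilon> * variation (\<theta> n) + 2 * \<delta>" using 1 2 by linarith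
    have "L (\<lambda>x. \<theta> n x * u x) = L (\<lambda>x. \<theta> n x * f x - f y * \<theta> n x)"
      by (simp add: u_def algebra_simps)
    also have "\<dots> = L (\<lambda>x. \<theta> n x * f x) - f y * L (\<theta> n)"
      by (subst L_diff) (auto intro!: continuous_intros \<theta>_cont f(1) simp: L_scale[OF \<theta>_cont])
    finally have "L (\<lambda>x. \<theta> n x * f x) - L (\<theta> n) * f y = L (\<lambda>x. \<theta> n x * u x)" by simp
    with 3 show "\<bar>L (\<lambda>x. \<phi> x * \<psi> n x * f x) - L (\<lambda>x. \<phi> x * \<psi> n x) * f y\<bar>
        \<le> 2 * \<epsilon> * variation (\<lambda>x. \<phi> x * \<psi> n x) + 2 * \<delta>"
      by (simp add: \<theta>_eq)
  qed (use \<psi>_cont \<psi>_ge \<psi>_le in auto)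
qed

text \<open>
The sets \<open>K d\<close> are split off one after the other: \<open>\<Phi> (i + 1) = \<Phi> i * (1 - \<psi> i)\<close>, where \<open>\<psi> i\<close> localises \<open>\<Phi> i\<close> at the
\<open>i\<close>-th set and the piece \<open>\<Phi> i * \<psi> i\<close> is replaced by a multiple of a point evaluation. As \<open>\<psi> i = 1\<close> on a
neighbourhood of the \<open>i\<close>-th set, finitely many of these neighbourhoods cover \<open>X\<close>, and after
finitely many steps nothing remains. By superadditivity the variations of the pieces add up to at most
that of the constant \<open>1\<close>.
\<close>

lemma discretise:
  assumes D: "countable D" and K: "\<And>d. d \<in> D \<Longrightarrow> closed (K d)" "(\<Union>d\<in>D. K d) = UNIV"
    and "\<epsilon> > 0" "\<delta> > 0"
  obtains l where "l \<in> lists (\<rat> \<times> D)"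
    "\<forall>f. continuous_on UNIV f \<and> (\<forall>x. \<bar>f x\<bar> \<le> 1) \<and> (\<forall>d\<in>D. \<forall>x\<in>K d. \<bar>f x - f d\<bar> \<le> \<epsilon>) \<longrightarrow>
      \<bar>L f - evaluation l f\<bar> \<le> 2 * \<epsilon> * C + \<delta>"
proof -
  define H where "H = {f. continuous_on UNIV f \<and> (\<forall>x. \<bar>f x\<bar> \<le> 1) \<and> (\<forall>d\<in>D. \<forall>x\<in>K d. \<bar>f x - f d\<bar> \<le> \<epsilon>)}"
  have "D \<noteq> {}" using K(2) by auto
  define d where "d = from_nat_into D"
  have d: "d i \<in> D" for i unfolding d_def using \<open>D \<noteq> {}\<close> by (rule from_nat_into)
  have range_d: "range d = D" unfolding d_def using \<open>D \<noteq> {}\<close> D by (rule range_from_nat_into)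
  define unit where "unit \<phi> \<longleftrightarrow> continuous_on UNIV \<phi> \<and> (\<forall>x. 0 \<le> \<phi> x) \<and> (\<forall>x. \<phi> x \<le> 1)" for \<phi> :: "'x \<Rightarrow> real"
  \<comment> \<open>Step \<open>i\<close> costs \<open>3 * \<delta>' i\<close>: twice \<open>\<delta>' i\<close> for localising and once for rounding the coefficient.
      Hence the total is below \<open>\<delta>\<close>.\<close>
  define \<delta>' where "\<delta>' i = \<delta> / 2 ^ (i + 3)" for i :: nat
  have \<delta>': "\<delta>' i > 0" for i using \<open>\<delta> > 0\<close> by (simp add: \<delta>'_def)
  define good where "good i \<phi> \<psi> U \<longleftrightarrow> unit \<psi> \<and> open U \<and> K (d i) \<subseteq> U \<and> (\<forall>x\<in>U. \<psi> x = 1) \<and>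
      (\<forall>f\<in>H. \<bar>L (\<lambda>x. \<phi> x * \<psi> x * f x) - L (\<lambda>x. \<phi> x * \<psi> x) * f (d i)\<bar>
        \<le> 2 * \<epsilon> * variation (\<lambda>x. \<phi> x * \<psi> x) + 2 * \<delta>' i)" for i \<phi> \<psi> U
  have good_ex: "\<exists>\<psi> U. good i \<phi> \<psi> U" if \<phi>: "unit \<phi>" for i \<phi>
  proof -
    have \<phi>': "continuous_on UNIV \<phi>" "\<And>x. 0 \<le> \<phi> x" using \<phi> by (simp_all add: unit_def)
    show ?thesis
    proof (rule localise_at_closed_set[OF K(1)[OF d] \<phi>' \<delta>'])
      fix \<psi> U assume *: "continuous_on UNIV \<psi>" "\<And>x. 0 \<le> \<psi> x" "\<And>x. \<psi> x \<le> 1"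
        "open U" "K (d i) \<subseteq> U" "\<And>x. x \<in> U \<Longrightarrow> \<psi> x = 1"
        "\<And>f y \<epsilon>. continuous_on UNIV f \<Longrightarrow> (\<And>x. \<bar>f x\<bar> \<le> 1) \<Longrightarrow> \<epsilon> > 0 \<Longrightarrow>
          (\<And>x. x \<in> K (d i) \<Longrightarrow> \<bar>f x - f y\<bar> \<le> \<epsilon>) \<Longrightarrow>
          \<bar>L (\<lambda>x. \<phi> x * \<psi> x * f x) - L (\<lambda>x. \<phi> x * \<psi> x) * f y\<bar>
            \<le> 2 * \<epsilon> * variation (\<lambda>x. \<phi> x * \<psi> x) + 2 * \<delta>' i"
      have "\<bar>L (\<lambda>x. \<phi> x * \<psi> x * f x) - L (\<lambda>x. \<phi> x * \<psi> x) * f (d i)\<bar>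
          \<le> 2 * \<epsilon> * variation (\<lambda>x. \<phi> x * \<psi> x) + 2 * \<delta>' i" if f: "f \<in> H" for f
        using f d \<open>\<epsilon> > 0\<close> by (intro *(7)) (simp_all add: H_def)
      moreover have "unit \<psi>" using *(1-3) by (simp add: unit_def)
      ultimately show ?thesis using *(4-6) unfolding good_def by blast
    qed
  qed
  define R where "R i \<phi> = (SOME p. good i \<phi> (fst p) (snd p))" for i \<phi>
  define \<Psi> U where "\<Psi> i \<phi> = fst (R i \<phi>)" and "U i \<phi> = snd (R i \<phi>)" for i \<phi>
  have good: "good i \<phi> (\<Psi> i \<phi>) (U i \<phi>)" if "unit \<phi>" for i \<phi>
    unfolding \<Psi>_def U_def R_def by (rule someI_ex) (use good_ex[OF that] in auto)
  note \<Psi> = good[unfolded good_def]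
  define \<Phi> where "\<Phi> = rec_nat (\<lambda>x. 1) (\<lambda>i \<phi> x. \<phi> x * (1 - \<Psi> i \<phi> x))"
  have \<Phi>_0: "\<Phi> 0 = (\<lambda>x. 1)" and \<Phi>_Suc: "\<Phi> (Suc i) = (\<lambda>x. \<Phi> i x * (1 - \<Psi> i (\<Phi> i) x))" for i
    by (simp_all add: \<Phi>_def)
  have unit_\<Phi>: "unit (\<Phi> i)" for i
  proof (induction i)
    case (Suc i)
    from \<Psi>[OF Suc, of i] have "unit (\<Psi> i (\<Phi> i))" by blast
    with Suc show ?case
      unfolding \<Phi>_Suc unit_def by (auto intro!: continuous_intros mult_nonneg_nonneg mult_le_one)
  qed (simp add: \<Phi>_0 unit_def)
  define \<psi> V where "\<psi> i = \<Psi> i (\<Phi> i)" and "V i = U i (\<Phi> i)" for i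
  have "good i (\<Phi> i) (\<psi> i) (V i)" for i unfolding \<psi>_def V_def using unit_\<Phi> by (rule good)
  note \<psi> = this[unfolded good_def]
  have unit_\<psi>: "unit (\<psi> i)" for i using \<psi> by blast
  have step: "\<exists>l\<in>lists (\<rat> \<times> D). \<forall>f\<in>H. \<bar>L f - L (\<lambda>x. \<Phi> n x * f x) - evaluation l f\<bar>
      \<le> 2 * \<epsilon> * (variation (\<lambda>x. 1) - variation (\<Phi> n)) + \<delta> * (1 - 1 / 2 ^ n)" for n
  proof (induction n)
    case 0
    show ?case by (intro bexI[of _ "[]"]) (simp_all add: \<Phi>_0 evaluation_def)
  next
    case (Suc n)
    then obtain l where l: "l \<in> lists (\<rat> \<times> D)" "\<And>f. f \<in> H \<Longrightarrow> \<bar>L f - L (\<lambda>x. \<Phi> n x * f x) - evaluation l f\<bar>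
      \<le> 2 * \<epsilon> * (variation (\<lambda>x. 1) - variation (\<Phi> n)) + \<delta> * (1 - 1 / 2 ^ n)" by blast
    define c where "c = L (\<lambda>x. \<Phi> n x * \<psi> n x)"
    obtain q where q: "q \<in> \<rat>" "c < q" "q < c + \<delta>' n"
      using Rats_dense_in_real[of c "c + \<delta>' n"] \<delta>'[of n] by auto
    have "\<bar>L f - L (\<lambda>x. \<Phi> (Suc n) x * f x) - evaluation ((q, d n) # l) f\<bar>
      \<le> 2 * \<epsilon> * (variation (\<lambda>x. 1) - variation (\<Phi> (Suc n))) + \<delta> * (1 - 1 / 2 ^ Suc n)" if f: "f \<in> H" for f
    proof -
      have f': "continuous_on UNIV f" "\<bar>f (d n)\<bar> \<le> 1" using f by (simp_all add: H_def)
      have c1: "continuous_on UNIV (\<Phi> n)" "continuous_on UNIV (\<psi> n)"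
        using unit_\<Phi>[of n] unit_\<psi>[of n] by (simp_all add: unit_def)
      have "L (\<lambda>x. \<Phi> n x * f x) = L (\<lambda>x. \<Phi> (Suc n) x * f x + \<Phi> n x * \<psi> n x * f x)"
        by (simp add: \<Phi>_Suc \<psi>_def algebra_simps)
      also have "\<dots> = L (\<lambda>x. \<Phi> (Suc n) x * f x) + L (\<lambda>x. \<Phi> n x * \<psi> n x * f x)"
        using unit_\<Phi>[of "Suc n"] c1 f'(1) by (intro L_add continuous_intros) (simp_all add: unit_def)
      finally have 1: "L (\<lambda>x. \<Phi> n x * f x) = L (\<lambda>x. \<Phi> (Suc n) x * f x) + L (\<lambda>x. \<Phi> n x * \<psi> n x * f x)" .
      have 2: "\<bar>L (\<lambda>x. \<Phi> n x * \<psi> n x * f x) - c * f (d n)\<bar>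
          \<le> 2 * \<epsilon> * variation (\<lambda>x. \<Phi> n x * \<psi> n x) + 2 * \<delta>' n"
        using \<psi>[of n] f unfolding c_def by blast
      have "\<bar>c - q\<bar> * \<bar>f (d n)\<bar> \<le> \<delta>' n * 1" using q f'(2) by (intro mult_mono) simp_all
      hence 3: "\<bar>c * f (d n) - q * f (d n)\<bar> \<le> \<delta>' n" by (simp add: abs_mult flip: left_diff_distrib)
      have "variation (\<lambda>x. \<Phi> n x * \<psi> n x) + variation (\<lambda>x. \<Phi> n x - \<Phi> n x * \<psi> n x) \<le> variation (\<Phi> n)"
        using c1 unit_\<Phi>[of n] unit_\<psi>[of n]
        by (intro variation_split continuous_intros) (simp_all add: unit_def mult_left_le)
      moreover have "(\<lambda>x. \<Phi> n x - \<Phi> n x * \<psi> n x) = \<Phi> (Suc n)"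
        by (simp add: \<Phi>_Suc \<psi>_def algebra_simps)
      ultimately have "(2 * \<epsilon>) * (variation (\<lambda>x. \<Phi> n x * \<psi> n x) + variation (\<Phi> (Suc n))) \<le> (2 * \<epsilon>) * variation (\<Phi> n)"
        using \<open>\<epsilon> > 0\<close> by (intro mult_left_mono) simp_all
      hence 4: "2 * \<epsilon> * variation (\<lambda>x. \<Phi> n x * \<psi> n x) + 2 * \<epsilon> * variation (\<Phi> (Suc n)) \<le> 2 * \<epsilon> * variation (\<Phi> n)"
        by (simp add: distrib_left)
      have 5: "3 * \<delta>' n \<le> \<delta> * (1 / 2 ^ n - 1 / 2 ^ Suc n)"
        using \<open>\<delta> > 0\<close> by (simp add: \<delta>'_def field_simps power_add)
      show ?thesis
        using l(2)[OF f] 1 2 3 4 5 by (simp only: evaluation_def list.map sum_list.Cons prod.case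
            right_diff_distrib)
    qed
    moreover have "(q, d n) # l \<in> lists (\<rat> \<times> D)" using l(1) q(1) d by simp
    ultimately show ?case by blast
  qed
  have "open (V i)" if "i \<in> UNIV" for i using \<psi>[of i] by blast
  moreover have "UNIV \<subseteq> (\<Union>i. V i)"
  proof
    fix x :: 'x
    obtain z where z: "z \<in> D" "x \<in> K z" using K(2) by blast
    then obtain i where "z = d i" using range_d by blast
    hence "x \<in> V i" using \<psi>[of i] z(2) by blast
    thus "x \<in> (\<Union>i. V i)" by blast
  qed
  ultimately obtain I where I: "I \<subseteq> UNIV" "finite I" "UNIV \<subseteq> (\<Union>i\<in>I. V i)"
    by (rule compactE_image[OF compact_space])
  obtain n where n: "\<And>i. i \<in> I \<Longrightarrow> i < n" using I(2) unfolding finite_nat_set_iff_bounded by blast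
  have vanish: "\<Phi> m x = 0" if x: "x \<in> V i" "i < m" for x i m
    using x(2)
  proof (induction m)
    case (Suc m)
    show ?case
    proof (cases "i = m")
      case True
      hence "\<psi> m x = 1" using \<psi>[of m] x(1) by blast
      thus ?thesis by (simp add: \<Phi>_Suc \<psi>_def)
    qed (use Suc in \<open>simp add: \<Phi>_Suc\<close>)
  qed simp
  have \<Phi>_n: "\<Phi> n = (\<lambda>x. 0)"
  proof
    fix x :: 'x
    obtain i where "i \<in> I" "x \<in> V i" using I(3) by blast
    thus "\<Phi> n x = 0" using n by (intro vanish)
  qed
  obtain l where l: "l \<in> lists (\<rat> \<times> D)" "\<And>f. f \<in> H \<Longrightarrow> \<bar>L f - L (\<lambda>x. \<Phi> n x * f x) - evaluation l f\<bar>
      \<le> 2 * \<epsilon> * (variation (\<lambda>x. 1) - variation (\<Phi> n)) + \<delta> * (1 - 1 / 2 ^ n)" using step[of n] by blast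
  show thesis
  proof (rule that[OF l(1)], intro allI impI)
    fix f assume "continuous_on UNIV f \<and> (\<forall>x. \<bar>f x\<bar> \<le> 1) \<and> (\<forall>d\<in>D. \<forall>x\<in>K d. \<bar>f x - f d\<bar> \<le> \<epsilon>)"
    hence "f \<in> H" by (simp add: H_def)
    from l(2)[OF this] have "\<bar>L f - evaluation l f\<bar>
        \<le> 2 * \<epsilon> * (variation (\<lambda>x. 1) - variation (\<lambda>x. 0)) + \<delta> * (1 - 1 / 2 ^ n)"
      by (simp add: \<Phi>_n L_zero)
    also have "\<dots> \<le> 2 * \<epsilon> * C + \<delta>"
    proof (rule add_mono)
      have "variation (\<lambda>x. 1) - variation (\<lambda>x. 0) \<le> C"
        using variation_le[of "\<lambda>x. 1" 1] variation_nonneg[of "\<lambda>x. 0"] by simp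
      thus "2 * \<epsilon> * (variation (\<lambda>x. 1) - variation (\<lambda>x. 0)) \<le> 2 * \<epsilon> * C"
        using \<open>\<epsilon> > 0\<close> by (intro mult_left_mono) simp_all
      show "\<delta> * (1 - 1 / 2 ^ n) \<le> \<delta>" using \<open>\<delta> > 0\<close> by (simp add: mult_left_le)
    qed
    finally show "\<bar>L f - evaluation l f\<bar> \<le> 2 * \<epsilon> * C + \<delta>" .
  qed
qed

end

section \<open>Normed spaces carried by an injection\<close>

text \<open>
The vector spaces that occur below live in types of class \<open>real_vector\<close>. They are moved to a given
carrier type along an injection \<open>\<iota>\<close>, since representability speaks about one fixed carrier type.
\<close>

definition carried_space :: "('a::real_vector \<Rightarrow> 'v) \<Rightarrow> 'a set \<Rightarrow> ('a \<Rightarrow> real) \<Rightarrow> 'v vspace" where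
  "carried_space \<iota> S N = \<lparr>vcarrier = \<iota> ` S, vzero = \<iota> 0,
     vadd = (\<lambda>v w. \<iota> (inv \<iota> v + inv \<iota> w)), vscale = (\<lambda>a v. \<iota> (a *\<^sub>R inv \<iota> v)),
     vnorm = (\<lambda>v. N (inv \<iota> v))\<rparr>"

locale carried_norm =
  fixes \<iota> :: "'a::real_vector \<Rightarrow> 'v" and S :: "'a set" and N :: "'a \<Rightarrow> real"
  assumes inj_carrier: "inj \<iota>" and subspace: "subspace S"
    and N_nonneg: "f \<in> S \<Longrightarrow> 0 \<le> N f"
    and N_eq_0: "f \<in> S \<Longrightarrow> N f = 0 \<longleftrightarrow> f = 0"
    and N_scale: "f \<in> S \<Longrightarrow> N (a *\<^sub>R f) = \<bar>a\<bar> * N f"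
    and N_triangle: "f \<in> S \<Longrightarrow> g \<in> S \<Longrightarrow> N (f + g) \<le> N f + N g"
begin

abbreviation "V \<equiv> carried_space \<iota> S N"

lemma inv_carrier [simp]: "inv \<iota> (\<iota> f) = f"
  using inj_carrier by (rule inv_f_f)

lemma V_simps [simp]:
  "vcarrier V = \<iota> ` S" "vzero V = \<iota> 0" "vadd V (\<iota> f) (\<iota> g) = \<iota> (f + g)"
  "vscale V a (\<iota> f) = \<iota> (a *\<^sub>R f)" "vnorm V (\<iota> f) = N f"
  by (simp_all add: carried_space_def)

lemma normed_vspace_V: "normed_vspace V"
proof
  show "\<exists>y\<in>vcarrier V. vadd V x y = vzero V" if "x \<in> vcarrier V" for x
  proof -
    obtain f where f: "f \<in> S" "x = \<iota> f" using \<open>x \<in> vcarrier V\<close> by auto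
    have "\<iota> (- f) \<in> vcarrier V" using f(1) subspace by (simp add: subspace_neg)
    moreover have "vadd V x (\<iota> (- f)) = vzero V" using f(2) by simp
    ultimately show ?thesis by blast
  qed
  show "vadd V x y = vadd V y x" if "x \<in> vcarrier V" "y \<in> vcarrier V" for x y
    using that by (auto simp: add.commute)
  show "vnorm V x = 0 \<longleftrightarrow> x = vzero V" if "x \<in> vcarrier V" for x
    using that N_eq_0 by (auto simp: inj_eq[OF inj_carrier])
qed (auto simp: subspace_0[OF subspace] subspace_add[OF subspace] subspace_scale[OF subspace]
    add.assoc scaleR_add_right scaleR_add_left N_nonneg N_scale N_triangle)

lemma vdist_V: "f \<in> S \<Longrightarrow> g \<in> S \<Longrightarrow> vdist V (\<iota> f) (\<iota> g) = N (f - g)"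
  by (simp add: vdist_def)

end

text \<open>
Every linear functional below \<open>p u = inf {C \<parallel>u - w\<parallel> + f w + \<delta> N w | w \<in> W}\<close> has the desired properties: \<open>w = 0\<close>
gives the bound by \<open>C \<parallel>u\<parallel>\<close>, and \<open>w = u\<close> the closeness to \<open>f\<close> on \<open>W\<close>. The hypothesis on \<open>f\<close> says exactly
that the infimum is finite.
\<close>

lemma approximation_by_norm_bounded_functional:
  fixes W :: "'a::real_normed_vector set"
  assumes W: "subspace W" and N: "\<And>u v. u \<in> W \<Longrightarrow> v \<in> W \<Longrightarrow> N (u + v) \<le> N u + N v"
      "\<And>a u. u \<in> W \<Longrightarrow> N (a *\<^sub>R u) = \<bar>a\<bar> * N u"
    and f: "\<And>u v. u \<in> W \<Longrightarrow> v \<in> W \<Longrightarrow> f (u + v) = f u + f v"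
      "\<And>a u. u \<in> W \<Longrightarrow> f (a *\<^sub>R u) = a * f u"
    and bound: "\<And>u. u \<in> W \<Longrightarrow> \<bar>f u\<bar> \<le> C * norm u + \<delta> * N u" and "C \<ge> 0" "\<delta> \<ge> 0"
  obtains \<mu> :: "'a \<Rightarrow> real" where "linear \<mu>" "\<And>u. \<bar>\<mu> u\<bar> \<le> C * norm u"
    "\<And>w. w \<in> W \<Longrightarrow> \<bar>\<mu> w - f w\<bar> \<le> \<delta> * N w"
proof -
  define h where "h u w = C * norm (u - w) + f w + \<delta> * N w" for u w
  define p where "p u = (INF w\<in>W. h u w)" for u
  have W0: "0 \<in> W" using W by (rule subspace_0)
  have f0: "f 0 = 0" using f(2)[OF W0, of 0] by simp
  have N0: "N 0 = 0" using N(2)[OF W0, of 0] by simp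
  have low: "- (C * norm u) \<le> h u w" if w: "w \<in> W" for u w
  proof -
    have "C * norm w \<le> C * (norm u + norm (u - w))"
      using \<open>C \<ge> 0\<close> norm_triangle_ineq4[of u "u - w"] by (intro mult_left_mono) simp_all
    thus ?thesis using bound[OF w] unfolding h_def by (simp add: distrib_left abs_le_iff)
  qed
  have lower: "p u \<le> h u w" if "w \<in> W" for u w
    unfolding p_def using low that by (intro cINF_lower bdd_belowI2[of _ "- (C * norm u)"])
  have greatest: "a \<le> p u" if "\<And>w. w \<in> W \<Longrightarrow> a \<le> h u w" for a u
    unfolding p_def using that W0 by (intro cINF_greatest) auto
  have "sublinear p"
  proof (rule sublinearI)
    fix u v
    have *: "p (u + v) \<le> h u w + h v z" if wz: "w \<in> W" "z \<in> W" for w z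
    proof -
      have "p (u + v) \<le> h (u + v) (w + z)" using wz W by (intro lower subspace_add)
      moreover have "norm (u + v - (w + z)) \<le> norm (u - w) + norm (v - z)" by (rule norm_diff_triangle_ineq)
      hence "C * norm (u + v - (w + z)) \<le> C * (norm (u - w) + norm (v - z))"
        using \<open>C \<ge> 0\<close> by (rule mult_left_mono)
      moreover have "\<delta> * N (w + z) \<le> \<delta> * (N w + N z)"
        using N(1)[OF wz] \<open>\<delta> \<ge> 0\<close> by (rule mult_left_mono)
      ultimately show ?thesis
        using f(1)[OF wz] unfolding h_def by (simp add: distrib_left)
    qed
    have "p (u + v) - p u \<le> h v z" if z: "z \<in> W" for z
    proof -
      have "p (u + v) - h v z \<le> p u" using *[OF _ z] by (intro greatest) (simp add: diff_le_eq)
      thus ?thesis by linarith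
    qed
    hence "p (u + v) - p u \<le> p v" by (rule greatest)
    thus "p (u + v) \<le> p u + p v" by linarith
  next
    fix c :: real and u assume c: "c > 0"
    have "p (c *\<^sub>R u) / c \<le> h u w" if w: "w \<in> W" for w
    proof -
      have "p (c *\<^sub>R u) \<le> h (c *\<^sub>R u) (c *\<^sub>R w)" using w W by (intro lower subspace_scale)
      also have "\<dots> = c * h u w"
        using c f(2)[OF w] N(2)[OF w] by (simp add: h_def algebra_simps flip: scaleR_diff_right)
      finally show ?thesis using c by (simp add: field_simps)
    qed
    hence "p (c *\<^sub>R u) / c \<le> p u" by (rule greatest)
    thus "p (c *\<^sub>R u) \<le> c * p u" using c by (simp add: field_simps)
  next
    show "p 0 = 0"
    proof (rule antisym)
      show "p 0 \<le> 0" using lower[OF W0, of 0] by (simp add: h_def f0 N0)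
      show "0 \<le> p 0" using low[of _ 0] by (intro greatest) simp
    qed
  qed
  then obtain \<mu> where \<mu>: "linear \<mu>" "\<And>u. \<mu> u \<le> p u" by (rule sublinear_dominates_linear) blast
  have neg: "\<mu> (- u) = - \<mu> u" for u using \<mu>(1) by (rule linear_neg)
  have 1: "\<mu> u \<le> C * norm u" for u
    using order_trans[OF \<mu>(2) lower[OF W0]] by (simp add: h_def f0 N0)
  have 2: "\<mu> w - f w \<le> \<delta> * N w" if "w \<in> W" for w
    using order_trans[OF \<mu>(2) lower[OF that], of w] by (simp add: h_def)
  show thesis
  proof
    show "linear \<mu>" by fact
    show "\<bar>\<mu> u\<bar> \<le> C * norm u" for u
      using 1[of u] 1[of "- u"] neg[of u] by (simp add: abs_le_iff)
    show "\<bar>\<mu> w - f w\<bar> \<le> \<delta> * N w" if w: "w \<in> W" for w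
    proof -
      have "- w \<in> W" using w W by (simp add: subspace_neg)
      thus ?thesis
        using 2[OF w] 2[of "- w"] neg[of w] f(2)[OF w, of "-1"] N(2)[OF w, of "-1"] by (simp add: abs_le_iff)
    qed
  qed
qed

section \<open>Little Hoelder functions\<close>

context compact_system
begin

text \<open>
The exponent \<open>1/2\<close> could be any number strictly between 0 and 1: it has to be less than 1 so that
Lipschitz functions, such as the functions \<open>dist p\<close>, are little Hoelder functions.
\<close>

definition hoelder_bound :: "('x \<Rightarrow>\<^sub>C real) \<Rightarrow> real \<Rightarrow> bool" where
  "hoelder_bound f c \<longleftrightarrow> (\<forall>x. \<bar>f x\<bar> \<le> c) \<and> (\<forall>x y. \<bar>f x - f y\<bar> \<le> c * sqrt (dG act x y))"

definition little_hoelder :: "('x \<Rightarrow>\<^sub>C real) set" where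
  "little_hoelder = {f :: 'x \<Rightarrow>\<^sub>C real. \<forall>\<epsilon>>0. \<exists>\<eta>>0. \<forall>x y. dG act x y < \<eta> \<longrightarrow> \<bar>f x - f y\<bar> \<le> \<epsilon> * sqrt (dG act x y)}"

text \<open>
The infimum is attained for little Hoelder functions, so that all norm estimates reduce to
statements about \<open>hoelder_bound\<close>.
\<close>

definition hoelder_norm :: "('x \<Rightarrow>\<^sub>C real) \<Rightarrow> real" where
  "hoelder_norm f = Inf {c. hoelder_bound f c}"

lemma abs_le_norm: "\<bar>apply_bcontfun f x\<bar> \<le> norm f" for f :: "'x \<Rightarrow>\<^sub>C real"
  using norm_bounded[of f x] by simp

lemma hoelder_bound_nonneg: "hoelder_bound f c \<Longrightarrow> 0 \<le> c"
  unfolding hoelder_bound_def using abs_ge_zero order_trans by blast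

text \<open>
At distance at least \<open>\<eta>\<close> the Hoelder condition follows from smallness of the supremum.
\<close>

lemma hoelder_bound_far:
  fixes f :: "'x \<Rightarrow>\<^sub>C real"
  assumes "norm f \<le> c * sqrt \<eta> / 2" "\<eta> \<le> dG act x y" "0 \<le> c"
  shows "\<bar>f x - f y\<bar> \<le> c * sqrt (dG act x y)"
proof -
  have "\<bar>f x - f y\<bar> \<le> 2 * norm f" using abs_le_norm[of f x] abs_le_norm[of f y] by linarith
  also have "\<dots> \<le> c * sqrt \<eta>" using assms(1) by simp
  also have "\<dots> \<le> c * sqrt (dG act x y)" using assms(2,3) by (intro mult_left_mono) simp_all
  finally show ?thesis .
qed

lemma little_hoelder_bound:
  assumes "f \<in> little_hoelder"
  shows "\<exists>c. hoelder_bound f c"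
proof -
  obtain \<eta> where \<eta>: "\<eta> > 0" "\<And>x y. dG act x y < \<eta> \<Longrightarrow> \<bar>f x - f y\<bar> \<le> 1 * sqrt (dG act x y)"
    using assms unfolding little_hoelder_def by (auto dest: spec[of _ 1])
  define c where "c = 1 + norm f + 2 * norm f / sqrt \<eta>"
  have c: "norm f \<le> c" "1 \<le> c" "norm f \<le> c * sqrt \<eta> / 2" "0 \<le> c"
  proof -
    have n: "0 \<le> 2 * norm f / sqrt \<eta>" using \<eta>(1) by simp
    thus "norm f \<le> c" "1 \<le> c" "0 \<le> c" using norm_ge_zero[of f] unfolding c_def by linarith+
    have "2 * norm f / sqrt \<eta> * sqrt \<eta> \<le> c * sqrt \<eta>"
      using \<eta>(1) norm_ge_zero[of f] unfolding c_def by (intro mult_right_mono) simp_all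
    thus "norm f \<le> c * sqrt \<eta> / 2" using \<eta>(1) by simp
  qed
  have "\<bar>f x - f y\<bar> \<le> c * sqrt (dG act x y)" for x y
  proof (cases "dG act x y < \<eta>")
    case True
    have "1 * sqrt (dG act x y) \<le> c * sqrt (dG act x y)" using c(2) by (intro mult_right_mono) simp_all
    with \<eta>(2)[OF True] show ?thesis by linarith
  next
    case False
    thus ?thesis using hoelder_bound_far[OF c(3) _ c(4)] by simp
  qed
  moreover have "\<bar>f x\<bar> \<le> c" for x using abs_le_norm[of f x] c(1) by linarith
  ultimately show ?thesis unfolding hoelder_bound_def by blast
qed

lemma hoelder_norm_le_iff:
  assumes "f \<in> little_hoelder"
  shows "hoelder_norm f \<le> c \<longleftrightarrow> hoelder_bound f c"
proof
  have bdd: "bdd_below {c. hoelder_bound f c}" using hoelder_bound_nonneg by (intro bdd_belowI[of _ 0]) simp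
  show "hoelder_norm f \<le> c" if "hoelder_bound f c"
    unfolding hoelder_norm_def using bdd that by (intro cInf_lower) simp_all
  have ne: "{c. hoelder_bound f c} \<noteq> {}" using little_hoelder_bound[OF assms] by simp
  have "hoelder_bound f (hoelder_norm f)"
    unfolding hoelder_bound_def
  proof (intro conjI allI)
    show "\<bar>f x\<bar> \<le> hoelder_norm f" for x
      unfolding hoelder_norm_def using ne by (intro cInf_greatest) (simp_all add: hoelder_bound_def)
    show "\<bar>f x - f y\<bar> \<le> hoelder_norm f * sqrt (dG act x y)" for x y
    proof (cases "dG act x y = 0")
      case True
      obtain b where "hoelder_bound f b" using ne by auto
      hence "\<bar>f x - f y\<bar> \<le> b * sqrt (dG act x y)" by (simp add: hoelder_bound_def)
      with True show ?thesis by simp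
    next
      case False
      hence "dG act x y > 0" using dG_nonneg[of x y] by linarith
      hence pos: "sqrt (dG act x y) > 0" by simp
      have "\<bar>f x - f y\<bar> / sqrt (dG act x y) \<le> hoelder_norm f"
        unfolding hoelder_norm_def using ne pos
        by (intro cInf_greatest) (simp_all add: hoelder_bound_def divide_le_eq)
      thus ?thesis using pos by (simp add: divide_le_eq)
    qed
  qed
  moreover assume "hoelder_norm f \<le> c"
  moreover have "hoelder_norm f * sqrt (dG act x y) \<le> c * sqrt (dG act x y)" for x y
    using \<open>hoelder_norm f \<le> c\<close> by (intro mult_right_mono) simp_all
  ultimately show "hoelder_bound f c"
    unfolding hoelder_bound_def by (meson order_trans)
qed

lemma hoelder_bound_norm: "f \<in> little_hoelder \<Longrightarrow> hoelder_bound f (hoelder_norm f)"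
  using hoelder_norm_le_iff by blast

lemma hoelder_norm_nonneg: "f \<in> little_hoelder \<Longrightarrow> 0 \<le> hoelder_norm f"
  using hoelder_bound_norm hoelder_bound_nonneg by blast

lemma norm_le_hoelder_norm: "f \<in> little_hoelder \<Longrightarrow> norm f \<le> hoelder_norm f"
  using hoelder_bound_norm by (intro norm_bound) (simp add: hoelder_bound_def)

lemma hoelder_bound_add: "hoelder_bound f a \<Longrightarrow> hoelder_bound g b \<Longrightarrow> hoelder_bound (f + g) (a + b)"
  unfolding hoelder_bound_def
proof (intro conjI allI; elim conjE)
  fix x y
  assume *: "\<forall>x. \<bar>f x\<bar> \<le> a" "\<forall>x. \<bar>g x\<bar> \<le> b" "\<forall>x y. \<bar>f x - f y\<bar> \<le> a * sqrt (dG act x y)"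
    "\<forall>x y. \<bar>g x - g y\<bar> \<le> b * sqrt (dG act x y)"
  show "\<bar>(f + g) x\<bar> \<le> a + b" using *(1)[rule_format, of x] *(2)[rule_format, of x] by simp
  show "\<bar>(f + g) x - (f + g) y\<bar> \<le> (a + b) * sqrt (dG act x y)"
    using *(3)[rule_format, of x y] *(4)[rule_format, of x y] by (simp add: distrib_right abs_le_iff)
qed

lemma hoelder_bound_scale: "hoelder_bound f c \<Longrightarrow> hoelder_bound (r *\<^sub>R f) (\<bar>r\<bar> * c)"
  unfolding hoelder_bound_def
  by (auto simp: abs_mult mult.assoc simp flip: right_diff_distrib intro!: mult_left_mono)

lemma subspace_little_hoelder: "subspace little_hoelder"
proof (rule subspaceI)
  show "0 \<in> little_hoelder" by (auto simp: little_hoelder_def intro: exI[of _ 1])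
next
  fix f g assume fg: "f \<in> little_hoelder" "g \<in> little_hoelder"
  show "f + g \<in> little_hoelder"
    unfolding little_hoelder_def mem_Collect_eq
  proof (intro allI impI)
    fix \<epsilon> :: real assume "\<epsilon> > 0"
    hence e: "\<epsilon> / 2 > 0" by simp
    obtain a where a: "a > 0" "\<forall>x y. dG act x y < a \<longrightarrow> \<bar>f x - f y\<bar> \<le> \<epsilon> / 2 * sqrt (dG act x y)"
      using fg(1) e unfolding little_hoelder_def by blast
    obtain b where b: "b > 0" "\<forall>x y. dG act x y < b \<longrightarrow> \<bar>g x - g y\<bar> \<le> \<epsilon> / 2 * sqrt (dG act x y)"
      using fg(2) e unfolding little_hoelder_def by blast
    have "\<bar>(f + g) x - (f + g) y\<bar> \<le> \<epsilon> * sqrt (dG act x y)" if "dG act x y < min a b" for x y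
    proof -
      have "\<bar>f x - f y\<bar> \<le> \<epsilon> * sqrt (dG act x y) / 2" "\<bar>g x - g y\<bar> \<le> \<epsilon> * sqrt (dG act x y) / 2"
        using a(2) b(2) that by simp_all
      thus ?thesis unfolding plus_bcontfun.rep_eq by linarith
    qed
    thus "\<exists>\<eta>>0. \<forall>x y. dG act x y < \<eta> \<longrightarrow> \<bar>(f + g) x - (f + g) y\<bar> \<le> \<epsilon> * sqrt (dG act x y)"
      using a(1) b(1) by (intro exI[of _ "min a b"]) simp
  qed
next
  fix r :: real and f assume f: "f \<in> little_hoelder"
  show "r *\<^sub>R f \<in> little_hoelder"
    unfolding little_hoelder_def mem_Collect_eq
  proof (intro allI impI)
    fix \<epsilon> :: real assume "\<epsilon> > 0"
    hence e: "\<epsilon> / (\<bar>r\<bar> + 1) > 0" by simp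
    obtain a where a: "a > 0"
      "\<forall>x y. dG act x y < a \<longrightarrow> \<bar>f x - f y\<bar> \<le> \<epsilon> / (\<bar>r\<bar> + 1) * sqrt (dG act x y)"
      using f e unfolding little_hoelder_def by blast
    have "\<bar>(r *\<^sub>R f) x - (r *\<^sub>R f) y\<bar> \<le> \<epsilon> * sqrt (dG act x y)" if "dG act x y < a" for x y
    proof -
      have "\<bar>(r *\<^sub>R f) x - (r *\<^sub>R f) y\<bar> = \<bar>r\<bar> * \<bar>f x - f y\<bar>"
        by (simp add: abs_mult flip: right_diff_distrib)
      also have "\<dots> \<le> (\<bar>r\<bar> + 1) * (\<epsilon> / (\<bar>r\<bar> + 1) * sqrt (dG act x y))"
        using a(2) that by (intro mult_mono) simp_all
      also have "\<dots> = \<epsilon> * sqrt (dG act x y)" by (simp add: add_nonneg_eq_0_iff)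
      finally show ?thesis .
    qed
    thus "\<exists>\<eta>>0. \<forall>x y. dG act x y < \<eta> \<longrightarrow> \<bar>(r *\<^sub>R f) x - (r *\<^sub>R f) y\<bar> \<le> \<epsilon> * sqrt (dG act x y)"
      using a(1) by blast
  qed
qed

lemmas little_hoelder_intros =
  subspace_0[OF subspace_little_hoelder] subspace_add[OF subspace_little_hoelder]
  subspace_scale[OF subspace_little_hoelder] subspace_diff[OF subspace_little_hoelder]

lemma hoelder_norm_scale_le:
  assumes "f \<in> little_hoelder"
  shows "hoelder_norm (r *\<^sub>R f) \<le> \<bar>r\<bar> * hoelder_norm f"
  using assms hoelder_bound_scale[OF hoelder_bound_norm] by (simp add: hoelder_norm_le_iff little_hoelder_intros)

lemma carried_norm_little_hoelder:
  assumes "inj (\<iota> :: ('x \<Rightarrow>\<^sub>C real) \<Rightarrow> 'v)"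
  shows "carried_norm \<iota> little_hoelder hoelder_norm"
proof
  fix f assume f: "f \<in> little_hoelder"
  show "hoelder_norm f = 0 \<longleftrightarrow> f = 0"
  proof
    assume "hoelder_norm f = 0"
    thus "f = 0" using norm_le_hoelder_norm[OF f] by simp
  next
    assume "f = 0"
    hence "hoelder_bound f 0" by (simp add: hoelder_bound_def)
    thus "hoelder_norm f = 0"
      using hoelder_norm_le_iff[OF f, of 0] hoelder_norm_nonneg[OF f] by simp
  qed
  fix a :: real
  show "hoelder_norm (a *\<^sub>R f) = \<bar>a\<bar> * hoelder_norm f"
  proof (cases "a = 0")
    case True
    have "hoelder_norm 0 = 0"
      using hoelder_norm_scale_le[OF f, of 0] hoelder_norm_nonneg[of 0] by (simp add: little_hoelder_intros)
    thus ?thesis using True by simp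
  next
    case False
    have "hoelder_norm ((1 / a) *\<^sub>R (a *\<^sub>R f)) \<le> \<bar>1 / a\<bar> * hoelder_norm (a *\<^sub>R f)"
      using f by (intro hoelder_norm_scale_le little_hoelder_intros)
    hence "\<bar>a\<bar> * hoelder_norm f \<le> hoelder_norm (a *\<^sub>R f)" using False by (simp add: field_simps)
    thus ?thesis using hoelder_norm_scale_le[OF f, of a] by simp
  qed
next
  fix f g assume "f \<in> little_hoelder" "g \<in> little_hoelder"
  thus "hoelder_norm (f + g) \<le> hoelder_norm f + hoelder_norm g"
    using hoelder_bound_add[OF hoelder_bound_norm hoelder_bound_norm]
    by (simp add: hoelder_norm_le_iff little_hoelder_intros)
qed (simp_all add: assms subspace_little_hoelder hoelder_norm_nonneg)

lemma little_hoelder_complete: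
  fixes s :: "nat \<Rightarrow> 'x \<Rightarrow>\<^sub>C real"
  assumes s: "\<And>n. s n \<in> little_hoelder"
    and cauchy: "\<And>\<epsilon>. \<epsilon> > 0 \<Longrightarrow> \<exists>N. \<forall>m\<ge>N. \<forall>n\<ge>N. hoelder_norm (s m - s n) < \<epsilon>"
  shows "\<exists>f\<in>little_hoelder. \<forall>\<epsilon>>0. \<exists>N. \<forall>n\<ge>N. hoelder_norm (s n - f) < \<epsilon>"
proof -
  have diff: "s m - s n \<in> little_hoelder" for m n using s by (intro little_hoelder_intros)
  have "Cauchy s"
    unfolding Cauchy_def dist_norm using cauchy norm_le_hoelder_norm[OF diff] by (meson le_less_trans)
  then obtain f where f: "s \<longlonglongrightarrow> f" using Cauchy_convergent by (auto simp: convergent_def)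
  have ptw: "(\<lambda>n. s n x) \<longlonglongrightarrow> f x" for x
  proof (rule metric_tendsto_imp_tendsto[OF f])
    show "\<forall>\<^sub>F n in sequentially. dist (s n x) (f x) \<le> dist (s n) f"
      by (intro always_eventually allI dist_bounded)
  qed
  have lim: "\<exists>N. \<forall>n\<ge>N. hoelder_bound (s n - f) \<epsilon>" if \<epsilon>: "\<epsilon> > 0" for \<epsilon>
  proof -
    obtain N where N: "\<forall>m\<ge>N. \<forall>n\<ge>N. hoelder_norm (s m - s n) < \<epsilon>" using cauchy[OF \<epsilon>] by blast
    have b: "hoelder_bound (s m - s n) \<epsilon>" if "m \<ge> N" "n \<ge> N" for m n
      using N that by (simp add: less_imp_le flip: hoelder_norm_le_iff[OF diff])
    have "hoelder_bound (s n - f) \<epsilon>" if n: "n \<ge> N" for n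
      unfolding hoelder_bound_def
    proof (intro conjI allI)
      fix x y
      have "(\<lambda>m. \<bar>(s n - s m) x\<bar>) \<longlonglongrightarrow> \<bar>(s n - f) x\<bar>"
        by (auto intro!: tendsto_intros ptw)
      moreover have "\<forall>m\<ge>N. \<bar>(s n - s m) x\<bar> \<le> \<epsilon>" using b[OF n] unfolding hoelder_bound_def by blast
      ultimately show "\<bar>(s n - f) x\<bar> \<le> \<epsilon>" by (rule Lim_bounded)
      have "(\<lambda>m. \<bar>(s n - s m) x - (s n - s m) y\<bar>) \<longlonglongrightarrow> \<bar>(s n - f) x - (s n - f) y\<bar>"
        by (auto intro!: tendsto_intros ptw)
      moreover have "\<forall>m\<ge>N. \<bar>(s n - s m) x - (s n - s m) y\<bar> \<le> \<epsilon> * sqrt (dG act x y)"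
        using b[OF n] unfolding hoelder_bound_def by blast
      ultimately show "\<bar>(s n - f) x - (s n - f) y\<bar> \<le> \<epsilon> * sqrt (dG act x y)" by (rule Lim_bounded)
    qed
    thus ?thesis by blast
  qed
  have f_mem: "f \<in> little_hoelder"
    unfolding little_hoelder_def mem_Collect_eq
  proof (intro allI impI)
    fix \<epsilon> :: real assume "\<epsilon> > 0"
    hence e: "\<epsilon> / 2 > 0" by simp
    obtain n where n: "hoelder_bound (s n - f) (\<epsilon> / 2)" using lim[OF e] by blast
    obtain \<eta> where \<eta>: "\<eta> > 0" "\<forall>x y. dG act x y < \<eta> \<longrightarrow> \<bar>s n x - s n y\<bar> \<le> \<epsilon> / 2 * sqrt (dG act x y)"
      using s[of n] e unfolding little_hoelder_def by blast
    have "\<bar>f x - f y\<bar> \<le> \<epsilon> * sqrt (dG act x y)" if xy: "dG act x y < \<eta>" for x y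
    proof -
      have "\<bar>(s n - f) x - (s n - f) y\<bar> \<le> \<epsilon> * sqrt (dG act x y) / 2"
        using n unfolding hoelder_bound_def by simp
      moreover have "\<bar>s n x - s n y\<bar> \<le> \<epsilon> * sqrt (dG act x y) / 2" using \<eta>(2) xy by simp
      ultimately show ?thesis unfolding minus_bcontfun.rep_eq by linarith
    qed
    thus "\<exists>\<eta>>0. \<forall>x y. dG act x y < \<eta> \<longrightarrow> \<bar>f x - f y\<bar> \<le> \<epsilon> * sqrt (dG act x y)" using \<eta>(1) by blast
  qed
  have "\<exists>N. \<forall>n\<ge>N. hoelder_norm (s n - f) < \<epsilon>" if "\<epsilon> > 0" for \<epsilon>
  proof -
    have "\<epsilon> / 2 > 0" using that by simp
    then obtain N where "\<forall>n\<ge>N. hoelder_bound (s n - f) (\<epsilon> / 2)" using lim by blast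
    moreover have "s n - f \<in> little_hoelder" for n
      using s f_mem by (intro little_hoelder_intros)
    ultimately have "\<forall>n\<ge>N. hoelder_norm (s n - f) \<le> \<epsilon> / 2"
      using hoelder_norm_le_iff by blast
    thus ?thesis using that by (intro exI[of _ N]) force
  qed
  thus ?thesis using f_mem by blast
qed

text \<open>
If the bound fails for every \<open>C\<close>, then there are \<open>u\<close> in the unit ball of \<open>W\<close> with arbitrarily small
supremum and \<open>f u \<ge> \<delta>\<close>. The Hoelder quotients of such a \<open>u\<close> are small for all pairs that are not too close,
and those of a given little Hoelder function are small for all pairs that are close enough. So
one can add \<open>k\<close> such functions whose large quotients occur at different distances: the sum \<open>s\<close> stays in the
ball of radius 2, but \<open>f s \<ge> k * \<delta>\<close>, which contradicts boundedness of \<open>f\<close>.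
\<close>

lemma hoelder_functional_bound:
  assumes W: "subspace W" "W \<subseteq> little_hoelder"
    and f: "\<And>u v. u \<in> W \<Longrightarrow> v \<in> W \<Longrightarrow> f (u + v) = f u + f v"
      "\<And>a u. u \<in> W \<Longrightarrow> f (a *\<^sub>R u) = a * f u"
    and K: "\<And>u. u \<in> W \<Longrightarrow> \<bar>f u\<bar> \<le> K * hoelder_norm u"
    and "\<delta> > 0"
  shows "\<exists>C\<ge>0. \<forall>u\<in>W. \<bar>f u\<bar> \<le> C * norm u + \<delta> * hoelder_norm u"
proof (rule ccontr)
  assume no: "\<not> ?thesis"
  have mem: "u \<in> little_hoelder" if "u \<in> W" for u using that W(2) by blast
  have thin: "\<exists>u\<in>W. hoelder_bound u 1 \<and> norm u \<le> t \<and> \<delta> \<le> f u" if t: "t > 0" for t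
  proof -
    define C where "C = \<bar>K\<bar> / t"
    have "C \<ge> 0" using t by (simp add: C_def)
    then obtain u where u: "u \<in> W" "C * norm u + \<delta> * hoelder_norm u < \<bar>f u\<bar>"
      using no by (meson not_le)
    have f0: "f 0 = 0" using f(2)[OF u(1), of 0] by simp
    have pos: "hoelder_norm u > 0"
    proof (rule ccontr)
      assume "\<not> hoelder_norm u > 0"
      hence "norm u \<le> 0" using norm_le_hoelder_norm[OF mem[OF u(1)]] by linarith
      hence "u = 0" by simp
      with u(2) f0 hoelder_norm_nonneg[OF mem[OF u(1)]] \<open>\<delta> > 0\<close> show False
        by (simp add: not_le[symmetric])
    qed
    define r where "r = sgn (f u) / hoelder_norm u"
    have f_u: "\<delta> * hoelder_norm u \<le> \<bar>f u\<bar>"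
      using u(2) mult_nonneg_nonneg[OF \<open>C \<ge> 0\<close> norm_ge_zero[of u]] by linarith
    moreover have "f (r *\<^sub>R u) = \<bar>f u\<bar> / hoelder_norm u"
      by (simp add: f(2)[OF u(1)] r_def abs_sgn mult.commute)
    ultimately have f_r: "\<delta> \<le> f (r *\<^sub>R u)" using pos by (simp add: le_divide_eq)
    have abs_r: "\<bar>r\<bar> \<le> 1 / hoelder_norm u"
      using pos by (simp add: r_def abs_mult divide_right_mono abs_sgn_eq)
    have "\<bar>r\<bar> * hoelder_norm u \<le> 1 / hoelder_norm u * hoelder_norm u"
      using abs_r pos by (intro mult_right_mono) simp_all
    hence "hoelder_norm (r *\<^sub>R u) \<le> 1"
      using pos hoelder_norm_scale_le[OF mem[OF u(1)], of r] by simp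
    hence b_r: "hoelder_bound (r *\<^sub>R u) 1"
      using mem[OF u(1)] by (simp add: little_hoelder_intros hoelder_norm_le_iff)
    have "C * norm u \<le> \<bar>K\<bar> * hoelder_norm u"
      using u(2) K[OF u(1)] \<open>\<delta> > 0\<close> pos mult_right_mono[OF abs_ge_self[of K], of "hoelder_norm u"]
        mult_pos_pos[OF \<open>\<delta> > 0\<close> pos] by linarith
    have "0 < \<bar>f u\<bar>" using f_u mult_pos_pos[OF \<open>\<delta> > 0\<close> pos] by linarith
    hence "K \<noteq> 0" using K[OF u(1)] by auto
    hence "norm u \<le> t * hoelder_norm u"
      using \<open>C * norm u \<le> \<bar>K\<bar> * hoelder_norm u\<close> t by (simp add: C_def field_simps)
    hence "1 / hoelder_norm u * norm u \<le> 1 / hoelder_norm u * (t * hoelder_norm u)"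
      using pos by (intro mult_left_mono) simp_all
    moreover have "norm (r *\<^sub>R u) \<le> 1 / hoelder_norm u * norm u"
      using abs_r by (simp only: norm_scaleR) (intro mult_right_mono norm_ge_zero)
    ultimately have "norm (r *\<^sub>R u) \<le> t" using pos by simp
    with f_r b_r u(1) W(1) show ?thesis by (blast intro: subspace_scale)
  qed
  \<comment> \<open>The bounds increase to 1 and 2 by \<open>e = 1 / 2 ^ (k + 1)\<close> in each step. For pairs closer than \<open>\<eta>\<close> the sum
      \<open>s\<close> contributes at most \<open>e\<close> and the new function at most 1, for all other pairs the new function
      contributes at most \<open>e\<close>.\<close>
  have hump: "\<exists>s\<in>W. norm s \<le> 1 - 1 / 2 ^ k \<and> hoelder_bound s (2 - 1 / 2 ^ k) \<and> real k * \<delta> \<le> f s" for k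
  proof (induction k)
    case 0
    have "0 \<in> W" using W(1) by (rule subspace_0)
    moreover from this have "f 0 = 0" using f(2)[of 0 0] by simp
    ultimately show ?case by (intro bexI[of _ 0]) (simp_all add: hoelder_bound_def)
  next
    case (Suc k)
    then obtain s where s: "s \<in> W" "norm s \<le> 1 - 1 / 2 ^ k" "hoelder_bound s (2 - 1 / 2 ^ k)" "real k * \<delta> \<le> f s"
      by blast
    define e :: real where "e = 1 / 2 ^ Suc k"
    have e: "e > 0" "e \<le> 1 / 2" "1 / 2 ^ k = 2 * e"
    proof -
      have "(1::real) \<le> 2 ^ k" by simp
      thus "e \<le> 1 / 2" by (simp add: e_def field_simps)
    qed (simp_all add: e_def)
    obtain \<eta> where \<eta>: "\<eta> > 0" "\<forall>x y. dG act x y < \<eta> \<longrightarrow> \<bar>s x - s y\<bar> \<le> e * sqrt (dG act x y)"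
      using mem[OF s(1)] e(1) unfolding little_hoelder_def by blast
    have "min e (e * sqrt \<eta> / 2) > 0" using e(1) \<eta>(1) by simp
    then obtain u where u: "u \<in> W" "hoelder_bound u 1" "norm u \<le> e" "norm u \<le> e * sqrt \<eta> / 2" "\<delta> \<le> f u"
      using thin by (metis min.boundedE)
    have n: "norm (s + u) \<le> 1 - e"
      using norm_triangle_ineq[of s u] s(2) u(3) e(3) by linarith
    have "\<bar>(s + u) x - (s + u) y\<bar> \<le> (2 - e) * sqrt (dG act x y)" for x y
    proof -
      have tri: "\<bar>(s + u) x - (s + u) y\<bar> \<le> \<bar>s x - s y\<bar> + \<bar>u x - u y\<bar>" by simp
      show ?thesis
      proof (cases "dG act x y < \<eta>")
        case True
        have "\<bar>s x - s y\<bar> \<le> e * sqrt (dG act x y)" using \<eta>(2) True by blast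
        moreover have "\<bar>u x - u y\<bar> \<le> 1 * sqrt (dG act x y)" using u(2) by (simp add: hoelder_bound_def)
        moreover have "(e + 1) * sqrt (dG act x y) \<le> (2 - e) * sqrt (dG act x y)"
          using e(2) by (intro mult_right_mono) simp_all
        ultimately show ?thesis using tri by (simp add: distrib_right)
      next
        case False
        hence "\<bar>u x - u y\<bar> \<le> e * sqrt (dG act x y)"
          using u(4) e(1) by (intro hoelder_bound_far[where \<eta> = \<eta>]) simp_all
        moreover have "\<bar>s x - s y\<bar> \<le> (2 - 2 * e) * sqrt (dG act x y)"
          using s(3) e(3) by (simp add: hoelder_bound_def)
        moreover have "(2 - 2 * e) * sqrt (dG act x y) + e * sqrt (dG act x y) = (2 - e) * sqrt (dG act x y)"
          by (simp add: algebra_simps)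
        ultimately show ?thesis using tri by linarith
      qed
    qed
    moreover have "\<bar>(s + u) x\<bar> \<le> 2 - e" for x
      using abs_le_norm[of "s + u" x] n by linarith
    ultimately have "hoelder_bound (s + u) (2 - e)" by (simp add: hoelder_bound_def)
    moreover have "real (Suc k) * \<delta> \<le> f (s + u)"
      using s(4) u(5) f(1)[OF s(1) u(1)] by (simp add: distrib_right)
    ultimately show ?case
      using n subspace_add[OF W(1) s(1) u(1)] unfolding e_def by blast
  qed
  obtain k :: nat where k: "2 * \<bar>K\<bar> / \<delta> < real k" using reals_Archimedean2 by blast
  obtain s where s: "s \<in> W" "hoelder_bound s (2 - 1 / 2 ^ k)" "real k * \<delta> \<le> f s" using hump[of k] by blast
  have "hoelder_norm s \<le> 2 - 1 / 2 ^ k" using s(2) mem[OF s(1)] by (simp add: hoelder_norm_le_iff)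
  also have "\<dots> \<le> 2" by simp
  finally have "\<bar>K\<bar> * hoelder_norm s \<le> \<bar>K\<bar> * 2" by (intro mult_left_mono) simp_all
  moreover have "K * hoelder_norm s \<le> \<bar>K\<bar> * hoelder_norm s"
    using hoelder_norm_nonneg[OF mem[OF s(1)]] by (intro mult_right_mono) simp_all
  moreover have "2 * \<bar>K\<bar> < real k * \<delta>" using k \<open>\<delta> > 0\<close> by (simp add: divide_less_eq)
  ultimately show False using K[OF s(1)] s(3) by linarith
qed

section \<open>The little Hoelder space is Asplund\<close>

lemma apply_Bcontfun:
  assumes "continuous_on UNIV (F :: 'x \<Rightarrow> real)"
  shows "apply_bcontfun (Bcontfun F) = F"
proof (rule Bcontfun_inverse)
  have "bounded (range F)"
    using compact_continuous_image[OF assms compact_UNIV] by (rule compact_imp_bounded)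
  thus "F \<in> bcontfun" using assms by (simp add: bcontfun_def)
qed

text \<open>
A continuous function is determined by its values on a countable dense set, and a sequence of reals is
coded by a set of natural numbers. This places \<open>C(X)\<close> inside the summand \<open>real\<close> of the
carrier type.
\<close>

lemma ex_inj_bcontfun_real:
  assumes "pm_separable UNIV (dG act)"
  shows "\<exists>\<iota> :: ('x \<Rightarrow>\<^sub>C real) \<Rightarrow> real. inj \<iota>"
proof -
  obtain D where D: "countable D" "\<forall>x. \<forall>\<epsilon>>0. \<exists>y\<in>D. dG act x y < \<epsilon>"
    using assms unfolding pm_separable_def by auto
  have "D \<noteq> {}" using D(2)[rule_format, of 1] by auto
  have dense: "closure D = UNIV"
  proof (rule set_eqI, rule iffI)
    fix x :: 'x
    have "\<exists>y\<in>D. dist y x < \<epsilon>" if "\<epsilon> > 0" for \<epsilon>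
      using D(2) that dist_le_dG[of x] by (metis dist_commute le_less_trans)
    thus "x \<in> closure D" by (simp add: closure_approachable)
  qed simp
  define d where "d = from_nat_into D"
  have range_d: "range d = D" unfolding d_def using \<open>D \<noteq> {}\<close> D(1) by (rule range_from_nat_into)
  obtain code :: "nat set \<Rightarrow> real" where code: "inj code"
    using nat_sets_eqpoll_reals by (auto simp: eqpoll_def bij_betw_def)
  obtain decode :: "real \<Rightarrow> nat set" where decode: "inj decode"
    using eqpoll_sym[OF nat_sets_eqpoll_reals] by (auto simp: eqpoll_def bij_betw_def)
  define graph where "graph f = {prod_encode (n, m) | n m. m \<in> decode (apply_bcontfun f (d n))}"
    for f :: "'x \<Rightarrow>\<^sub>C real"
  have graph_iff: "prod_encode (n, m) \<in> graph f \<longleftrightarrow> m \<in> decode (f (d n))" for n m f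
    by (auto simp: graph_def)
  have "f = g" if eq: "graph f = graph g" for f g
  proof (rule bcontfun_eqI)
    fix x
    have "decode (f (d n)) = decode (g (d n))" for n
      using graph_iff[of n _ f] graph_iff[of n _ g] eq by blast
    hence "f (d n) = g (d n)" for n using decode by (simp add: inj_eq)
    hence vanish: "f y - g y = 0" if "y \<in> D" for y using that range_d by auto
    have "continuous_on (closure D) (\<lambda>y. f y - g y)"
      by (intro continuous_on_diff continuous_on_apply_bcontfun)
    hence "f x - g x = 0"
      by (rule continuous_constant_on_closure[OF _ vanish]) (simp_all add: dense)
    thus "f x = g x" by simp
  qed
  hence "inj graph" by (rule injI)
  thus ?thesis using code by (intro exI[of _ "code \<circ> graph"] inj_compose)
qed

text \<open>
In the dual of a subspace \<open>W\<close>, the restrictions to \<open>W\<close> of the rational combinations of evaluations at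
points of a countable \<open>d\<^sub>G\<close>-dense set \<open>D0\<close> are dense: a functional on \<open>W\<close> is first replaced by a nearby
bounded functional \<open>\<mu>\<close> on \<open>C(X)\<close>, and \<open>\<mu>\<close> is then discretised.
\<close>

lemma Asplund_little_hoelder:
  assumes sep: "pm_separable UNIV (dG act)" and inj: "inj (\<iota> :: ('x \<Rightarrow>\<^sub>C real) \<Rightarrow> 'v)"
  shows "Asplund (carried_space \<iota> little_hoelder hoelder_norm)"
proof -
  interpret cn: carried_norm \<iota> little_hoelder hoelder_norm
    using inj by (rule carried_norm_little_hoelder)
  interpret nv: normed_vspace cn.V by (rule cn.normed_vspace_V)
  have "nv.met.mcomplete"
  proof (rule nv.mcomplete_iff[THEN iffD2], intro allI impI)
    fix s :: "nat \<Rightarrow> 'v"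
    assume s: "range s \<subseteq> vcarrier cn.V"
      and cauchy: "\<forall>\<epsilon>>0. \<exists>N. \<forall>m\<ge>N. \<forall>n\<ge>N. vdist cn.V (s m) (s n) < \<epsilon>"
    define t where "t n = inv \<iota> (s n)" for n
    have t: "s n = \<iota> (t n)" "t n \<in> little_hoelder" for n
    proof -
      obtain f where "f \<in> little_hoelder" "s n = \<iota> f" using s by auto
      thus "s n = \<iota> (t n)" "t n \<in> little_hoelder" by (simp_all add: t_def)
    qed
    have "\<exists>f\<in>little_hoelder. \<forall>\<epsilon>>0. \<exists>N. \<forall>n\<ge>N. hoelder_norm (t n - f) < \<epsilon>"
      using t(2) cauchy by (intro little_hoelder_complete) (simp_all add: t(1) cn.vdist_V)
    then obtain f where f: "f \<in> little_hoelder" "\<forall>\<epsilon>>0. \<exists>N. \<forall>n\<ge>N. hoelder_norm (t n - f) < \<epsilon>" by blast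
    thus "\<exists>x\<in>vcarrier cn.V. \<forall>\<epsilon>>0. \<exists>N. \<forall>n\<ge>N. vdist cn.V (s n) x < \<epsilon>"
      by (intro bexI[of _ "\<iota> f"]) (simp_all add: t cn.vdist_V)
  qed
  hence banach: "banach_vspace cn.V" by unfold_locales
  obtain D0 where D0: "countable D0" "\<forall>x. \<forall>\<epsilon>>0. \<exists>y\<in>D0. dG act x y < \<epsilon>"
    using sep unfolding pm_separable_def by auto
  have "pm_separable (dual (cn.V\<lparr>vcarrier := W\<rparr>))
      (\<lambda>f f'. dual_norm (cn.V\<lparr>vcarrier := W\<rparr>) (\<lambda>v. f v - f' v))"
    if W: "W \<subseteq> vcarrier cn.V" "banach_vspace (cn.V\<lparr>vcarrier := W\<rparr>)" for W
  proof -
    let ?W = "cn.V\<lparr>vcarrier := W\<rparr>"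
    interpret w: banach_vspace ?W by fact
    define W0 where "W0 = {u. \<iota> u \<in> W}"
    have W0_lh: "u \<in> little_hoelder" if "u \<in> W0" for u
      using that W(1) by (auto simp: W0_def inj_eq[OF inj] dest!: subsetD)
    have W_W0: "\<exists>u\<in>W0. v = \<iota> u" if "v \<in> W" for v
      using that W(1) by (auto simp: W0_def dest!: subsetD)
    have subspace_W0: "subspace W0"
    proof (rule subspaceI)
      show "0 \<in> W0" using w.zero_closed by (simp add: W0_def)
      show "u + v \<in> W0" if "u \<in> W0" "v \<in> W0" for u v
        using that w.add_closed[of "\<iota> u" "\<iota> v"] by (simp add: W0_def)
      show "c *\<^sub>R u \<in> W0" if "u \<in> W0" for c u
        using that w.scale_closed[of "\<iota> u" c] by (simp add: W0_def)
    qed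
    define ev where "ev l = restrict (\<lambda>v. evaluation l (apply_bcontfun (inv \<iota> v))) W" for l
    have ev: "ev l (\<iota> u) = evaluation l u" if "u \<in> W0" for l u
      using that by (simp add: ev_def W0_def)
    have ev_dual: "ev l \<in> dual ?W" for l
      unfolding dual_def mem_Collect_eq
    proof (intro conjI ballI allI exI)
      show "ev l \<in> extensional (vcarrier ?W)" by (simp add: ev_def)
      fix v assume "v \<in> vcarrier ?W"
      then obtain u where u: "u \<in> W0" "v = \<iota> u" using W_W0 by auto
      show "ev l (vscale ?W a v) = a * ev l v" for a
        using subspace_scale[OF subspace_W0 u(1)] u by (simp add: ev evaluation_scale)
      have "\<bar>u x\<bar> \<le> hoelder_norm u" for x
        using hoelder_bound_norm[OF W0_lh[OF u(1)]] by (simp add: hoelder_bound_def)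
      from evaluation_bound[OF this] show "\<bar>ev l v\<bar> \<le> (\<Sum>(q, d)\<leftarrow>l. \<bar>q\<bar>) * vnorm ?W v"
        using u by (simp add: ev)
      fix v' assume "v' \<in> vcarrier ?W"
      then obtain u' where u': "u' \<in> W0" "v' = \<iota> u'" using W_W0 by auto
      show "ev l (vadd ?W v v') = ev l v + ev l v'"
        using subspace_add[OF subspace_W0 u(1) u'(1)] u u' by (simp add: ev evaluation_add)
    qed
    have approx: "\<exists>l\<in>lists (\<rat> \<times> D0). dual_norm ?W (\<lambda>v. F v - ev l v) < \<epsilon>"
      if F: "F \<in> dual ?W" and \<epsilon>: "\<epsilon> > 0" for F \<epsilon>
    proof -
      obtain K where K: "\<forall>v\<in>W. \<bar>F v\<bar> \<le> K * vnorm ?W v" using F unfolding dual_def by auto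
      have lin: "\<forall>v\<in>W. \<forall>w\<in>W. F (vadd cn.V v w) = F v + F w" "\<forall>a. \<forall>v\<in>W. F (vscale cn.V a v) = a * F v"
        using F by (simp_all add: dual_def)
      have F_add: "F (\<iota> (u + v)) = F (\<iota> u) + F (\<iota> v)" if "u \<in> W0" "v \<in> W0" for u v
        using lin(1)[rule_format, of "\<iota> u" "\<iota> v"] that by (simp add: W0_def)
      have F_scale: "F (\<iota> (a *\<^sub>R u)) = a * F (\<iota> u)" if "u \<in> W0" for a u
        using lin(2)[rule_format, of "\<iota> u" a] that by (simp add: W0_def)
      have e4: "\<epsilon> / 4 > 0" using \<epsilon> by simp
      have "\<exists>C\<ge>0. \<forall>u\<in>W0. \<bar>F (\<iota> u)\<bar> \<le> C * norm u + \<epsilon> / 4 * hoelder_norm u"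
        using K W0_lh F_add F_scale e4 subspace_W0
        by (intro hoelder_functional_bound[where K = K]) (auto simp: W0_def)
      then obtain C where C: "C \<ge> 0" "\<forall>u\<in>W0. \<bar>F (\<iota> u)\<bar> \<le> C * norm u + \<epsilon> / 4 * hoelder_norm u"
        by blast
      obtain \<mu> :: "('x \<Rightarrow>\<^sub>C real) \<Rightarrow> real" where \<mu>: "linear \<mu>" "\<And>u. \<bar>\<mu> u\<bar> \<le> C * norm u"
        "\<And>u. u \<in> W0 \<Longrightarrow> \<bar>\<mu> u - F (\<iota> u)\<bar> \<le> \<epsilon> / 4 * hoelder_norm u"
      proof (rule approximation_by_norm_bounded_functional
          [of W0 hoelder_norm "\<lambda>u. F (\<iota> u)" C "\<epsilon> / 4"])
        show "\<bar>F (\<iota> u)\<bar> \<le> C * norm u + \<epsilon> / 4 * hoelder_norm u" if "u \<in> W0" for u using C(2) that by blast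
      qed (use subspace_W0 cn.N_triangle cn.N_scale W0_lh F_add F_scale C(1) e4 in auto)
      interpret L: bounded_functional "\<lambda>f. \<mu> (Bcontfun f)" C
      proof
        fix f g :: "'x \<Rightarrow> real" and c M
        assume f: "continuous_on UNIV f"
        show "\<mu> (Bcontfun (\<lambda>x. c * f x)) = c * \<mu> (Bcontfun f)"
        proof -
          have "Bcontfun (\<lambda>x. c * f x) = c *\<^sub>R Bcontfun f"
            using f by (intro bcontfun_eqI) (simp add: apply_Bcontfun continuous_on_mult)
          thus ?thesis using linear_scale[OF \<mu>(1)] by simp
        qed
        show "\<bar>\<mu> (Bcontfun f)\<bar> \<le> C * M" if M: "\<And>x. \<bar>f x\<bar> \<le> M"
        proof -
          have "norm (Bcontfun f) \<le> M" using M f by (intro norm_bound) (simp add: apply_Bcontfun)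
          hence "C * norm (Bcontfun f) \<le> C * M" using C(1) by (rule mult_left_mono)
          thus ?thesis using \<mu>(2)[of "Bcontfun f"] by linarith
        qed
        assume g: "continuous_on UNIV g"
        have "Bcontfun (\<lambda>x. f x + g x) = Bcontfun f + Bcontfun g"
          using f g by (intro bcontfun_eqI) (simp add: apply_Bcontfun continuous_on_add)
        thus "\<mu> (Bcontfun (\<lambda>x. f x + g x)) = \<mu> (Bcontfun f) + \<mu> (Bcontfun g)"
          using linear_add[OF \<mu>(1)] by simp
      qed (rule compact_UNIV)
      \<comment> \<open>The balls of radius \<open>e^2\<close> match the exponent \<open>1/2\<close>: functions of norm at most 1 vary by at most \<open>e\<close>
          from the centre. The choice of \<open>e\<close> gives \<open>2 * e * C \<le> \<epsilon> / 4\<close>.\<close>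
      define e where "e = \<epsilon> / (8 * (C + 1))"
      have e: "e > 0" "2 * e * C \<le> \<epsilon> / 4"
        using \<epsilon> C(1) by (simp_all add: e_def field_simps)
      have cover: "(\<Union>d\<in>D0. {x. dG act x d \<le> e\<^sup>2}) = UNIV"
      proof (intro set_eqI iffI UNIV_I)
        fix x :: 'x
        obtain y where "y \<in> D0" "dG act x y < e\<^sup>2" using D0(2) e(1) by (meson zero_less_power)
        thus "x \<in> (\<Union>d\<in>D0. {x. dG act x d \<le> e\<^sup>2})" by (auto intro: less_imp_le)
      qed
      obtain l where l: "l \<in> lists (\<rat> \<times> D0)"
        "\<forall>f. continuous_on UNIV f \<and> (\<forall>x. \<bar>f x\<bar> \<le> 1) \<and>
          (\<forall>d\<in>D0. \<forall>x\<in>{x. dG act x d \<le> e\<^sup>2}. \<bar>f x - f d\<bar> \<le> e) \<longrightarrow>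
          \<bar>\<mu> (Bcontfun f) - evaluation l f\<bar> \<le> 2 * e * C + \<epsilon> / 4"
        by (rule L.discretise[OF D0(1) closed_dG_cball cover e(1) e4])
      have "\<bar>F v - ev l v\<bar> \<le> 3 * \<epsilon> / 4" if v: "v \<in> W" "vnorm ?W v \<le> 1" for v
      proof -
        obtain u where u: "u \<in> W0" "v = \<iota> u" using W_W0[OF v(1)] by blast
        have N: "hoelder_norm u \<le> 1" using v(2) u by simp
        hence b: "hoelder_bound u 1" using hoelder_norm_le_iff[OF W0_lh[OF u(1)]] by simp
        have "\<bar>\<mu> (Bcontfun (apply_bcontfun u)) - evaluation l u\<bar> \<le> 2 * e * C + \<epsilon> / 4"
        proof (rule l(2)[rule_format], intro conjI allI ballI)
          show "\<bar>u x\<bar> \<le> 1" for x using b by (simp add: hoelder_bound_def)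
          fix d x assume "x \<in> {x. dG act x d \<le> e\<^sup>2}"
          hence "sqrt (dG act x d) \<le> e" using e(1) by (simp add: real_le_lsqrt)
          moreover have "\<bar>u x - u d\<bar> \<le> 1 * sqrt (dG act x d)" using b unfolding hoelder_bound_def by blast
          ultimately show "\<bar>u x - u d\<bar> \<le> e" by linarith
        qed simp
        hence "\<bar>\<mu> u - evaluation l u\<bar> \<le> 2 * e * C + \<epsilon> / 4" by (simp add: apply_bcontfun_inverse)
        moreover have "\<epsilon> / 4 * hoelder_norm u \<le> \<epsilon> / 4 * 1" using e4 N by (intro mult_left_mono) simp_all
        moreover have "\<bar>\<mu> u - F (\<iota> u)\<bar> \<le> \<epsilon> / 4 * hoelder_norm u" using u(1) by (rule \<mu>(3))
        ultimately have "\<bar>F (\<iota> u) - evaluation l u\<bar> \<le> 3 * \<epsilon> / 4" using e(2) by linarith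
        thus ?thesis using u by (simp add: ev)
      qed
      hence "dual_norm ?W (\<lambda>v. F v - ev l v) \<le> 3 * \<epsilon> / 4"
        unfolding dual_norm_def using w.zero_closed w.norm_zero by (intro cSUP_least) auto
      thus ?thesis using l(1) \<epsilon> by (intro bexI[of _ l]) simp_all
    qed
    show ?thesis
      unfolding pm_separable_def
    proof (intro exI[of _ "ev ` lists (\<rat> \<times> D0)"] conjI ballI allI impI)
      show "ev ` lists (\<rat> \<times> D0) \<subseteq> dual ?W" using ev_dual by blast
      show "countable (ev ` lists (\<rat> \<times> D0))"
        using D0(1) by (intro countable_image countable_lists) (simp add: countable_rat)
      fix F and \<epsilon> :: real assume "F \<in> dual ?W" "\<epsilon> > 0"
      from approx[OF this] show "\<exists>y\<in>ev ` lists (\<rat> \<times> D0). dual_norm ?W (\<lambda>v. F v - y v) < \<epsilon>" by blast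
    qed
  qed
  with banach show ?thesis by (simp add: Asplund_def)
qed

section \<open>The action on the little Hoelder space\<close>

definition translate :: "'g \<Rightarrow> ('x \<Rightarrow>\<^sub>C real) \<Rightarrow> ('x \<Rightarrow>\<^sub>C real)" where
  "translate g f = Bcontfun (\<lambda>x. f (act g x))"

lemma apply_translate [simp]: "apply_bcontfun (translate g f) x = f (act g x)"
proof -
  have "continuous_on UNIV (\<lambda>x. f (act g x))"
    by (rule continuous_on_compose2[OF continuous_on_apply_bcontfun[of UNIV] continuous_on_act]) simp
  thus ?thesis by (simp add: translate_def apply_Bcontfun)
qed

lemma translate_add: "translate (g + g') f = translate g' (translate g f)"
  by (rule bcontfun_eqI) (simp add: act_add)

lemma translate_minus [simp]:
  "translate g (translate (- g) f) = f" "translate (- g) (translate g f) = f"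
  by (rule bcontfun_eqI, simp)+

lemma translate_linear:
  "translate g (f + f') = translate g f + translate g f'" "translate g (a *\<^sub>R f) = a *\<^sub>R translate g f"
  by (rule bcontfun_eqI, simp)+

lemma translate_little_hoelder: "f \<in> little_hoelder \<Longrightarrow> translate g f \<in> little_hoelder"
  unfolding little_hoelder_def mem_Collect_eq apply_translate by (metis dG_act)

lemma hoelder_bound_translate: "hoelder_bound f c \<Longrightarrow> hoelder_bound (translate g f) c"
  unfolding hoelder_bound_def apply_translate by (metis dG_act)

lemma hoelder_norm_translate:
  assumes "f \<in> little_hoelder"
  shows "hoelder_norm (translate g f) = hoelder_norm f"
proof -
  have le: "hoelder_norm (translate g f) \<le> hoelder_norm f" if "f \<in> little_hoelder" for f g
    using that by (simp add: hoelder_norm_le_iff translate_little_hoelder hoelder_bound_translate hoelder_bound_norm)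
  show ?thesis
    using le[OF assms, of g] le[OF translate_little_hoelder[OF assms], of "- g" g] by simp
qed

text \<open>
All translates of \<open>f\<close> have the same modulus of continuity for \<open>d\<^sub>G\<close>, so pairs closer than \<open>\<eta>\<close> are harmless. For
the other pairs the supremum of the difference matters, and this is small by joint continuity of
the action and compactness of \<open>X\<close>.
\<close>

lemma translate_continuous:
  assumes f: "f \<in> little_hoelder" and "\<epsilon> > 0"
  shows "\<exists>U. open U \<and> g0 \<in> U \<and> (\<forall>g\<in>U. hoelder_norm (translate g f - translate g0 f) < \<epsilon>)"
proof -
  have e: "\<epsilon> / 4 > 0" using \<open>\<epsilon> > 0\<close> by simp
  obtain \<eta> where \<eta>: "\<eta> > 0" "\<forall>x y. dG act x y < \<eta> \<longrightarrow> \<bar>f x - f y\<bar> \<le> \<epsilon> / 4 * sqrt (dG act x y)"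
    using f e unfolding little_hoelder_def by blast
  define t where "t = min (\<epsilon> / 2) (\<epsilon> / 2 * sqrt \<eta> / 2)"
  have "t > 0" using \<open>\<epsilon> > 0\<close> \<eta>(1) by (simp add: t_def)
  have "continuous_on (UNIV \<times> UNIV) (\<lambda>p. f (case p of (g, x) \<Rightarrow> act g x))"
    by (rule continuous_on_compose2[OF continuous_on_apply_bcontfun[of UNIV]]) (use continuous_act in auto)
  then obtain U where U: "g0 \<in> U" "open U"
    "\<forall>g\<in>U \<inter> UNIV. \<forall>x\<in>UNIV. dist (f (case (g, x) of (g, x) \<Rightarrow> act g x)) (f (case (g0, x) of (g, x) \<Rightarrow> act g x)) \<le> t"
    using continuous_on_prod_compactE[OF _ compact_UNIV UNIV_I \<open>t > 0\<close>] by metis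
  have "hoelder_norm (translate g f - translate g0 f) < \<epsilon>" if g: "g \<in> U" for g
  proof -
    let ?u = "translate g f - translate g0 f"
    have u: "?u \<in> little_hoelder" using f by (intro little_hoelder_intros translate_little_hoelder)
    have "norm ?u \<le> t" using U(3) g by (intro norm_bound) (simp add: dist_real_def)
    hence n: "norm ?u \<le> \<epsilon> / 2" "norm ?u \<le> \<epsilon> / 2 * sqrt \<eta> / 2" by (simp_all add: t_def)
    have "\<bar>?u x - ?u y\<bar> \<le> \<epsilon> / 2 * sqrt (dG act x y)" for x y
    proof (cases "dG act x y < \<eta>")
      case True
      have "\<bar>f (act h x) - f (act h y)\<bar> \<le> \<epsilon> * sqrt (dG act x y) / 4" for h
        using \<eta>(2)[rule_format, of "act h x" "act h y"] True by simp
      from this[of g] this[of g0] have "\<bar>?u x - ?u y\<bar> \<le> \<epsilon> * sqrt (dG act x y) / 2"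
        unfolding minus_bcontfun.rep_eq apply_translate by linarith
      thus ?thesis by simp
    next
      case False
      thus ?thesis using n(2) \<open>\<epsilon> > 0\<close> by (intro hoelder_bound_far[where \<eta> = \<eta>]) simp_all
    qed
    moreover have "\<bar>?u x\<bar> \<le> \<epsilon> / 2" for x using abs_le_norm[of ?u x] n(1) by linarith
    ultimately have "hoelder_norm ?u \<le> \<epsilon> / 2"
      unfolding hoelder_norm_le_iff[OF u] hoelder_bound_def by blast
    thus ?thesis using \<open>\<epsilon> > 0\<close> by linarith
  qed
  thus ?thesis using U(1,2) by blast
qed

text \<open>
These functions separate points, which makes the evaluation map injective.
\<close>

lemma dist_little_hoelder: "Bcontfun (dist p) \<in> little_hoelder"
  unfolding little_hoelder_def mem_Collect_eq
proof (intro allI impI)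
  fix \<epsilon> :: real assume "\<epsilon> > 0"
  have "\<bar>dist p x - dist p y\<bar> \<le> \<epsilon> * sqrt (dG act x y)" if xy: "dG act x y < \<epsilon>\<^sup>2" for x y
  proof -
    have "dist p x \<le> dist p y + dist x y" "dist p y \<le> dist p x + dist x y"
      using dist_triangle[of p x y] dist_triangle[of p y x] by (simp_all add: dist_commute)
    hence "\<bar>dist p x - dist p y\<bar> \<le> dG act x y" using dist_le_dG[of x y] by linarith
    also have "\<dots> = sqrt (dG act x y) * sqrt (dG act x y)" by simp
    also have "\<dots> \<le> \<epsilon> * sqrt (dG act x y)"
      using xy \<open>\<epsilon> > 0\<close> by (intro mult_right_mono) (simp_all add: real_le_lsqrt)
    finally show ?thesis .
  qed
  thus "\<exists>\<eta>>0. \<forall>x y. dG act x y < \<eta> \<longrightarrow>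
      \<bar>apply_bcontfun (Bcontfun (dist p)) x - apply_bcontfun (Bcontfun (dist p)) y\<bar> \<le> \<epsilon> * sqrt (dG act x y)"
    using \<open>\<epsilon> > 0\<close> by (intro exI[of _ "\<epsilon>\<^sup>2"]) (simp add: apply_Bcontfun continuous_on_dist continuous_on_const continuous_on_id)
qed

lemma dG_separable_imp_RN:
  assumes sep: "pm_separable UNIV (dG act)"
  shows "RN TYPE('v + real) act"
proof -
  obtain j :: "('x \<Rightarrow>\<^sub>C real) \<Rightarrow> real" where j: "inj j" using ex_inj_bcontfun_real[OF sep] by blast
  define \<iota> :: "('x \<Rightarrow>\<^sub>C real) \<Rightarrow> 'v + real" where "\<iota> f = Inr (j f)" for f
  have inj: "inj \<iota>" using j by (auto simp: \<iota>_def inj_def)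
  interpret cn: carried_norm \<iota> little_hoelder hoelder_norm
    using inj by (rule carried_norm_little_hoelder)
  interpret nv: normed_vspace cn.V by (rule cn.normed_vspace_V)
  define h where "h g v = \<iota> (translate g (inv \<iota> v))" for g v
  define \<alpha> where "\<alpha> x = restrict (\<lambda>v. apply_bcontfun (inv \<iota> v) x) (\<iota> ` little_hoelder)" for x
  have h: "h g (\<iota> f) = \<iota> (translate g f)" for g f by (simp add: h_def)
  have \<alpha>: "\<alpha> x (\<iota> f) = f x" if "f \<in> little_hoelder" for x f using that by (simp add: \<alpha>_def)
  have \<alpha>_le: "\<bar>\<alpha> x v\<bar> \<le> 1 * vnorm cn.V v" if "v \<in> vcarrier cn.V" for x v
    using that hoelder_bound_norm by (auto simp: \<alpha> hoelder_bound_def)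
  have \<alpha>_dual: "\<alpha> x \<in> dual cn.V" for x
    unfolding dual_def mem_Collect_eq
  proof (intro conjI)
    show "\<alpha> x \<in> extensional (vcarrier cn.V)" by (simp add: \<alpha>_def)
    show "\<exists>C. \<forall>v\<in>vcarrier cn.V. \<bar>\<alpha> x v\<bar> \<le> C * vnorm cn.V v" using \<alpha>_le by blast
  qed (auto simp: \<alpha> little_hoelder_intros)
  have "h g \<in> Iso cn.V" for g
    unfolding Iso_def mem_Collect_eq
  proof (intro conjI)
    have "bij_betw (h g) (\<iota> ` little_hoelder) (\<iota> ` little_hoelder)"
      by (rule bij_betw_byWitness[where f' = "h (- g)"]) (auto simp: h translate_little_hoelder)
    thus "bij_betw (h g) (vcarrier cn.V) (vcarrier cn.V)" by simp
  qed (auto simp: h translate_linear hoelder_norm_translate)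
  moreover have "\<forall>g g'. \<forall>v\<in>vcarrier cn.V. h (g + g') v = h g' (h g v)"
    by (auto simp: h translate_add)
  moreover have "continuous_map euclidean (vtopology cn.V) (\<lambda>g. h g v)" if v: "v \<in> vcarrier cn.V" for v
    unfolding vtopology_def nv.met.continuous_map_to_metric
  proof (intro ballI allI impI)
    obtain f where f: "f \<in> little_hoelder" "v = \<iota> f" using v by auto
    fix g0 :: 'g and \<epsilon> :: real assume "\<epsilon> > 0"
    then obtain U where U: "open U" "g0 \<in> U" "\<forall>g\<in>U. hoelder_norm (translate g f - translate g0 f) < \<epsilon>"
      using translate_continuous[OF f(1)] by blast
    have "h g v \<in> nv.met.mball (h g0 v) \<epsilon>" if "g \<in> U" for g
    proof -
      have "vdist cn.V (h g v) (h g0 v) < \<epsilon>"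
        using U(3) that f by (simp add: h cn.vdist_V translate_little_hoelder)
      moreover have "h g v \<in> vcarrier cn.V" for g using f by (simp add: h translate_little_hoelder)
      ultimately show ?thesis
        unfolding nv.met.in_mball nv.vdist_sym[of "h g0 v"] by (intro conjI)
    qed
    thus "\<exists>U. openin euclidean U \<and> g0 \<in> U \<and> (\<forall>g\<in>U. h g v \<in> nv.met.mball (h g0 v) \<epsilon>)"
      using U(1,2) by (intro exI[of _ U]) simp
  qed
  moreover have "embedding_map euclidean (weak_star cn.V) \<alpha>"
  proof (rule injective_closed_imp_embedding_map)
    show cont: "continuous_map euclidean (weak_star cn.V) \<alpha>"
      unfolding weak_star_def continuous_map_in_subtopology continuous_map_componentwise
    proof (intro conjI ballI)
      show "\<alpha> ` topspace euclidean \<subseteq> extensional (vcarrier cn.V)" by (auto simp: \<alpha>_def)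
      show "continuous_map euclidean euclideanreal (\<lambda>x. \<alpha> x v)" if v: "v \<in> vcarrier cn.V" for v
      proof -
        obtain f where f: "f \<in> little_hoelder" "v = \<iota> f" using v by auto
        thus ?thesis by (simp add: \<alpha>)
      qed
    qed (use \<alpha>_dual in auto)
    have "Hausdorff_space (weak_star cn.V)"
      unfolding weak_star_def by (intro Hausdorff_space_subtopology) (simp add: Hausdorff_space_product_topology)
    moreover have "compact_space (euclidean :: 'x topology)" using compact_UNIV by (simp add: compact_space_def)
    ultimately show "closed_map euclidean (weak_star cn.V) \<alpha>"
      using cont by (intro continuous_imp_closed_map)
    show "inj_on \<alpha> (topspace euclidean)"
    proof (rule inj_onI)
      fix x y assume "\<alpha> x = \<alpha> y"
      hence "\<alpha> x (\<iota> (Bcontfun (dist x))) = \<alpha> y (\<iota> (Bcontfun (dist x)))" by simp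
      hence "dist x x = dist x y"
        by (simp add: \<alpha> dist_little_hoelder apply_Bcontfun continuous_on_dist continuous_on_const continuous_on_id)
      thus "x = y" by simp
    qed
  qed
  moreover have "dual_norm cn.V (\<alpha> x) \<le> 1" for x
    unfolding dual_norm_def
  proof (rule cSUP_least)
    show "{v \<in> vcarrier cn.V. vnorm cn.V v \<le> 1} \<noteq> {}"
    proof -
      have "vzero cn.V \<in> {v \<in> vcarrier cn.V. vnorm cn.V v \<le> 1}"
        using nv.zero_closed nv.norm_zero by simp
      thus ?thesis by blast
    qed
    show "\<bar>\<alpha> x v\<bar> \<le> 1" if "v \<in> {v \<in> vcarrier cn.V. vnorm cn.V v \<le> 1}" for v
      using that \<alpha>_le[of v x] by simp
  qed
  moreover have "\<forall>g x. \<forall>v\<in>vcarrier cn.V. \<alpha> (act g x) v = \<alpha> x (h g v)"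
    by (auto simp: h \<alpha> translate_little_hoelder)
  ultimately show ?thesis
    unfolding RN_def using Asplund_little_hoelder[OF sep inj]
    by (intro exI[of _ cn.V] exI[of _ h] exI[of _ \<alpha>] conjI) auto
qed

end

section \<open>The equivalence of the seven properties\<close>

theorem theorem9p14:
  fixes act :: "'g::topological_group_add \<Rightarrow> 'x::metric_space \<Rightarrow> 'x"
  assumes "compact (UNIV :: 'x set)"
    and "continuous_action act"
  shows "(RN TYPE('v + real) act \<longleftrightarrow> HAE act) \<and>
    (HAE act \<longleftrightarrow> (\<forall>Y. subsystem act Y \<longrightarrow> (\<exists>x. equicontinuity_point act Y x))) \<and>
    ((\<forall>Y. subsystem act Y \<longrightarrow> (\<exists>x. equicontinuity_point act Y x)) \<longleftrightarrow> HNS act) \<and>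
    (HNS act \<longleftrightarrow> dG_fragmented act) \<and>
    (dG_fragmented act \<longleftrightarrow> pm_separable UNIV (dG act)) \<and>
    (pm_separable UNIV (dG act) \<longleftrightarrow>
      (\<forall>F :: 'x \<Rightarrow> real. continuous_on UNIV F \<longrightarrow> s_Asplund act F))"
proof -
  interpret compact_system act
    using assms by unfold_locales
  have "HNS act" if "\<forall>Y. subsystem act Y \<longrightarrow> (\<exists>x. equicontinuity_point act Y x)"
    unfolding HNS_def using that equicontinuity_point_imp_NS by blast
  moreover have "RN TYPE('v + real) act \<longleftrightarrow> pm_separable UNIV (dG act)"
    using RN_imp_dG_separable dG_separable_imp_RN by blast
  moreover have "(\<forall>F :: 'x \<Rightarrow> real. continuous_on UNIV F \<longrightarrow> s_Asplund act F) \<longleftrightarrow> pm_separable UNIV (dG act)"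
    using dG_separable_imp_s_Asplund s_Asplund_imp_dG_separable by blast
  ultimately show ?thesis
    using HAE_imp_equicontinuity_point HNS_imp_dG_separable dG_separable_imp_fragmented
      fragmented_imp_HNS HNS_imp_HAE by blast
qed

end
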